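(* Assume (F1), (F2), (H1), (H2). For each solution $(c,\varphi)$ of the travelling wave problem with $c\ge c^*$ there exists $\eta=\eta(\varphi)\in\mathbb{R}$ such that $$\lim_{\xi\to-\infty}\frac{\varphi(\xi+\eta)}{e^{\lambda_1(c)\xi}}=1\quad\text{if } c>c^*,\qquad \lim_{\xi\to-\infty}\frac{\varphi(\xi+\eta)}{-\xi\, e^{\lambda_1(c)\xi}}=1\quad\text{if } c=c^*.$$ Moreover, $\lim_{\xi\to-\infty}\varphi'(\xi)/\varphi(\xi)=\lambda_1(c)$ for $c\geq c^*$.
   Context: Fix constants $d>0$, $\tau\geq0$, $K>0$, $f:[0,K]^2\to\mathbb{R}$ and $h:\mathbb{R}\to\mathbb{R}$ (partial derivatives of $f$ assumed to exist). (F1) $f\in C([0,K]^2,\mathbb{R})$, $f(0,0)=f(K,K)=0$, $f(u,u)>0$ for $u\in(0,K)$, $\partial_2f(u,v)\geq0$ on $[0,K]^2$. (F2) There exist $M>0$, $\sigma\in(0,1]$ with $0\leq \partial_1f(0,0)u+\partial_2f(0,0)v-f(u,v)\leq M(u+v)^{1+\sigma}$ on $[0,K]^2$, and $\partial_1f(K,K)+\partial_2f(K,K)<0$. (H1) $h\ge0$, even, integrable, $\int_{\mathbb{R}}h=1$. (H2) There is $\lambda_0\in(0,\infty]$ with $\int_0^\infty h(x)e^{\lambda x}dx<\infty$ for all $\lambda<\lambda_0$. Let $G(\lambda)=\int_{\mathbb{R}}h(y)e^{-\lambda y}dy$, $\lambda^+=\lambda_0$ if $\partial_2f(0,0)>0$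 and $\lambda^+=+\infty$ otherwise, $\Delta(c,\lambda)=c\lambda-d[e^{\lambda}+e^{-\lambda}-2]-\partial_1f(0,0)-\partial_2f(0,0)e^{-\lambda c\tau}G(\lambda)$. Let $c^*>0$, $\lambda^*\in(0,\lambda^+)$ be the unique pair with $\Delta(c^*,\lambda^* )=0=\partial_\lambda\Delta(c^*,\lambda^* )$. For $c>c^*$, $\lambda_1(c)$ is the smallest positive zero of $\Delta(c,\cdot)$, and $\lambda_1(c^* ):=\lambda^*$. Notation: $\Delta_1\varphi(\xi)=\varphi(\xi+1)-2\varphi(\xi)+\varphi(\xi-1)$, $(h*\varphi)(\xi)=\int h(y)\varphi(\xi-y)dy$. A solution $(c,\varphi)$: $c>0$ and a differentiable $\varphi:\mathbb{R}\to\mathbb{R}$ with $-c\varphi'+d\Delta_1\varphi+f(\varphi(\xi),(h*\varphi)(\xi-c\tau))=0$ for all $\xi$, $\varphi(-\infty)=0$, $\varphi(+\infty)=K$, $0\le\varphi\le K$. *)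

theory Defs
  imports "HOL-Analysis.Analysis"
begin

definition disc_lap :: "(real \<Rightarrow> real) \<Rightarrow> real \<Rightarrow> real" where
  "disc_lap \<phi> \<xi> = \<phi> (\<xi> + 1) - 2 * \<phi> \<xi> + \<phi> (\<xi> - 1)"

definition conv :: "(real \<Rightarrow> real) \<Rightarrow> (real \<Rightarrow> real) \<Rightarrow> real \<Rightarrow> real" where
  "conv h \<phi> \<xi> = (LINT y|lborel. h y * \<phi> (\<xi> - y))"

definition Gfun :: "(real \<Rightarrow> real) \<Rightarrow> real \<Rightarrow> real" where
  "Gfun h l = (LINT y|lborel. h y * exp (- l * y))"

definition lam_plus :: "real \<Rightarrow> ereal \<Rightarrow> ereal" where
  "lam_plus f2_00 lam0 = (if f2_00 > 0 then lam0 else \<infinity>)"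

text \<open>Characteristic function \<Delta>(c,\<lambda>); f1_00 = \<partial>_1 f(0,0), f2_00 = \<partial>_2 f(0,0).\<close>
definition char_fun ::
  "real \<Rightarrow> real \<Rightarrow> real \<Rightarrow> real \<Rightarrow> (real \<Rightarrow> real) \<Rightarrow> real \<Rightarrow> real \<Rightarrow> real" where
  "char_fun d \<tau> f1_00 f2_00 h c l =
     c * l - d * (exp l + exp (- l) - 2) - f1_00 - f2_00 * exp (- l * c * \<tau>) * Gfun h l"

text \<open>\<lambda>_1(c): the smallest positive zero of \<Delta>(c,.) (within the domain (0,\<lambda>^+) of \<Delta>)
  for c > c*, and \<lambda>* for c = c*.\<close>
definition lambda1 ::
  "real \<Rightarrow> real \<Rightarrow> real \<Rightarrow> real \<Rightarrow> (real \<Rightarrow> real) \<Rightarrow> ereal \<Rightarrow> real \<Rightarrow> real \<Rightarrow> real \<Rightarrow> real" where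
  "lambda1 d \<tau> f1_00 f2_00 h lam0 cstar lamstar c =
     (if c = cstar then lamstar
      else (LEAST l. 0 < l \<and> ereal l < lam_plus f2_00 lam0
                    \<and> char_fun d \<tau> f1_00 f2_00 h c l = 0))"

definition tw_solution ::
  "real \<Rightarrow> real \<Rightarrow> real \<Rightarrow> (real \<Rightarrow> real \<Rightarrow> real) \<Rightarrow> (real \<Rightarrow> real) \<Rightarrow> real \<Rightarrow> (real \<Rightarrow> real) \<Rightarrow> bool" where
  "tw_solution d \<tau> K f h c \<phi> \<longleftrightarrow>
     c > 0 \<and> (\<forall>\<xi>. \<phi> differentiable (at \<xi>)) \<and>
     (\<forall>\<xi>. - c * deriv \<phi> \<xi> + d * disc_lap \<phi> \<xi> + f (\<phi> \<xi>) (conv h \<phi> (\<xi> - c * \<tau>)) = 0) \<and>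
     (\<phi> \<longlongrightarrow> 0) at_bot \<and> (\<phi> \<longlongrightarrow> K) at_top \<and>
     (\<forall>\<xi>. 0 \<le> \<phi> \<xi> \<and> \<phi> \<xi> \<le> K)"

end

(* Near -infinity the profile solves c phi' = int phi(x + a) d rho(a) - b phi - R with a positive
   kernel rho and a superlinear remainder R >= 0, and P(l) = c l + b - int e^(l a) d rho(a) is the
   characteristic function. For l below the first root mu of P, w = e^(-l x) phi satisfies a
   differential inequality with positive zero-order coefficient; integrating it twice gives
   U <= D U' for the second antiderivative U of w, hence a uniform gain in the decay rate, and by
   iteration phi = O(e^(l x)) for every l < mu.
   At l = mu the flux J = c w - int e^(mu a) (V(x + a) - V(x)) d rho(a), with V' = w, satisfies
   J' = -e^(-mu x) R, so it decreases from some l0 > 0 to 0. If w is almost constant, equal to A, on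
   a long interval, then J is almost A P'(mu) there; when P'(mu) = 0 the role of J is played by an
   antiderivative T of -J, which is almost A times half the second moment of e^(mu a) d rho(a). The
   strong maximum principle shows that w, divided by its expected growth, is almost constant near
   points where it almost attains its limes superior or inferior, and so both are determined by l0. *)

theory Submission
  imports Defs
begin

section \<open>Convolution with a kernel having exponential moments\<close>

text \<open>\<phi> is not assumed monotone and the kernel may have unbounded support; both shape the
  estimates. Two integrations are needed below \<mu> because only an integral of the positive
  \<open>w\<close> is monotone: then increments of \<open>U\<close> are at least -|\<alpha>| V x,
  which the first moment of the kernel pays for. Unbounded support is met by allowing errors
  \<epsilon> (1 + t^2) at distance t: this weight eventually beats every linear a priori bound, so
  that Harnack chains are needed on a compact window only, and exponential moments keep its
  integrals finite. No limit of translates is taken; an explicit \<delta> replaces compactness. The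
  atom of the kernel at 1 comes from the discrete Laplacian. It gives transport to the right in the
  maximum principle, strict convexity of \<open>E\<close> and a positive second moment. The
  nonlinearity enters through l0 > 0: zero flux would force R = 0 everywhere, while R has a positive
  limit at +infinity. The linear factor at \<open>c = cstar\<close> arises because \<open>T\<close>
  has slope about -l0 near -infinity.\<close>

lemma real_mvt_bound:
  fixes u v :: "real \<Rightarrow> real"
  assumes "\<And>t. (u has_real_derivative v t) (at t)" "\<And>t. t \<in> closed_segment x y \<Longrightarrow> \<bar>v t\<bar> \<le> B"
  shows "\<bar>u y - u x\<bar> \<le> B * \<bar>y - x\<bar>"
  using field_differentiable_bound[of "closed_segment x y" u v B y x] assms
  by (auto simp: has_field_derivative_at_within)

text \<open>Fourth powers of the distance are the worst weight that occurs: for an almost constant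
  profile the Taylor remainder of the second antiderivative has an error of size (1 + t^2)
  t^2.\<close>

lemma square_weight_le_exp:
  assumes "\<delta> > 0"
  shows "\<exists>C>0. \<forall>x::real. (1 + x\<^sup>2)\<^sup>2 \<le> C * exp (\<delta> * \<bar>x\<bar>)"
proof -
  define k where "k = min 1 (\<delta>\<^sup>2 / 8)"
  have k: "k > 0" "k \<le> 1" "k \<le> \<delta>\<^sup>2 / 8" using assms by (auto simp: k_def)
  have "(1 + x\<^sup>2)\<^sup>2 \<le> (1 / k\<^sup>2) * exp (\<delta> * \<bar>x\<bar>)" for x :: real
  proof -
    have "1 + \<delta> * \<bar>x\<bar> / 2 + (\<delta> * \<bar>x\<bar> / 2)\<^sup>2 / 2 \<le> exp (\<delta> * \<bar>x\<bar> / 2)"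
      using assms by (intro exp_lower_Taylor_quadratic) auto
    moreover have "(\<delta> * \<bar>x\<bar> / 2)\<^sup>2 / 2 = \<delta>\<^sup>2 / 8 * x\<^sup>2" by (simp add: power_mult_distrib power_divide)
    moreover have "k * x\<^sup>2 \<le> \<delta>\<^sup>2 / 8 * x\<^sup>2" using k by (intro mult_right_mono) auto
    moreover have "0 \<le> \<delta> * \<bar>x\<bar> / 2" using assms by simp
    moreover have "k * (1 + x\<^sup>2) = k + k * x\<^sup>2" by (simp add: distrib_left)
    ultimately have "k * (1 + x\<^sup>2) \<le> exp (\<delta> * \<bar>x\<bar> / 2)" using k(2) by linarith
    hence "(k * (1 + x\<^sup>2))\<^sup>2 \<le> (exp (\<delta> * \<bar>x\<bar> / 2))\<^sup>2" using k by (intro power_mono) auto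
    also have "\<dots> = exp (\<delta> * \<bar>x\<bar>)" by (simp add: power2_eq_square flip: exp_add)
    finally have "k\<^sup>2 * (1 + x\<^sup>2)\<^sup>2 \<le> exp (\<delta> * \<bar>x\<bar>)" by (simp only: power_mult_distrib)
    thus ?thesis using k by (simp add: pos_le_divide_eq mult.commute)
  qed
  thus ?thesis using k by (intro exI[of _ "1 / k\<^sup>2"]) auto
qed

text \<open>Only the atom of \<open>\<rho>\<close> at \<open>1\<close>, of mass at least \<open>d0\<close>, is needed for the maximum principle.\<close>
locale kernel =
  fixes \<rho> :: "real measure" and d0 \<Lambda> :: real
  assumes sets_rho [measurable_cong]: "sets \<rho> = sets borel"
    and d0_pos: "d0 > 0"
    and exp_int: "\<And>l. \<bar>l\<bar> < \<Lambda> \<Longrightarrow> integrable \<rho> (\<lambda>\<alpha>. exp (l * \<alpha>))"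
    and atom: "\<And>F. integrable \<rho> F \<Longrightarrow> (\<And>\<alpha>. F \<alpha> \<ge> 0) \<Longrightarrow> d0 * F 1 \<le> (\<integral>\<alpha>. F \<alpha> \<partial>\<rho>)"
begin

lemma space_rho [simp]: "space \<rho> = UNIV"
  using sets_eq_imp_space_eq[OF sets_rho] by simp

definition E :: "real \<Rightarrow> real" where "E a = (\<integral>\<alpha>. exp (a * \<alpha>) \<partial>\<rho>)"

definition S :: "real \<Rightarrow> (real \<Rightarrow> real) \<Rightarrow> real \<Rightarrow> real" where
  "S a u x = (\<integral>\<alpha>. exp (a * \<alpha>) * u (x + \<alpha>) \<partial>\<rho>)"

text \<open>Subtracting \<open>E a\<close> makes the operator vanish on constants:
  \<open>L a\<close> generates the jump process with the tilted jump measure exp (a \<alpha>)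
  d\<rho>, and such generators obey a maximum principle.\<close>

definition L :: "real \<Rightarrow> (real \<Rightarrow> real) \<Rightarrow> real \<Rightarrow> real" where
  "L a u x = S a u x - E a * u x"

lemma E_nonneg: "E a \<ge> 0"
  unfolding E_def by (intro integral_nonneg_AE) auto

lemma exp_abs_int:
  assumes "\<bar>a\<bar> + \<delta> < \<Lambda>" "\<delta> \<ge> 0"
  shows "integrable \<rho> (\<lambda>\<alpha>. exp (a * \<alpha>) * exp (\<delta> * \<bar>\<alpha>\<bar>))"
proof (rule Bochner_Integration.integrable_bound)
  show "integrable \<rho> (\<lambda>\<alpha>. exp ((a + \<delta>) * \<alpha>) + exp ((a - \<delta>) * \<alpha>))"
    using assms by (intro Bochner_Integration.integrable_add exp_int) auto
  show "AE \<alpha> in \<rho>. norm (exp (a * \<alpha>) * exp (\<delta> * \<bar>\<alpha>\<bar>)) \<le> norm (exp ((a + \<delta>) * \<alpha>) + exp ((a - \<delta>) * \<alpha>))"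
  proof (rule AE_I2)
    fix \<alpha> :: real
    have "exp (a * \<alpha>) * exp (\<delta> * \<bar>\<alpha>\<bar>) = exp ((a + \<delta>) * \<alpha>) \<or> exp (a * \<alpha>) * exp (\<delta> * \<bar>\<alpha>\<bar>) = exp ((a - \<delta>) * \<alpha>)"
      by (cases "\<alpha> < 0") (simp_all add: algebra_simps flip: exp_add)
    moreover have "exp ((a + \<delta>) * \<alpha>) > 0" "exp ((a - \<delta>) * \<alpha>) > 0" by auto
    ultimately show "norm (exp (a * \<alpha>) * exp (\<delta> * \<bar>\<alpha>\<bar>)) \<le> norm (exp ((a + \<delta>) * \<alpha>) + exp ((a - \<delta>) * \<alpha>))"
      unfolding real_norm_def by (smt (verit))
  qed
qed measurable

lemma dominated_int:
  assumes "\<bar>a\<bar> + \<delta> < \<Lambda>" "\<delta> \<ge> 0" and [measurable]: "F \<in> borel_measurable borel"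
    and "\<And>\<alpha>. \<bar>F \<alpha>\<bar> \<le> C * (exp (a * \<alpha>) * exp (\<delta> * \<bar>\<alpha>\<bar>))"
  shows "integrable \<rho> F"
proof (rule Bochner_Integration.integrable_bound)
  show "integrable \<rho> (\<lambda>\<alpha>. C * (exp (a * \<alpha>) * exp (\<delta> * \<bar>\<alpha>\<bar>)))"
    using assms by (intro integrable_mult_right exp_abs_int) auto
  show "AE \<alpha> in \<rho>. norm (F \<alpha>) \<le> norm (C * (exp (a * \<alpha>) * exp (\<delta> * \<bar>\<alpha>\<bar>)))"
    using assms(4) by (intro AE_I2) (auto intro: order_trans[OF _ abs_ge_self] simp del: abs_mult)
qed measurable

lemma moment_int:
  assumes "\<bar>a\<bar> < \<Lambda>" and [measurable]: "F \<in> borel_measurable borel"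
    and F: "\<And>\<alpha>. \<bar>F \<alpha>\<bar> \<le> C * (exp (a * \<alpha>) * (1 + \<alpha>\<^sup>2)\<^sup>2)" and C: "C \<ge> 0"
  shows "integrable \<rho> F"
proof -
  define \<delta> where "\<delta> = (\<Lambda> - \<bar>a\<bar>) / 2"
  have d: "\<delta> > 0" "\<bar>a\<bar> + \<delta> < \<Lambda>" using assms(1) by (auto simp: \<delta>_def field_simps)
  obtain D where D: "D > 0" "\<And>x::real. (1 + x\<^sup>2)\<^sup>2 \<le> D * exp (\<delta> * \<bar>x\<bar>)"
    using square_weight_le_exp[OF d(1)] by auto
  have "\<bar>F \<alpha>\<bar> \<le> (C * D) * (exp (a * \<alpha>) * exp (\<delta> * \<bar>\<alpha>\<bar>))" for \<alpha>
  proof -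
    have "\<bar>F \<alpha>\<bar> \<le> C * (exp (a * \<alpha>) * (1 + \<alpha>\<^sup>2)\<^sup>2)" by (rule F)
    also have "\<dots> \<le> C * (exp (a * \<alpha>) * (D * exp (\<delta> * \<bar>\<alpha>\<bar>)))"
      using C D by (intro mult_left_mono) auto
    finally show ?thesis by (simp add: ac_simps)
  qed
  thus ?thesis using d by (intro dominated_int[of a \<delta> F]) auto
qed

lemma shift_int:
  assumes "\<bar>a\<bar> + \<delta> < \<Lambda>" "\<delta> \<ge> 0" and "continuous_on UNIV u"
    and u: "\<And>t. \<bar>u t\<bar> \<le> C * exp (\<delta> * \<bar>t\<bar>)"
  shows "integrable \<rho> (\<lambda>\<alpha>. exp (a * \<alpha>) * u (x + \<alpha>))"
proof (rule dominated_int[of a \<delta> _ "C * exp (\<delta> * \<bar>x\<bar>)"])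
  have [measurable]: "u \<in> borel_measurable borel"
    using assms(3) by (rule borel_measurable_continuous_onI)
  show "(\<lambda>\<alpha>. exp (a * \<alpha>) * u (x + \<alpha>)) \<in> borel_measurable borel" by measurable
  have C: "C \<ge> 0" using u[of 0] by auto
  show "\<bar>exp (a * \<alpha>) * u (x + \<alpha>)\<bar> \<le> C * exp (\<delta> * \<bar>x\<bar>) * (exp (a * \<alpha>) * exp (\<delta> * \<bar>\<alpha>\<bar>))" for \<alpha>
  proof -
    have "\<bar>u (x + \<alpha>)\<bar> \<le> C * exp (\<delta> * \<bar>x + \<alpha>\<bar>)" by (rule u)
    also have "\<dots> \<le> C * (exp (\<delta> * \<bar>x\<bar>) * exp (\<delta> * \<bar>\<alpha>\<bar>))"
      using C assms(2) by (auto simp flip: exp_add distrib_left intro!: mult_left_mono)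
    finally show ?thesis by (simp add: abs_mult ac_simps)
  qed
qed (use assms in auto)

lemma L_eq:
  assumes "\<bar>a\<bar> < \<Lambda>" "integrable \<rho> (\<lambda>\<alpha>. exp (a * \<alpha>) * u (x + \<alpha>))"
  shows "L a u x = (\<integral>\<alpha>. exp (a * \<alpha>) * (u (x + \<alpha>) - u x) \<partial>\<rho>)"
proof -
  have "(\<integral>\<alpha>. exp (a * \<alpha>) * (u (x + \<alpha>) - u x) \<partial>\<rho>)
      = (\<integral>\<alpha>. (exp (a * \<alpha>) * u (x + \<alpha>) - u x * exp (a * \<alpha>)) \<partial>\<rho>)"
    by (intro Bochner_Integration.integral_cong) (auto simp: algebra_simps)
  also have "\<dots> = S a u x - u x * E a"
    unfolding S_def E_def using assms exp_int[of a]
    by (subst Bochner_Integration.integral_diff) auto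
  finally show ?thesis by (simp add: L_def)
qed

text \<open>Dominated convergence along an arbitrary null sequence: the mean value theorem bounds
  the difference quotients by the growth bound of \<open>v\<close> on a segment of length at most
  \<open>B\<close>, which the spare exponential moment \<delta> dominates.\<close>

lemma S_has_derivative:
  assumes a: "\<bar>a\<bar> + \<delta> < \<Lambda>" "\<delta> \<ge> 0" and du: "\<And>t. (u has_real_derivative v t) (at t)"
    and cv: "continuous_on UNIV v"
    and u: "\<And>t. \<bar>u t\<bar> \<le> C * exp (\<delta> * \<bar>t\<bar>)" and v: "\<And>t. \<bar>v t\<bar> \<le> D * exp (\<delta> * \<bar>t\<bar>)"
  shows "(S a u has_real_derivative S a v x) (at x)"
proof -
  have cu: "continuous_on UNIV u"
    using du by (meson DERIV_isCont continuous_at_imp_continuous_on)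
  have [measurable]: "u \<in> borel_measurable borel" "v \<in> borel_measurable borel"
    using cu cv by (auto intro: borel_measurable_continuous_onI)
  have D: "D \<ge> 0" using v[of 0] by auto
  have "(\<lambda>h. (S a u (x + h) - S a u x) / h) \<midarrow>0\<rightarrow> S a v x"
    unfolding tendsto_at_iff_sequentially
  proof (intro allI impI, unfold o_def)
    fix X :: "nat \<Rightarrow> real" assume X: "\<forall>i. X i \<in> UNIV - {0}" "X \<longlonglongrightarrow> 0"
    obtain B where B: "\<And>n. \<bar>X n\<bar> \<le> B"
      using X(2) by (metis Bseq_def convergentI convergent_imp_Bseq real_norm_def)
    define q where "q n \<alpha> = exp (a * \<alpha>) * ((u (x + X n + \<alpha>) - u (x + \<alpha>)) / X n)" for n \<alpha>
    have q: "(S a u (x + X n) - S a u x) / X n = (\<integral>\<alpha>. q n \<alpha> \<partial>\<rho>)" for n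
    proof -
      have "(\<integral>\<alpha>. q n \<alpha> \<partial>\<rho>) = (\<integral>\<alpha>. (exp (a * \<alpha>) * u (x + X n + \<alpha>) - exp (a * \<alpha>) * u (x + \<alpha>)) / X n \<partial>\<rho>)"
        unfolding q_def by (intro Bochner_Integration.integral_cong) (auto simp: algebra_simps)
      also have "\<dots> = (S a u (x + X n) - S a u x) / X n"
        unfolding S_def using shift_int[OF a cu u]
        by (subst Bochner_Integration.integral_divide_zero, subst Bochner_Integration.integral_diff) auto
      finally show ?thesis by simp
    qed
    have "(\<lambda>n. \<integral>\<alpha>. q n \<alpha> \<partial>\<rho>) \<longlonglongrightarrow> S a v x"
      unfolding S_def
    proof (rule integral_dominated_convergence)
      show "(\<lambda>\<alpha>. exp (a * \<alpha>) * v (x + \<alpha>)) \<in> borel_measurable \<rho>" by measurable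
      show "q n \<in> borel_measurable \<rho>" for n unfolding q_def by measurable
      show "integrable \<rho> (\<lambda>\<alpha>. D * exp (\<delta> * (\<bar>x\<bar> + B)) * (exp (a * \<alpha>) * exp (\<delta> * \<bar>\<alpha>\<bar>)))"
        using a by (intro integrable_mult_right exp_abs_int) auto
      show "AE \<alpha> in \<rho>. (\<lambda>n. q n \<alpha>) \<longlonglongrightarrow> exp (a * \<alpha>) * v (x + \<alpha>)"
      proof (rule AE_I2)
        fix \<alpha>
        have "(\<lambda>h. (u (x + \<alpha> + h) - u (x + \<alpha>)) / h) \<midarrow>0\<rightarrow> v (x + \<alpha>)"
          using du by (simp add: DERIV_def)
        hence "(\<lambda>n. (u (x + \<alpha> + X n) - u (x + \<alpha>)) / X n) \<longlonglongrightarrow> v (x + \<alpha>)"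
          using X unfolding tendsto_at_iff_sequentially o_def by blast
        thus "(\<lambda>n. q n \<alpha>) \<longlonglongrightarrow> exp (a * \<alpha>) * v (x + \<alpha>)"
          unfolding q_def by (intro tendsto_mult_left) (simp add: add_ac)
      qed
      show "AE \<alpha> in \<rho>. norm (q n \<alpha>) \<le> D * exp (\<delta> * (\<bar>x\<bar> + B)) * (exp (a * \<alpha>) * exp (\<delta> * \<bar>\<alpha>\<bar>))" for n
      proof (rule AE_I2)
        fix \<alpha>
        have "\<bar>u (x + X n + \<alpha>) - u (x + \<alpha>)\<bar> \<le> (D * exp (\<delta> * (\<bar>x\<bar> + B + \<bar>\<alpha>\<bar>))) * \<bar>(x + X n + \<alpha>) - (x + \<alpha>)\<bar>"
        proof (rule real_mvt_bound[OF du])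
          fix t assume "t \<in> closed_segment (x + \<alpha>) (x + X n + \<alpha>)"
          hence "\<bar>t\<bar> \<le> \<bar>x\<bar> + B + \<bar>\<alpha>\<bar>" using B[of n] by (auto simp: closed_segment_eq_real_ivl split: if_splits)
          hence "D * exp (\<delta> * \<bar>t\<bar>) \<le> D * exp (\<delta> * (\<bar>x\<bar> + B + \<bar>\<alpha>\<bar>))"
            using D a by (intro mult_left_mono) (auto intro: mult_left_mono)
          thus "\<bar>v t\<bar> \<le> D * exp (\<delta> * (\<bar>x\<bar> + B + \<bar>\<alpha>\<bar>))" using v[of t] by linarith
        qed
        hence "\<bar>u (x + X n + \<alpha>) - u (x + \<alpha>)\<bar> / \<bar>X n\<bar> \<le> D * exp (\<delta> * (\<bar>x\<bar> + B + \<bar>\<alpha>\<bar>))"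
          using X(1) by (auto simp: divide_le_eq)
        hence "exp (a * \<alpha>) * (\<bar>u (x + X n + \<alpha>) - u (x + \<alpha>)\<bar> / \<bar>X n\<bar>) \<le> exp (a * \<alpha>) * (D * exp (\<delta> * (\<bar>x\<bar> + B + \<bar>\<alpha>\<bar>)))"
          by (intro mult_left_mono) auto
        thus "norm (q n \<alpha>) \<le> D * exp (\<delta> * (\<bar>x\<bar> + B)) * (exp (a * \<alpha>) * exp (\<delta> * \<bar>\<alpha>\<bar>))"
          by (simp add: q_def abs_mult abs_divide exp_add distrib_left ac_simps)
      qed
    qed
    thus "(\<lambda>n. (S a u (x + X n) - S a u x) / X n) \<longlonglongrightarrow> S a v x" by (simp add: q)
  qed
  thus ?thesis by (simp add: DERIV_def)
qed

lemma L_has_derivative: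
  assumes a: "\<bar>a\<bar> + \<delta> < \<Lambda>" "\<delta> \<ge> 0" and du: "\<And>t. (u has_real_derivative v t) (at t)"
    and cv: "continuous_on UNIV v"
    and u: "\<And>t. \<bar>u t\<bar> \<le> C * exp (\<delta> * \<bar>t\<bar>)" and v: "\<And>t. \<bar>v t\<bar> \<le> D * exp (\<delta> * \<bar>t\<bar>)"
  shows "(L a u has_real_derivative L a v x) (at x)"
  unfolding L_def[abs_def]
  by (intro DERIV_diff S_has_derivative[OF assms] DERIV_cmult du)

end

section \<open>Harnack inequalities and the maximum principle\<close>

text \<open>The bound makes every antiderivative bounded below, so subtracting its infimum
  normalises it to vanish at -infinity without an improper integral.\<close>

lemma exp_bounded_antiderivative:
  fixes w :: "real \<Rightarrow> real"
  assumes cw: "continuous_on UNIV w" and \<eta>: "\<eta> > 0"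
    and w: "\<And>x. 0 \<le> w x" "\<And>x. w x \<le> C * exp (\<eta> * x)"
  obtains V where "\<And>x. (V has_real_derivative w x) (at x)"
    "\<And>x. 0 \<le> V x" "\<And>x. V x \<le> C / \<eta> * exp (\<eta> * x)"
proof -
  have "\<exists>F. \<forall>x::real. (- \<infinity>) < ereal x \<longrightarrow> ereal x < \<infinity> \<longrightarrow> (F has_vector_derivative w x) (at x)"
    using cw by (intro einterval_antiderivative) (auto simp: continuous_on_eq_continuous_at)
  then obtain F where F: "\<And>x. (F has_real_derivative w x) (at x)"
    by (auto simp: has_real_derivative_iff_has_vector_derivative)
  have C: "C \<ge> 0" using w[of 0] by simp
  have mono: "F x \<le> F y" if "x \<le> y" for x y
    using that by (rule DERIV_nonneg_imp_nondecreasing) (use F w in blast)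
  have low: "F x - C / \<eta> * exp (\<eta> * x) \<le> F y" for x y
  proof (cases "y \<le> x")
    case True
    have "C / \<eta> * exp (\<eta> * y) - F y \<le> C / \<eta> * exp (\<eta> * x) - F x"
    proof (rule DERIV_nonneg_imp_nondecreasing[OF True])
      fix t
      have "((\<lambda>t. C / \<eta> * exp (\<eta> * t) - F t) has_real_derivative (C * exp (\<eta> * t) - w t)) (at t)"
        by (rule derivative_eq_intros F refl | use \<eta> in simp)+
      thus "\<exists>d. ((\<lambda>t. C / \<eta> * exp (\<eta> * t) - F t) has_real_derivative d) (at t) \<and> 0 \<le> d"
        using w(2)[of t] by auto
    qed
    moreover have "0 \<le> C / \<eta> * exp (\<eta> * y)" using C \<eta> by simp
    ultimately show ?thesis by linarith
  next
    case False
    have "0 \<le> C / \<eta> * exp (\<eta> * x)" using C \<eta> by simp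
    thus ?thesis using mono[of x y] False by linarith
  qed
  have bdd: "bdd_below (range F)" using low[of 0] by (intro bdd_belowI2)
  define I where "I = (INF x. F x)"
  have "I \<le> F x" for x unfolding I_def using bdd by (intro cINF_lower) auto
  moreover have "F x - C / \<eta> * exp (\<eta> * x) \<le> I" for x
    unfolding I_def using low by (intro cINF_greatest) auto
  ultimately show ?thesis
    by (intro that[of "\<lambda>x. F x - I"]) (auto intro!: derivative_eq_intros F simp: algebra_simps)
qed

text \<open>Integrating factor exp (B s); the source \<eta> is absorbed by a linear term of slope
  \<eta> exp (B t'), since exp (B t') is the largest value of the factor. A small value at t' forces
  small values to its left.\<close>

lemma weak_harnack_left:
  fixes y y' :: "real \<Rightarrow> real"
  assumes "t \<le> t'" "B \<ge> 0" "\<eta> \<ge> 0"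
    and dy: "\<And>s. t \<le> s \<Longrightarrow> s \<le> t' \<Longrightarrow> (y has_real_derivative y' s) (at s)"
    and y': "\<And>s. t \<le> s \<Longrightarrow> s \<le> t' \<Longrightarrow> y' s \<ge> - B * y s - \<eta>"
  shows "y t \<le> exp (B * (t' - t)) * (y t' + \<eta> * (t' - t))"
proof -
  define f where "f s = exp (B * s) * y s + \<eta> * exp (B * t') * s" for s
  have "f t \<le> f t'"
  proof (rule DERIV_nonneg_imp_nondecreasing[OF assms(1)])
    fix s assume s: "t \<le> s" "s \<le> t'"
    have "(f has_real_derivative (exp (B * s) * (B * y s + y' s) + \<eta> * exp (B * t'))) (at s)"
      unfolding f_def by (rule derivative_eq_intros dy s refl | simp add: algebra_simps)+
    moreover have "exp (B * s) * (B * y s + y' s) \<ge> exp (B * s) * (- \<eta>)"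
      using y'[OF s] by (intro mult_left_mono) auto
    moreover have "\<eta> * exp (B * s) \<le> \<eta> * exp (B * t')"
      using assms s by (intro mult_left_mono) (auto intro: mult_left_mono)
    ultimately show "\<exists>d. (f has_real_derivative d) (at s) \<and> 0 \<le> d"
      by (intro exI conjI) (assumption, simp add: mult.commute)
  qed
  hence "exp (B * t) * y t \<le> exp (B * t') * (y t' + \<eta> * (t' - t))"
    by (simp add: f_def algebra_simps)
  also have "\<dots> = exp (B * t) * (exp (B * (t' - t)) * (y t' + \<eta> * (t' - t)))"
    by (simp add: right_diff_distrib exp_diff)
  finally show ?thesis by simp
qed

text \<open>The term \<open>D * y (s + 1)\<close> transports information to the right, against the direction
  of \<open>weak_harnack_left\<close>.\<close>
lemma weak_harnack_right:
  fixes y y' :: "real \<Rightarrow> real"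
  assumes "B \<ge> 0" "\<eta> \<ge> 0" "D > 0"
    and nonneg: "\<And>s. y s \<ge> 0"
    and dy: "\<And>s. (y has_real_derivative y' s) (at s)"
    and y': "\<And>s. t - 1/2 \<le> s \<Longrightarrow> s \<le> t + 1 \<Longrightarrow> y' s \<ge> D * y (s + 1) - B * y s - \<eta>"
  shows "y (t + 1/2) \<le> exp (B/2) * (1 + (1 + 2 * exp (B/2)) / D) * (y t + \<eta>)"
proof -
  \<comment> \<open>\<open>Y\<close> bounds \<open>y\<close> from below on [t + 1/2, t + 1], by
    running \<open>weak_harnack_left\<close> from t + 1/2. Through the term
    \<open>D * y (s + 1)\<close> this feeds growth of \<open>y\<close> on [t - 1/2, t], so a large
    value at t + 1/2 forces a large value at t.\<close>
  define Y where "Y = exp (- (B/2)) * y (t + 1/2) - \<eta>"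
  have Y: "Y \<le> y (s + 1)" if s: "t - 1/2 \<le> s" "s \<le> t" for s
  proof -
    have "y (t + 1/2) \<le> exp (B * (s + 1 - (t + 1/2))) * (y (s + 1) + \<eta> * (s + 1 - (t + 1/2)))"
    proof (rule weak_harnack_left[where y = y and y' = y'])
      show "y' r \<ge> - B * y r - \<eta>" if "t + 1/2 \<le> r" "r \<le> s + 1" for r
      proof -
        have "D * y (r + 1) \<ge> 0" using assms by simp
        thus ?thesis using y'[of r] that s by auto
      qed
    qed (use s assms dy in auto)
    also have "\<dots> \<le> exp (B/2) * (y (s + 1) + \<eta>)"
    proof (rule mult_mono)
      have "B * (s + 1 - (t + 1/2)) \<le> B * (1/2)" using s assms by (intro mult_left_mono) auto
      thus "exp (B * (s + 1 - (t + 1/2))) \<le> exp (B/2)" by simp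
      have "\<eta> * (s + 1 - (t + 1/2)) \<le> \<eta> * 1" using s assms by (intro mult_left_mono) auto
      thus "y (s + 1) + \<eta> * (s + 1 - (t + 1/2)) \<le> y (s + 1) + \<eta>" by simp
    qed (use nonneg[of "s + 1"] assms s in auto)
    finally have "exp (- (B/2)) * y (t + 1/2) \<le> exp (- (B/2)) * (exp (B/2) * (y (s + 1) + \<eta>))"
      by (intro mult_left_mono) auto
    also have "\<dots> = y (s + 1) + \<eta>" by (simp add: exp_minus)
    finally show ?thesis by (simp add: Y_def)
  qed
  have main: "D * Y - \<eta> \<le> 2 * exp (B/2) * y t"
  proof (cases "D * Y - \<eta> \<le> 0")
    case True
    moreover have "0 \<le> 2 * exp (B/2) * y t" using nonneg by simp
    ultimately show ?thesis by linarith
  next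
    case False
    define k where "k = exp (B * (t - 1/2)) * (D * Y - \<eta>)"
    define f where "f s = exp (B * s) * y s - k * s" for s
    have "f (t - 1/2) \<le> f t"
    proof (rule DERIV_nonneg_imp_nondecreasing[where f = f])
      fix s assume s: "t - 1/2 \<le> s" "s \<le> t"
      have "(f has_real_derivative (exp (B * s) * (B * y s + y' s) - k)) (at s)"
        unfolding f_def by (rule derivative_eq_intros dy s refl | simp add: algebra_simps)+
      moreover have "k \<le> exp (B * s) * (D * Y - \<eta>)"
        unfolding k_def using False s assms by (intro mult_right_mono) (auto intro: mult_left_mono)
      moreover have "exp (B * s) * (D * Y - \<eta>) \<le> exp (B * s) * (B * y s + y' s)"
      proof (rule mult_left_mono)
        have "D * Y \<le> D * y (s + 1)" using Y[OF s] assms by (intro mult_left_mono) auto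
        thus "D * Y - \<eta> \<le> B * y s + y' s" using y'[of s] s by auto
      qed auto
      ultimately show "\<exists>d. (f has_real_derivative d) (at s) \<and> 0 \<le> d"
        by (intro exI conjI) (assumption, linarith)
    qed auto
    hence "exp (B * (t - 1/2)) * y (t - 1/2) + k / 2 \<le> exp (B * t) * y t"
      by (simp add: f_def algebra_simps)
    moreover have "exp (B * (t - 1/2)) * y (t - 1/2) \<ge> 0" using nonneg by simp
    moreover have "exp (B * t) * y t = exp (B * (t - 1/2)) * (exp (B/2) * y t)"
      by (simp add: algebra_simps flip: exp_add)
    moreover have "k / 2 = exp (B * (t - 1/2)) * ((D * Y - \<eta>) / 2)" by (simp add: k_def)
    ultimately have "exp (B * (t - 1/2)) * ((D * Y - \<eta>) / 2) \<le> exp (B * (t - 1/2)) * (exp (B/2) * y t)"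
      by linarith
    hence "(D * Y - \<eta>) / 2 \<le> exp (B/2) * y t" by (simp only: mult_le_cancel_left_pos exp_gt_zero)
    thus ?thesis by simp
  qed
  have ny: "y t \<ge> 0" by (rule nonneg)
  have "D * Y \<le> \<eta> + 2 * exp (B/2) * y t" using main by linarith
  also have "\<dots> \<le> (1 + 2 * exp (B/2)) * (y t + \<eta>)"
    using ny assms(2) by (simp add: algebra_simps)
  finally have "Y \<le> (1 + 2 * exp (B/2)) / D * (y t + \<eta>)"
    using assms by (simp add: pos_le_divide_eq mult.commute)
  hence "exp (- (B/2)) * y (t + 1/2) \<le> (1 + (1 + 2 * exp (B/2)) / D) * (y t + \<eta>)"
    using ny by (simp add: Y_def distrib_right)
  hence "exp (B/2) * (exp (- (B/2)) * y (t + 1/2)) \<le> exp (B/2) * ((1 + (1 + 2 * exp (B/2)) / D) * (y t + \<eta>))"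
    by (intro mult_left_mono) auto
  moreover have "exp (B/2) * (exp (- (B/2)) * y (t + 1/2)) = y (t + 1/2)" by (simp add: exp_minus)
  ultimately show ?thesis by (simp only: mult.assoc)
qed

section \<open>Quadratic weights for errors at a distance\<close>

lemma peetre: "1 + (s + t)\<^sup>2 \<le> 2 * (1 + s\<^sup>2) * (1 + t\<^sup>2)" for s t :: real
proof -
  have "2 * (1 + s\<^sup>2) * (1 + t\<^sup>2) - (1 + (s + t)\<^sup>2) = 1 + (s - t)\<^sup>2 + 2 * (s * t)\<^sup>2"
    by (simp add: power2_eq_square algebra_simps)
  also have "\<dots> \<ge> 0" by (intro add_nonneg_nonneg) auto
  finally show ?thesis by simp
qed

lemma one_plus_abs_le: "1 + \<bar>t\<bar> \<le> 2 * (1 + t\<^sup>2)" for t :: real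
proof -
  have "2 * (1 + t\<^sup>2) - (1 + \<bar>t\<bar>) = (1 - \<bar>t\<bar> / 2)\<^sup>2 + 7 / 4 * t\<^sup>2"
    by (simp add: power2_eq_square algebra_simps)
  also have "\<dots> \<ge> 0" by (intro add_nonneg_nonneg) auto
  finally show ?thesis by simp
qed

text \<open>Beyond the radius n an a priori bound of linear growth already lies under the quadratic
  tolerance, so that only |t| \<le> n needs an argument.\<close>

lemma linear_le_square_weight:
  assumes "\<epsilon> > 0"
  shows "\<exists>n::nat. \<forall>t::real. \<bar>t\<bar> \<ge> n \<longrightarrow> C * (1 + \<bar>t\<bar>) \<le> \<epsilon> * (1 + t\<^sup>2)"
proof -
  obtain n :: nat where n: "real n \<ge> 2 * \<bar>C\<bar> / \<epsilon> + 1" using real_arch_simple by blast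
  have "C * (1 + \<bar>t\<bar>) \<le> \<epsilon> * (1 + t\<^sup>2)" if t: "\<bar>t\<bar> \<ge> n" for t :: real
  proof -
    have "2 * \<bar>C\<bar> / \<epsilon> \<le> \<bar>t\<bar>" "1 \<le> \<bar>t\<bar>"
      using n t assms by (auto intro: order_trans[OF _ order_trans[OF n t]])
    hence "2 * \<bar>C\<bar> \<le> \<epsilon> * \<bar>t\<bar>" using assms by (simp add: pos_divide_le_eq mult.commute)
    have "C * (1 + \<bar>t\<bar>) \<le> \<bar>C\<bar> * (\<bar>t\<bar> + \<bar>t\<bar>)"
      using \<open>1 \<le> \<bar>t\<bar>\<close> by (intro mult_mono) auto
    also have "\<dots> = 2 * \<bar>C\<bar> * \<bar>t\<bar>" by simp
    also have "\<dots> \<le> \<epsilon> * \<bar>t\<bar> * \<bar>t\<bar>" using \<open>2 * \<bar>C\<bar> \<le> \<epsilon> * \<bar>t\<bar>\<close> by (intro mult_right_mono) auto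
    also have "\<dots> = \<epsilon> * t\<^sup>2" by (simp add: power2_eq_square)
    also have "\<dots> \<le> \<epsilon> * (1 + t\<^sup>2)" using assms by simp
    finally show ?thesis .
  qed
  thus ?thesis by blast
qed

context kernel
begin

lemma weight_int:
  assumes "\<bar>a\<bar> < \<Lambda>"
  shows "integrable \<rho> (\<lambda>\<alpha>. exp (a * \<alpha>) * (1 + (s + \<alpha>)\<^sup>2))"
proof (rule moment_int[OF assms, of _ "2 * (1 + s\<^sup>2)"])
  show "\<bar>exp (a * \<alpha>) * (1 + (s + \<alpha>)\<^sup>2)\<bar> \<le> 2 * (1 + s\<^sup>2) * (exp (a * \<alpha>) * (1 + \<alpha>\<^sup>2)\<^sup>2)" for \<alpha>
  proof -
    have "1 + (s + \<alpha>)\<^sup>2 \<le> 2 * (1 + s\<^sup>2) * (1 + \<alpha>\<^sup>2)" by (rule peetre)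
    also have "\<dots> \<le> 2 * (1 + s\<^sup>2) * (1 + \<alpha>\<^sup>2)\<^sup>2"
      by (intro mult_left_mono self_le_power) auto
    finally have "exp (a * \<alpha>) * (1 + (s + \<alpha>)\<^sup>2) \<le> exp (a * \<alpha>) * (2 * (1 + s\<^sup>2) * (1 + \<alpha>\<^sup>2)\<^sup>2)"
      by (intro mult_left_mono) auto
    thus ?thesis by (simp add: abs_mult ac_simps)
  qed
qed auto

lemma quadratic_growth_shift_int:
  assumes "\<bar>a\<bar> < \<Lambda>" "continuous_on UNIV u" "\<And>t. \<bar>u t\<bar> \<le> C * (1 + t\<^sup>2)"
  shows "integrable \<rho> (\<lambda>\<alpha>. exp (a * \<alpha>) * u (x + \<alpha>))"
proof (rule Bochner_Integration.integrable_bound)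
  show "integrable \<rho> (\<lambda>\<alpha>. C * (exp (a * \<alpha>) * (1 + (x + \<alpha>)\<^sup>2)))"
    using assms by (intro integrable_mult_right weight_int)
  have [measurable]: "u \<in> borel_measurable borel"
    using assms(2) by (rule borel_measurable_continuous_onI)
  show "(\<lambda>\<alpha>. exp (a * \<alpha>) * u (x + \<alpha>)) \<in> borel_measurable \<rho>" by measurable
  show "AE \<alpha> in \<rho>. norm (exp (a * \<alpha>) * u (x + \<alpha>)) \<le> norm (C * (exp (a * \<alpha>) * (1 + (x + \<alpha>)\<^sup>2)))"
  proof (rule AE_I2)
    fix \<alpha>
    have "exp (a * \<alpha>) * \<bar>u (x + \<alpha>)\<bar> \<le> exp (a * \<alpha>) * (C * (1 + (x + \<alpha>)\<^sup>2))"
      by (intro mult_left_mono assms) auto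
    also have "\<dots> = C * (exp (a * \<alpha>) * (1 + (x + \<alpha>)\<^sup>2))" by (simp only: mult.left_commute)
    also have "\<dots> \<le> norm (C * (exp (a * \<alpha>) * (1 + (x + \<alpha>)\<^sup>2)))" by (simp only: real_norm_def abs_ge_self)
    finally show "norm (exp (a * \<alpha>) * u (x + \<alpha>)) \<le> norm (C * (exp (a * \<alpha>) * (1 + (x + \<alpha>)\<^sup>2)))"
      by (simp only: real_norm_def abs_mult abs_exp_cancel)
  qed
qed

lemma moment1_int: "\<bar>l\<bar> < \<Lambda> \<Longrightarrow> integrable \<rho> (\<lambda>\<alpha>. exp (l * \<alpha>) * \<alpha>)"
proof (rule moment_int[of l _ 2])
  fix \<alpha> :: real
  have "\<bar>\<alpha>\<bar> \<le> 2 * (1 + \<alpha>\<^sup>2)" using one_plus_abs_le[of \<alpha>] by simp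
  also have "\<dots> \<le> 2 * (1 + \<alpha>\<^sup>2)\<^sup>2" by (intro mult_left_mono self_le_power) auto
  finally have "exp (l * \<alpha>) * \<bar>\<alpha>\<bar> \<le> exp (l * \<alpha>) * (2 * (1 + \<alpha>\<^sup>2)\<^sup>2)" by (intro mult_left_mono) auto
  thus "\<bar>exp (l * \<alpha>) * \<alpha>\<bar> \<le> 2 * (exp (l * \<alpha>) * (1 + \<alpha>\<^sup>2)\<^sup>2)" by (simp add: abs_mult mult.left_commute)
qed auto

text \<open>The strong maximum principle in quantitative form: smallness at \<open>0\<close> travels to the right in steps
  of length \<open>1/2\<close> by \<open>weak_harnack_right\<close> and back to the left by \<open>weak_harnack_left\<close>.\<close>
lemma propagation:
  assumes c: "c > 0" and a: "\<bar>a\<bar> < \<Lambda>" and \<epsilon>: "\<epsilon> > 0"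
  shows "\<exists>\<delta>>0. \<forall>z z'. (\<forall>t. (z has_real_derivative z' t) (at t)) \<longrightarrow> (\<forall>t. \<bar>z t\<bar> \<le> C * (1 + \<bar>t\<bar>)) \<longrightarrow>
    (\<forall>t. z t \<ge> - \<delta> * (1 + t\<^sup>2)) \<longrightarrow> (\<forall>t. \<bar>c * z' t - L a z t\<bar> \<le> \<delta> * (1 + t\<^sup>2)) \<longrightarrow> z 0 \<le> \<delta> \<longrightarrow>
    (\<forall>t. \<bar>z t\<bar> \<le> \<epsilon> * (1 + t\<^sup>2))"
proof -
  obtain n :: nat where n: "\<And>t::real. \<bar>t\<bar> \<ge> n \<Longrightarrow> C * (1 + \<bar>t\<bar>) \<le> \<epsilon> * (1 + t\<^sup>2)"
    using linear_le_square_weight[OF \<epsilon>] by blast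
  define D where "D = d0 * exp a / c"
  define B where "B = E a / c"
  \<comment> \<open>By \<open>peetre\<close>, \<delta> M (1 + s^2) bounds the effect in
    \<open>S\<close> of adding the weight \<delta> (1 + t^2) to \<open>z\<close>.\<close>
  define M where "M = 2 * (\<integral>\<alpha>. exp (a * \<alpha>) * (1 + (0 + \<alpha>)\<^sup>2) \<partial>\<rho>)"
  \<comment> \<open>The summands M, 1 and c pay for the weight inside \<open>S\<close>, for the
    defect of the equation and for the derivative of the weight. The window reaches to n + 1 since a
    Harnack step looks beyond its endpoints.\<close>
  define \<kappa> where "\<kappa> = (1 + (real n + 1)\<^sup>2) * (M + 1 + c) / c"
  \<comment> \<open>The added 1 allows the iteration to run on \<open>y + \<eta>\<close> instead of
    \<open>y\<close>.\<close>
  define Q where "Q = exp (B/2) * (1 + (1 + 2 * exp (B/2)) / D) + 1"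
  \<comment> \<open>The cost of 2n half steps from 0 to n, starting from y 0 + \<eta> \<le> (2 +
    \<kappa>) \<delta>, and of the way back to the left over a distance of at most 2n.\<close>
  define H where "H = exp (2 * n * B) * (Q ^ (2 * n) * (2 + \<kappa>) + 2 * n * \<kappa>)"
  have D: "D > 0" using d0_pos c by (simp add: D_def)
  have B: "B \<ge> 0" using E_nonneg c by (simp add: B_def)
  have M: "M \<ge> 0" unfolding M_def by (intro mult_nonneg_nonneg integral_nonneg_AE AE_I2) auto
  have \<kappa>: "\<kappa> \<ge> 0" using M c by (simp add: \<kappa>_def)
  have Q: "Q \<ge> 1" using D by (simp add: Q_def)
  have H: "H \<ge> 0" unfolding H_def using Q \<kappa> by (intro mult_nonneg_nonneg add_nonneg_nonneg) auto
  define \<delta> where "\<delta> = \<epsilon> / (H + 1)"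
  have \<delta>: "\<delta> > 0" "\<delta> \<le> \<epsilon>" "H * \<delta> \<le> \<epsilon>"
    using \<epsilon> H by (auto simp: \<delta>_def field_simps)
  show ?thesis
  proof (intro exI[of _ \<delta>] conjI allI impI)
    fix z z' :: "real \<Rightarrow> real" and t0 :: real
    assume "\<forall>t. (z has_real_derivative z' t) (at t)" "\<forall>t. \<bar>z t\<bar> \<le> C * (1 + \<bar>t\<bar>)"
      "\<forall>t. z t \<ge> - \<delta> * (1 + t\<^sup>2)" "\<forall>t. \<bar>c * z' t - L a z t\<bar> \<le> \<delta> * (1 + t\<^sup>2)" and z0: "z 0 \<le> \<delta>"
    hence dz: "\<And>t. (z has_real_derivative z' t) (at t)" and zC: "\<And>t. \<bar>z t\<bar> \<le> C * (1 + \<bar>t\<bar>)"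
      and zl: "\<And>t. z t \<ge> - \<delta> * (1 + t\<^sup>2)" and zL: "\<And>t. \<bar>c * z' t - L a z t\<bar> \<le> \<delta> * (1 + t\<^sup>2)"
      by blast+
    define y where "y t = z t + \<delta> * (1 + t\<^sup>2)" for t
    have y0: "y t \<ge> 0" for t using zl[of t] by (simp add: y_def)
    have dy: "(y has_real_derivative (z' t + 2 * \<delta> * t)) (at t)" for t
      unfolding y_def by (rule derivative_eq_intros dz refl | simp)+
    have C0: "C \<ge> 0" using zC[of 0] by simp
    have zsq: "\<bar>z t\<bar> \<le> (2 * C) * (1 + t\<^sup>2)" for t
    proof -
      have "1 + \<bar>t\<bar> \<le> 2 * (1 + t\<^sup>2)" by (rule one_plus_abs_le)
      hence "C * (1 + \<bar>t\<bar>) \<le> C * (2 * (1 + t\<^sup>2))" using C0 by (intro mult_left_mono)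
      also have "\<dots> = (2 * C) * (1 + t\<^sup>2)" by (simp only: ac_simps)
      finally show ?thesis using zC[of t] by (rule order_trans[rotated])
    qed
    have cz: "continuous_on UNIV z"
      using dz by (meson DERIV_isCont continuous_at_imp_continuous_on)
    have zint: "integrable \<rho> (\<lambda>\<alpha>. exp (a * \<alpha>) * z (s + \<alpha>))" for s
      by (rule quadratic_growth_shift_int[OF a cz zsq])
    have S_ge: "S a z s \<ge> d0 * exp a * y (s + 1) - \<delta> * (M * (1 + s\<^sup>2))" for s
    proof -
      have ye: "exp (a * \<alpha>) * y (s + \<alpha>) = exp (a * \<alpha>) * z (s + \<alpha>) + \<delta> * (exp (a * \<alpha>) * (1 + (s + \<alpha>)\<^sup>2))" for \<alpha>
        by (simp add: y_def algebra_simps)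
      have yint: "integrable \<rho> (\<lambda>\<alpha>. exp (a * \<alpha>) * y (s + \<alpha>))"
        unfolding ye by (intro Bochner_Integration.integrable_add integrable_mult_right zint weight_int a)
      have "d0 * (exp (a * 1) * y (s + 1)) \<le> (\<integral>\<alpha>. exp (a * \<alpha>) * y (s + \<alpha>) \<partial>\<rho>)"
        by (rule atom[OF yint]) (simp add: y0)
      also have "\<dots> = (\<integral>\<alpha>. (exp (a * \<alpha>) * z (s + \<alpha>) + \<delta> * (exp (a * \<alpha>) * (1 + (s + \<alpha>)\<^sup>2))) \<partial>\<rho>)"
        by (simp only: ye)
      also have "\<dots> = S a z s + \<delta> * (\<integral>\<alpha>. exp (a * \<alpha>) * (1 + (s + \<alpha>)\<^sup>2) \<partial>\<rho>)"
        unfolding S_def using zint[of s] weight_int[OF a, of s]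
        by (subst Bochner_Integration.integral_add) auto
      finally have 1: "d0 * (exp (a * 1) * y (s + 1)) \<le> S a z s + \<delta> * (\<integral>\<alpha>. exp (a * \<alpha>) * (1 + (s + \<alpha>)\<^sup>2) \<partial>\<rho>)" .
      have "(\<integral>\<alpha>. exp (a * \<alpha>) * (1 + (s + \<alpha>)\<^sup>2) \<partial>\<rho>) \<le> (\<integral>\<alpha>. 2 * (1 + s\<^sup>2) * (exp (a * \<alpha>) * (1 + (0 + \<alpha>)\<^sup>2)) \<partial>\<rho>)"
      proof (rule integral_mono)
        show "exp (a * \<alpha>) * (1 + (s + \<alpha>)\<^sup>2) \<le> 2 * (1 + s\<^sup>2) * (exp (a * \<alpha>) * (1 + (0 + \<alpha>)\<^sup>2))" for \<alpha>
          using mult_left_mono[OF peetre[of s \<alpha>], of "exp (a * \<alpha>)"] by (simp add: ac_simps)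
      qed (intro integrable_mult_right weight_int a)+
      also have "\<dots> = M * (1 + s\<^sup>2)" by (simp add: M_def)
      finally have "\<delta> * (\<integral>\<alpha>. exp (a * \<alpha>) * (1 + (s + \<alpha>)\<^sup>2) \<partial>\<rho>) \<le> \<delta> * (M * (1 + s\<^sup>2))"
        using \<delta>(1) by (intro mult_left_mono) auto
      moreover have "d0 * (exp (a * 1) * y (s + 1)) = d0 * exp a * y (s + 1)" by simp
      ultimately show ?thesis using 1 by linarith
    qed
    define \<eta> where "\<eta> = \<delta> * \<kappa>"
    have \<eta>: "\<eta> \<ge> 0" using \<delta> \<kappa> by (simp add: \<eta>_def)
    have ineq: "z' s + 2 * \<delta> * s \<ge> D * y (s + 1) - B * y s - \<eta>" if s: "\<bar>s\<bar> \<le> real n + 1" for s :: real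
    proof -
      have "\<bar>c * z' s - (S a z s - E a * z s)\<bar> \<le> \<delta> * (1 + s\<^sup>2)" using zL[of s] by (simp add: L_def)
      moreover have "E a * z s \<le> E a * y s"
        using E_nonneg \<delta> by (intro mult_left_mono) (auto simp: y_def)
      moreover have "c * (2 * \<delta> * s) \<ge> - (\<delta> * (c * (1 + s\<^sup>2)))"
      proof -
        have "(1 + s)\<^sup>2 \<ge> 0" by simp
        hence "2 * s \<ge> - (1 + s\<^sup>2)" by (simp add: power2_eq_square algebra_simps)
        hence "(\<delta> * c) * (2 * s) \<ge> (\<delta> * c) * (- (1 + s\<^sup>2))" using \<delta> c by (intro mult_left_mono) auto
        thus ?thesis by (simp add: algebra_simps)
      qed
      moreover have "\<delta> * (M * (1 + s\<^sup>2)) + \<delta> * (1 + s\<^sup>2) + \<delta> * (c * (1 + s\<^sup>2)) = \<delta> * ((1 + s\<^sup>2) * (M + 1 + c))"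
        by (simp only: distrib_left distrib_right ac_simps)
      moreover have "c * (z' s + 2 * \<delta> * s) = c * z' s + c * (2 * \<delta> * s)" by (rule distrib_left)
      ultimately have "c * (z' s + 2 * \<delta> * s) \<ge>
          d0 * exp a * y (s + 1) - E a * y s - \<delta> * ((1 + s\<^sup>2) * (M + 1 + c))"
        using S_ge[of s] by linarith
      moreover have "\<delta> * ((1 + s\<^sup>2) * (M + 1 + c)) \<le> \<delta> * ((1 + (real n + 1)\<^sup>2) * (M + 1 + c))"
      proof -
        have "s\<^sup>2 \<le> (real n + 1)\<^sup>2" using power_mono[OF s, of 2] by simp
        thus ?thesis using \<delta>(1) M c by (intro mult_left_mono mult_right_mono) linarith+
      qed
      moreover have "c * (D * y (s + 1) - B * y s - \<eta>) =
          d0 * exp a * y (s + 1) - E a * y s - \<delta> * ((1 + (real n + 1)\<^sup>2) * (M + 1 + c))"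
      proof -
        have "c * D = d0 * exp a" "c * B = E a" "c * \<eta> = \<delta> * ((1 + (real n + 1)\<^sup>2) * (M + 1 + c))"
          using c by (simp_all add: D_def B_def \<eta>_def \<kappa>_def)
        thus ?thesis by (simp only: right_diff_distrib mult.assoc[symmetric])
      qed
      ultimately have "c * (z' s + 2 * \<delta> * s) \<ge> c * (D * y (s + 1) - B * y s - \<eta>)" by linarith
      thus ?thesis using c by simp
    qed
    have step: "k \<le> 2 * n \<Longrightarrow> y (real k / 2) + \<eta> \<le> Q ^ k * (y 0 + \<eta>)" for k
    proof (induction k)
      case (Suc k)
      have "y (real k / 2 + 1/2) \<le> exp (B/2) * (1 + (1 + 2 * exp (B/2)) / D) * (y (real k / 2) + \<eta>)"
      proof (rule weak_harnack_right[OF B \<eta> D y0 dy])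
        fix s assume "real k / 2 - 1/2 \<le> s" "s \<le> real k / 2 + 1"
        moreover have "real k + 1 \<le> 2 * real n" using Suc.prems by linarith
        ultimately have "\<bar>s\<bar> \<le> real n + 1" by linarith
        thus "z' s + 2 * \<delta> * s \<ge> D * y (s + 1) - B * y s - \<eta>" by (rule ineq)
      qed
      also have "\<dots> = Q * (y (real k / 2) + \<eta>) - (y (real k / 2) + \<eta>)"
        by (simp add: Q_def algebra_simps)
      finally have "y (real (Suc k) / 2) + \<eta> \<le> Q * (y (real k / 2) + \<eta>)"
        using y0[of "real k / 2"] by (simp add: add_divide_distrib add.commute)
      also have "\<dots> \<le> Q * (Q ^ k * (y 0 + \<eta>))" using Suc Q by (intro mult_left_mono) auto
      finally show ?case by (simp add: mult.assoc)
    qed simp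
    have yn: "y n \<le> Q ^ (2 * n) * (2 * \<delta> + \<eta>)"
    proof -
      have "y n + \<eta> \<le> Q ^ (2 * n) * (y 0 + \<eta>)" using step[of "2 * n"] by simp
      also have "\<dots> \<le> Q ^ (2 * n) * (2 * \<delta> + \<eta>)" using z0 Q by (intro mult_left_mono) (auto simp: y_def)
      finally show ?thesis using \<eta> by simp
    qed
    have small: "y s \<le> H * \<delta>" if s: "\<bar>s\<bar> \<le> n" for s :: real
    proof -
      have "y s \<le> exp (B * (n - s)) * (y n + \<eta> * (n - s))"
      proof (rule weak_harnack_left[OF _ B \<eta> dy])
        fix r assume "s \<le> r" "r \<le> real n"
        hence "\<bar>r\<bar> \<le> real n + 1" using s by linarith
        moreover have "D * y (r + 1) \<ge> 0" using D y0 by simp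
        ultimately show "z' r + 2 * \<delta> * r \<ge> - B * y r - \<eta>" using ineq[of r] by linarith
      qed (use s in auto)
      also have "\<dots> \<le> exp (2 * n * B) * (Q ^ (2 * n) * (2 * \<delta> + \<eta>) + \<eta> * (2 * n))"
      proof (rule mult_mono)
        have "B * (n - s) \<le> B * (2 * n)" using s B by (intro mult_left_mono) auto
        thus "exp (B * (n - s)) \<le> exp (2 * n * B)" by (simp add: mult.commute)
        have "\<eta> * (n - s) \<le> \<eta> * (2 * n)" using s \<eta> by (intro mult_left_mono) auto
        thus "y n + \<eta> * (n - s) \<le> Q ^ (2 * n) * (2 * \<delta> + \<eta>) + \<eta> * (2 * n)" using yn by linarith
      qed (use y0[of n] \<eta> s in auto)
      also have "Q ^ (2 * n) * (2 * \<delta> + \<eta>) + \<eta> * (2 * n) = (Q ^ (2 * n) * (2 + \<kappa>) + 2 * n * \<kappa>) * \<delta>"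
        by (simp add: \<eta>_def distrib_left distrib_right)
      also have "exp (2 * n * B) * \<dots> = H * \<delta>" by (simp only: H_def mult.assoc)
      finally show ?thesis .
    qed
    show "\<bar>z t0\<bar> \<le> \<epsilon> * (1 + t0\<^sup>2)"
    proof (cases "\<bar>t0\<bar> \<le> n")
      case True
      have "\<epsilon> * 1 \<le> \<epsilon> * (1 + t0\<^sup>2)" using \<epsilon> by (intro mult_left_mono) auto
      moreover have "z t0 \<le> y t0" using \<delta> by (simp add: y_def)
      ultimately have "z t0 \<le> \<epsilon> * (1 + t0\<^sup>2)" using small[OF True] \<delta> by linarith
      moreover have "\<delta> * (1 + t0\<^sup>2) \<le> \<epsilon> * (1 + t0\<^sup>2)" using \<delta> by (intro mult_right_mono) auto
      ultimately show ?thesis using zl[of t0] by auto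
    next
      case False
      thus ?thesis using n[of t0] zC[of t0] by linarith
    qed
  qed (use \<delta> in auto)
qed

end

section \<open>Exponential decay below the critical rate\<close>

lemma exp_minus_mult_le_iff: "exp (- B) * x \<le> y \<longleftrightarrow> x \<le> exp B * (y :: real)"
  by (simp add: exp_minus divide_inverse[symmetric] mult.commute pos_divide_le_eq)

lemma increment_ge:
  fixes F f :: "real \<Rightarrow> real"
  assumes "\<And>t. (F has_real_derivative f t) (at t)" "\<And>t. x \<le> t \<Longrightarrow> t \<le> x + 1 \<Longrightarrow> m \<le> f t"
  shows "m \<le> F (x + 1) - F x"
proof -
  define g where "g t = F t - m * t" for t
  have "x \<le> x + 1" by simp
  hence "g x \<le> g (x + 1)"
  proof (rule DERIV_nonneg_imp_nondecreasing[where f = g])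
    fix t assume t: "x \<le> t" "t \<le> x + 1"
    have "(g has_real_derivative (f t - m)) (at t)"
      unfolding g_def by (rule derivative_eq_intros assms refl | simp)+
    thus "\<exists>d. (g has_real_derivative d) (at t) \<and> 0 \<le> d" using assms(2)[OF t] by auto
  qed
  thus ?thesis by (simp add: g_def algebra_simps)
qed

lemma abs_le_exp_abs:
  fixes u B :: real
  assumes "0 \<le> u" "u \<le> B * exp (\<eta> * t)" "\<eta> > 0"
  shows "\<bar>u\<bar> \<le> B * exp (\<eta> * \<bar>t\<bar>)"
proof -
  have "0 \<le> B * exp (\<eta> * t)" using assms by linarith
  hence "B \<ge> 0" by (simp add: zero_le_mult_iff)
  hence "B * exp (\<eta> * t) \<le> B * exp (\<eta> * \<bar>t\<bar>)" using assms(3) by (intro mult_left_mono) auto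
  thus ?thesis using assms by linarith
qed

text \<open>An increasing function whose lower bound tends to 0 at -infinity cannot be negative;
  this stands in for integrating an inequality from -infinity.\<close>

lemma nonneg_of_increasing:
  fixes f f' :: "real \<Rightarrow> real"
  assumes df: "\<And>t. t \<le> X \<Longrightarrow> (f has_real_derivative f' t) (at t)" "\<And>t. t \<le> X \<Longrightarrow> f' t \<ge> 0"
    and low: "\<And>t. t \<le> X \<Longrightarrow> f t \<ge> - C * exp (\<eta> * t)" and \<eta>: "\<eta> > 0" and x: "x \<le> X"
  shows "f x \<ge> 0"
proof (rule tendsto_upperbound)
  have "((\<lambda>t. exp (\<eta> * t)) \<longlongrightarrow> 0) at_bot"
    by (rule filterlim_compose[OF exp_at_bot])
      (use \<eta> in \<open>auto intro!: filterlim_tendsto_pos_mult_at_bot[OF tendsto_const] filterlim_ident\<close>)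
  from tendsto_mult_left[OF this, of "- C"] show "((\<lambda>t. - C * exp (\<eta> * t)) \<longlongrightarrow> 0) at_bot" by simp
  show "\<forall>\<^sub>F t in at_bot. - C * exp (\<eta> * t) \<le> f x"
    using eventually_le_at_bot[of x]
  proof eventually_elim
    case (elim t)
    have "f t \<le> f x"
      by (rule DERIV_nonneg_imp_nondecreasing[where f = f, OF elim]) (use df x in \<open>meson order_trans\<close>)
    thus ?case using low[of t] elim x by linarith
  qed
qed simp

context kernel
begin

lemma E_convex:
  assumes "\<bar>a\<bar> < \<Lambda>" "\<bar>l\<bar> < \<Lambda>" "0 \<le> \<theta>" "\<theta> \<le> 1"
  shows "E (\<theta> * a + (1 - \<theta>) * l) \<le> \<theta> * E a + (1 - \<theta>) * E l"
proof -
  have e: "exp ((\<theta> * a + (1 - \<theta>) * l) * \<alpha>) \<le> \<theta> * exp (a * \<alpha>) + (1 - \<theta>) * exp (l * \<alpha>)" for \<alpha>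
    using convex_onD[OF exp_convex, of "1 - \<theta>" "a * \<alpha>" "l * \<alpha>"] assms
    by (simp add: algebra_simps)
  have i: "integrable \<rho> (\<lambda>\<alpha>. \<theta> * exp (a * \<alpha>) + (1 - \<theta>) * exp (l * \<alpha>))"
    using assms by (intro Bochner_Integration.integrable_add integrable_mult_right exp_int)
  have "E (\<theta> * a + (1 - \<theta>) * l) \<le> (\<integral>\<alpha>. \<theta> * exp (a * \<alpha>) + (1 - \<theta>) * exp (l * \<alpha>) \<partial>\<rho>)"
    unfolding E_def
  proof (rule integral_mono[OF _ i e])
    show "integrable \<rho> (\<lambda>\<alpha>. exp ((\<theta> * a + (1 - \<theta>) * l) * \<alpha>))"
      by (rule Bochner_Integration.integrable_bound[OF i])
        (use e in \<open>auto intro!: AE_I2 intro: order_trans[OF _ abs_ge_self]\<close>)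
  qed
  also have "\<dots> = \<theta> * E a + (1 - \<theta>) * E l"
    unfolding E_def using assms exp_int[of a] exp_int[of l]
    by (subst Bochner_Integration.integral_add) auto
  finally show ?thesis .
qed

lemma S_exp_bound:
  assumes "integrable \<rho> (\<lambda>\<alpha>. exp (a * \<alpha>) * u (x + \<alpha>))" "\<bar>a + \<eta>\<bar> < \<Lambda>"
    "\<And>t. u t \<le> C * exp (\<eta> * t)"
  shows "S a u x \<le> C * E (a + \<eta>) * exp (\<eta> * x)"
proof -
  have "S a u x \<le> (\<integral>\<alpha>. C * exp (\<eta> * x) * exp ((a + \<eta>) * \<alpha>) \<partial>\<rho>)"
    unfolding S_def
  proof (rule integral_mono[OF assms(1)])
    show "integrable \<rho> (\<lambda>\<alpha>. C * exp (\<eta> * x) * exp ((a + \<eta>) * \<alpha>))"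
      using assms by (intro integrable_mult_right exp_int)
    fix \<alpha>
    have "exp (a * \<alpha>) * u (x + \<alpha>) \<le> exp (a * \<alpha>) * (C * exp (\<eta> * (x + \<alpha>)))"
      by (intro mult_left_mono assms) auto
    also have "\<dots> = C * exp (\<eta> * x) * exp ((a + \<eta>) * \<alpha>)"
      by (simp add: distrib_left distrib_right exp_add)
    finally show "exp (a * \<alpha>) * u (x + \<alpha>) \<le> C * exp (\<eta> * x) * exp ((a + \<eta>) * \<alpha>)" .
  qed
  also have "\<dots> = C * E (a + \<eta>) * exp (\<eta> * x)" by (simp add: E_def)
  finally show ?thesis .
qed

lemma S_nonneg: "(\<And>t. u t \<ge> 0) \<Longrightarrow> S a u x \<ge> 0"
  unfolding S_def by (intro integral_nonneg_AE AE_I2) auto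

text \<open>The difference of the two sides has a nonnegative derivative, since \<open>L a\<close>
  commutes with differentiation, and its negative part is O(exp (\<eta> t)), so
  \<open>nonneg_of_increasing\<close> applies. It is used twice in a row: a lower bound for the
  derivative of \<open>w\<close> becomes one for \<open>w\<close>, and then one for
  \<open>V\<close>.\<close>

lemma flux_inequality:
  assumes a: "\<bar>a\<bar> + \<eta> < \<Lambda>" and pos: "\<eta> > 0" "0 \<le> \<epsilon>" "\<epsilon> \<le> 1" "\<kappa> \<ge> 0" "c > 0"
    and df: "\<And>t. (f has_real_derivative f' t) (at t)" and f0: "\<And>t. f t \<ge> 0"
    and dU: "\<And>t. (U has_real_derivative V t) (at t)" and cV: "continuous_on UNIV V"
    and V: "\<And>t. 0 \<le> V t" "\<And>t. V t \<le> C * exp (\<eta> * t)"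
    and U: "\<And>t. 0 \<le> U t" "\<And>t. U t \<le> D * exp (\<eta> * t)"
    and ineq: "\<And>t. t \<le> X \<Longrightarrow> c * f' t \<ge> (1 - \<epsilon>) * L a V t + \<kappa> * V t"
    and x: "x \<le> X"
  shows "c * f x \<ge> (1 - \<epsilon>) * L a U x + \<kappa> * U x"
proof -
  define J where "J t = c * f t - ((1 - \<epsilon>) * L a U t + \<kappa> * U t)" for t
  note b = abs_le_exp_abs[OF _ _ pos(1)]
  have cU: "continuous_on UNIV U" using dU by (meson DERIV_isCont continuous_at_imp_continuous_on)
  have a': "\<bar>a + \<eta>\<bar> < \<Lambda>" using a pos(1) by linarith
  have "J x \<ge> 0"
  proof (rule nonneg_of_increasing[OF _ _ _ pos(1) x])
    fix t
    show "(J has_real_derivative (c * f' t - ((1 - \<epsilon>) * L a V t + \<kappa> * V t))) (at t)"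
      unfolding J_def
      by (intro DERIV_diff DERIV_add DERIV_cmult df dU
          L_has_derivative[OF a less_imp_le[OF pos(1)] dU cV b[OF U(1,2)] b[OF V(1,2)]])
    show "c * f' t - ((1 - \<epsilon>) * L a V t + \<kappa> * V t) \<ge> 0" if "t \<le> X" using ineq[OF that] by simp
    have SU: "S a U t \<le> D * E (a + \<eta>) * exp (\<eta> * t)"
      by (rule S_exp_bound[OF shift_int[OF a less_imp_le[OF pos(1)] cU b[OF U(1,2)]] a' U(2)])
    have "(1 - \<epsilon>) * L a U t \<le> (1 - \<epsilon>) * S a U t"
      unfolding L_def using pos U(1) E_nonneg by (intro mult_left_mono) auto
    also have "\<dots> \<le> 1 * S a U t" using pos S_nonneg[of U] U(1) by (intro mult_right_mono) auto
    also have "\<dots> \<le> D * E (a + \<eta>) * exp (\<eta> * t)" using SU by simp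
    finally have "(1 - \<epsilon>) * L a U t \<le> D * E (a + \<eta>) * exp (\<eta> * t)" .
    moreover have "\<kappa> * U t \<le> \<kappa> * (D * exp (\<eta> * t))" using pos U by (intro mult_left_mono) auto
    moreover have "c * f t \<ge> 0" using pos f0 by simp
    moreover have "- (D * E (a + \<eta>) + \<kappa> * D) * exp (\<eta> * t) =
        - (D * E (a + \<eta>) * exp (\<eta> * t)) - \<kappa> * (D * exp (\<eta> * t))" by (simp add: algebra_simps)
    ultimately show "J t \<ge> - (D * E (a + \<eta>) + \<kappa> * D) * exp (\<eta> * t)"
      unfolding J_def by linarith
  qed
  thus ?thesis by (simp add: J_def)
qed

text \<open>For \<alpha> \<ge> 0 the increment of \<open>U\<close> is nonnegative; for \<alpha> < 0
  its derivative is at most \<open>V x\<close> on the segment to the left of x. The need for a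
  monotone \<open>V\<close> is why the differential inequality is integrated twice.\<close>

lemma L_ge_of_mono:
  assumes a: "\<bar>a\<bar> < \<Lambda>" and dU: "\<And>t. (U has_real_derivative V t) (at t)"
    and V: "\<And>t. 0 \<le> V t" "mono V" and int: "integrable \<rho> (\<lambda>\<alpha>. exp (a * \<alpha>) * U (x + \<alpha>))"
    and int1: "integrable \<rho> (\<lambda>\<alpha>. exp (a * \<alpha>) * \<bar>\<alpha>\<bar>)"
  shows "L a U x \<ge> - (\<integral>\<alpha>. exp (a * \<alpha>) * \<bar>\<alpha>\<bar> \<partial>\<rho>) * V x"
proof -
  have mono: "U s \<le> U t" if "s \<le> t" for s t
    using that by (rule DERIV_nonneg_imp_nondecreasing) (use dU V in blast)
  have *: "U (x + \<alpha>) - U x \<ge> - (\<bar>\<alpha>\<bar> * V x)" for \<alpha>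
  proof (cases "\<alpha> \<ge> 0")
    case True
    thus ?thesis using mono[of x "x + \<alpha>"] V(1)[of x]
      by (smt (verit) mult_nonneg_nonneg)
  next
    case False
    have "\<bar>U (x + \<alpha>) - U x\<bar> \<le> V x * \<bar>x + \<alpha> - x\<bar>"
      by (rule real_mvt_bound[OF dU])
        (use False V monoD[OF V(2)] in \<open>auto simp: closed_segment_eq_real_ivl abs_of_nonneg split: if_splits\<close>)
    thus ?thesis by (simp add: mult.commute abs_if split: if_splits)
  qed
  have i0: "integrable \<rho> (\<lambda>\<alpha>. exp (a * \<alpha>) * (U (x + \<alpha>) - U x))"
    using int exp_int[OF a] by (simp add: right_diff_distrib)
  have "- (\<integral>\<alpha>. exp (a * \<alpha>) * \<bar>\<alpha>\<bar> \<partial>\<rho>) * V x = (\<integral>\<alpha>. (- V x) * (exp (a * \<alpha>) * \<bar>\<alpha>\<bar>) \<partial>\<rho>)"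
    by simp
  also have "\<dots> \<le> (\<integral>\<alpha>. exp (a * \<alpha>) * (U (x + \<alpha>) - U x) \<partial>\<rho>)"
  proof (rule integral_mono[OF integrable_mult_right[OF int1] i0])
    show "(- V x) * (exp (a * \<alpha>) * \<bar>\<alpha>\<bar>) \<le> exp (a * \<alpha>) * (U (x + \<alpha>) - U x)" for \<alpha>
      using mult_left_mono[OF *, of "exp (a * \<alpha>)" \<alpha>] by (simp add: ac_simps)
  qed
  also have "\<dots> = L a U x" by (rule L_eq[OF a int, symmetric])
  finally show ?thesis .
qed

end

text \<open>\<open>c * a + b - E a\<close> is the characteristic function at \<open>a\<close>, and \<open>drift\<close> says that its derivative
  at the root \<open>\<mu>\<close> is nonnegative.\<close>
locale wave = kernel +
  fixes c b K M s \<mu> :: real and \<phi> R :: "real \<Rightarrow> real"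
  assumes c_pos: "c > 0" and s_pos: "s > 0" and M_nonneg: "M \<ge> 0" and K_pos: "K > 0"
    and lam: "0 < \<mu>" "\<mu> < \<Lambda>"
    and char_zero: "c * \<mu> + b = E \<mu>"
    and char_neg: "\<And>a. 0 \<le> a \<Longrightarrow> a < \<mu> \<Longrightarrow> c * a + b < E a"
    and drift: "(\<integral>\<alpha>. exp (\<mu> * \<alpha>) * \<alpha> \<partial>\<rho>) \<le> c"
    and dphi: "\<And>x. (\<phi> has_real_derivative (S 0 \<phi> x - b * \<phi> x - R x) / c) (at x)"
    and phi_pos: "\<And>x. \<phi> x > 0" and phi_le: "\<And>x. \<phi> x \<le> K"
    and phi_lim: "(\<phi> \<longlongrightarrow> 0) at_bot"
    and R_nonneg: "\<And>x. R x \<ge> 0"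
    and R_le: "\<And>x. R x \<le> M * (\<phi> x + S 0 \<phi> x) powr (1 + s)"
    and R_pos: "\<exists>x. R x > 0"
begin

lemma Lam_pos: "\<Lambda> > 0" using lam by simp

lemma phi_cont: "continuous_on UNIV \<phi>"
  using dphi by (meson DERIV_isCont continuous_at_imp_continuous_on)

lemma phi_measurable [measurable]: "\<phi> \<in> borel_measurable borel"
  using phi_cont by (rule borel_measurable_continuous_onI)

definition w :: "real \<Rightarrow> real \<Rightarrow> real" where "w a x = exp (- a * x) * \<phi> x"

lemma w_pos: "w a x > 0" using phi_pos by (simp add: w_def)

lemma S_w: "S a (w a) x = exp (- a * x) * S 0 \<phi> x"
proof -
  have "exp (a * \<alpha>) * w a (x + \<alpha>) = exp (- a * x) * \<phi> (x + \<alpha>)" for \<alpha>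
    by (simp add: w_def algebra_simps flip: exp_add mult.assoc)
  thus ?thesis by (simp add: S_def)
qed

lemma phi_shift_int: "integrable \<rho> (\<lambda>\<alpha>. \<phi> (x + \<alpha>))"
proof -
  have "integrable \<rho> (\<lambda>\<alpha>. exp (0 * \<alpha>) * \<phi> (x + \<alpha>))"
    using phi_le phi_pos Lam_pos
    by (intro shift_int[where \<delta> = 0 and C = K] phi_cont) (auto simp: abs_of_pos)
  thus ?thesis by simp
qed

lemma w_shift_int: "integrable \<rho> (\<lambda>\<alpha>. exp (a * \<alpha>) * w a (x + \<alpha>))"
proof -
  have "exp (a * \<alpha>) * w a (x + \<alpha>) = exp (- a * x) * \<phi> (x + \<alpha>)" for \<alpha>
    by (simp add: w_def algebra_simps flip: exp_add mult.assoc)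
  thus ?thesis using phi_shift_int[of x] by simp
qed

lemma w_has_derivative:
  "(w a has_real_derivative
     (L a (w a) x - (c * a + b - E a) * w a x - exp (- a * x) * R x) / c) (at x)"
proof -
  have "(w a has_real_derivative (exp (- a * x) * ((S 0 \<phi> x - b * \<phi> x - R x) / c) - a * w a x)) (at x)"
    unfolding w_def by (rule derivative_eq_intros dphi refl | simp)+
  also have "exp (- a * x) * ((S 0 \<phi> x - b * \<phi> x - R x) / c) - a * w a x
    = (S a (w a) x - (c * a + b) * w a x - exp (- a * x) * R x) / c"
    unfolding S_w using c_pos by (simp add: w_def field_simps)
  also have "S a (w a) x - (c * a + b) * w a x = L a (w a) x - (c * a + b - E a) * w a x"
    by (simp add: L_def algebra_simps)
  finally show ?thesis .
qed

lemma w_cont: "continuous_on UNIV (w a)"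
  using w_has_derivative by (meson DERIV_isCont continuous_at_imp_continuous_on)

text \<open>P(a) = c a + b - E a is concave with P(\<mu>) = 0, and a1 lies between a and \<mu>;
  hence \<theta> P(a) \<le> P(a1) < 0 with \<theta> \<le> 1. This keeps P uniformly away from 0
  below a1, also at the slightly negative rates that occur in \<open>decay_step\<close>.\<close>

lemma char_le:
  assumes "a \<le> a1" "0 \<le> a1" "a1 < \<mu>" "\<bar>a\<bar> < \<Lambda>"
  shows "c * a + b - E a \<le> c * a1 + b - E a1"
proof -
  define \<theta> where "\<theta> = (\<mu> - a1) / (\<mu> - a)"
  have \<theta>: "0 < \<theta>" "\<theta> \<le> 1" using assms by (auto simp: \<theta>_def field_simps)
  have "\<theta> * (\<mu> - a) = \<mu> - a1" using assms by (simp add: \<theta>_def)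
  hence e: "\<theta> * a + (1 - \<theta>) * \<mu> = a1" by (simp add: algebra_simps)
  have "E a1 \<le> \<theta> * E a + (1 - \<theta>) * E \<mu>"
    using E_convex[of a \<mu> \<theta>] \<theta> assms lam by (simp add: e)
  also have "E \<mu> = c * \<mu> + b" using char_zero by simp
  finally have "E a1 \<le> \<theta> * E a + (1 - \<theta>) * (c * \<mu> + b)" .
  also have "\<dots> = c * (\<theta> * a + (1 - \<theta>) * \<mu>) + b - \<theta> * (c * a + b - E a)" by (simp add: algebra_simps)
  finally have 1: "\<theta> * (c * a + b - E a) \<le> c * a1 + b - E a1" unfolding e by simp
  hence "\<theta> * (c * a + b - E a) < 0" using char_neg[of a1] assms by linarith
  hence "c * a + b - E a < 0" using \<theta> by (simp add: mult_less_0_iff)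
  hence "c * a + b - E a \<le> \<theta> * (c * a + b - E a)" using \<theta> mult_right_mono_neg[of \<theta> 1] by simp
  thus ?thesis using 1 by (rule order_trans)
qed

lemma S_phi_lim: "(S 0 \<phi> \<longlongrightarrow> 0) at_bot"
proof -
  have "((\<lambda>x. \<integral>\<alpha>. \<phi> (- x + \<alpha>) \<partial>\<rho>) \<longlongrightarrow> (\<integral>\<alpha>. 0 \<partial>\<rho>)) at_top"
  proof (rule integral_dominated_convergence_at_top)
    show "integrable \<rho> (\<lambda>\<alpha>. K * exp (0 * \<alpha>))" using Lam_pos by (intro integrable_mult_right exp_int) auto
    show "\<forall>\<^sub>F x in at_top. AE \<alpha> in \<rho>. norm (\<phi> (- x + \<alpha>)) \<le> K * exp (0 * \<alpha>)"
      using phi_le phi_pos by (auto simp: abs_of_pos)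
    show "AE \<alpha> in \<rho>. ((\<lambda>x. \<phi> (- x + \<alpha>)) \<longlongrightarrow> 0) at_top"
    proof (rule AE_I2)
      fix \<alpha> :: real
      have "\<exists>N. \<forall>x\<ge>N. - x + \<alpha> \<le> Z" for Z :: real by (rule exI[of _ "\<alpha> - Z"]) auto
      hence "filterlim (\<lambda>x. - x + \<alpha>) at_bot at_top"
        unfolding filterlim_at_bot eventually_at_top_linorder by blast
      thus "((\<lambda>x. \<phi> (- x + \<alpha>)) \<longlongrightarrow> 0) at_top"
        by (rule filterlim_compose[OF phi_lim])
    qed
  qed measurable
  hence "((\<lambda>x. S 0 \<phi> (- x)) \<longlongrightarrow> 0) at_top" by (simp add: S_def)
  thus ?thesis by (simp add: filterlim_at_bot_mirror)
qed

lemma S_phi_nonneg: "S 0 \<phi> x \<ge> 0"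
  using phi_pos by (intro S_nonneg) (simp add: less_imp_le)

lemma R_small:
  assumes \<epsilon>: "\<epsilon> > 0"
  obtains X where "\<And>x. x \<le> X \<Longrightarrow> R x \<le> \<epsilon> * (\<phi> x + S 0 \<phi> x)"
proof -
  define q where "q = (\<epsilon> / (M + 1)) powr (1 / s)"
  have q: "q > 0" using \<epsilon> M_nonneg by (simp add: q_def)
  have qs: "q powr s = \<epsilon> / (M + 1)" using s_pos \<epsilon> M_nonneg by (simp add: q_def powr_powr)
  have "((\<lambda>x. \<phi> x + S 0 \<phi> x) \<longlongrightarrow> 0 + 0) at_bot" by (intro tendsto_add phi_lim S_phi_lim)
  hence "\<forall>\<^sub>F x in at_bot. \<phi> x + S 0 \<phi> x < q" using q by (intro order_tendstoD) auto
  then obtain X where X: "\<And>x. x \<le> X \<Longrightarrow> \<phi> x + S 0 \<phi> x < q"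
    by (auto simp: eventually_at_bot_linorder)
  show thesis
  proof (rule that[of X])
    fix x assume "x \<le> X"
    define p where "p = \<phi> x + S 0 \<phi> x"
    have p: "0 < p" "p < q" using X[OF \<open>x \<le> X\<close>] S_phi_nonneg[of x] phi_pos[of x] by (auto simp: p_def)
    have "p powr s \<le> q powr s" using p s_pos by (intro powr_mono2) auto
    hence "M * (p * p powr s) \<le> (M + 1) * (p * (\<epsilon> / (M + 1)))"
      unfolding qs using p M_nonneg \<epsilon> by (intro mult_mono) auto
    also have "\<dots> = \<epsilon> * p" using M_nonneg by simp
    finally have "M * p powr (1 + s) \<le> \<epsilon> * p" using p by (simp add: powr_add)
    thus "R x \<le> \<epsilon> * (\<phi> x + S 0 \<phi> x)" using R_le[of x] by (simp add: p_def)
  qed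
qed


text \<open>The gain \<eta> depends on a1 only and not on the rate a already reached, so finitely
  many applications lead from rate 0 to a1.\<close>

lemma decay_step:
  assumes a1: "0 \<le> a1" "a1 < \<mu>"
  shows "\<exists>\<eta>>0. \<forall>a. 0 \<le> a \<longrightarrow> a \<le> a1 \<longrightarrow> (\<exists>C. \<forall>x. \<phi> x \<le> C * exp (a * x)) \<longrightarrow>
    (\<exists>C. \<forall>x. \<phi> x \<le> C * exp ((a + \<eta>) * x))"
proof -
  \<comment> \<open>Half of the gap -P(a1); the other half absorbs the remainder, which near
    -infinity is at most \<epsilon> times the sum of \<open>w\<close> and its image under
    \<open>S\<close>.\<close>
  define \<kappa> where "\<kappa> = (E a1 - (c * a1 + b)) / 2"
  have \<kappa>: "\<kappa> > 0" using char_neg[OF a1] by (simp add: \<kappa>_def)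
  define \<eta>0 where "\<eta>0 = min ((\<Lambda> - \<mu>) / 2) (\<mu> / 4)"
  have \<eta>0: "\<eta>0 > 0" "\<eta>0 \<le> (\<Lambda> - \<mu>) / 2" "\<eta>0 \<le> \<mu> / 4"
    unfolding \<eta>0_def using lam by (simp_all only: min.cobounded1 min.cobounded2 min_less_iff_conj) simp
  \<comment> \<open>A majorant of exp (a \<alpha>) for all |a| \<le> \<mu>, so that the constants
    \<open>E2\<close> and \<open>N\<close> built from it do not depend on a.\<close>
  define e2 where "e2 \<alpha> = exp (\<mu> * \<alpha>) + exp (- \<mu> * \<alpha>)" for \<alpha> :: real
  have e2: "exp (a * \<alpha>) \<le> e2 \<alpha>" if "\<bar>a\<bar> \<le> \<mu>" for a \<alpha>
  proof -
    have "a * \<alpha> \<le> \<bar>a\<bar> * \<bar>\<alpha>\<bar>" by (metis abs_ge_self abs_mult)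
    also have "\<dots> \<le> \<mu> * \<bar>\<alpha>\<bar>" using that by (intro mult_right_mono) auto
    finally have "exp (a * \<alpha>) \<le> exp (\<mu> * \<bar>\<alpha>\<bar>)" by simp
    also have "\<dots> \<le> e2 \<alpha>" by (cases "\<alpha> \<ge> 0") (auto simp: e2_def)
    finally show ?thesis .
  qed
  have e2i: "integrable \<rho> e2" unfolding e2_def
    using exp_int[of "\<mu>"] exp_int[of "- \<mu>"] lam by auto
  have abs_int: "integrable \<rho> (\<lambda>\<alpha>. exp (a * \<alpha>) * \<bar>\<alpha>\<bar>)" if "\<bar>a\<bar> < \<Lambda>" for a
    using integrable_abs[OF moment1_int[OF that]] by (simp add: abs_mult)
  have e2ai: "integrable \<rho> (\<lambda>\<alpha>. e2 \<alpha> * \<bar>\<alpha>\<bar>)" unfolding e2_def distrib_right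
    using abs_int[of "\<mu>"] abs_int[of "- \<mu>"] lam by auto
  define E2 where "E2 = (\<integral>\<alpha>. e2 \<alpha> \<partial>\<rho>)"
  define N where "N = (\<integral>\<alpha>. e2 \<alpha> * \<bar>\<alpha>\<bar> \<partial>\<rho>)"
  have E2: "E a \<le> E2" if "\<bar>a\<bar> \<le> \<mu>" for a
    unfolding E_def E2_def using that lam by (intro integral_mono exp_int e2i e2) auto
  have N: "(\<integral>\<alpha>. exp (a * \<alpha>) * \<bar>\<alpha>\<bar> \<partial>\<rho>) \<le> N" if "\<bar>a\<bar> \<le> \<mu>" for a
    unfolding N_def using that lam by (intro integral_mono abs_int e2ai mult_right_mono e2) auto
  have E20: "E2 \<ge> 0" using E2[of 0] E_nonneg[of 0] lam by simp
  have N0: "N \<ge> 0" unfolding N_def e2_def by (intro integral_nonneg_AE AE_I2) auto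
  define \<epsilon> where "\<epsilon> = min 1 (\<kappa> / (1 + E2))"
  have \<epsilon>: "0 < \<epsilon>" "\<epsilon> \<le> 1" "\<epsilon> * (1 + E2) \<le> \<kappa>"
  proof -
    show "0 < \<epsilon>" "\<epsilon> \<le> 1" using \<kappa> E20 by (auto simp: \<epsilon>_def)
    have "\<epsilon> \<le> \<kappa> / (1 + E2)" by (simp add: \<epsilon>_def)
    thus "\<epsilon> * (1 + E2) \<le> \<kappa>" using E20 by (simp add: pos_le_divide_eq)
  qed
  \<comment> \<open>The two integrations will end in \<kappa> U \<le> (c + N) V, that is U \<le> D
    U'.\<close>
  define D where "D = (c + N) / \<kappa>"
  have D: "D > 0" using c_pos N0 \<kappa> by (simp add: D_def)
  \<comment> \<open>The working rate a' = a - \<eta> sits below a, so that \<open>w\<close> is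
    integrable at -infinity. \<open>U\<close> decays at rate 1 / D, and 1 / D \<ge> 2 \<eta> leaves
    a net gain of \<eta> over a.\<close>
  define \<eta> where "\<eta> = min \<eta>0 (1 / (2 * D))"
  have \<eta>: "\<eta> > 0" "\<eta> \<le> \<eta>0" "2 * \<eta> \<le> 1 / D" using \<eta>0 D 
    by (auto simp: \<eta>_def min_def field_simps)
  obtain X where X: "\<And>x. x \<le> X \<Longrightarrow> R x \<le> \<epsilon> * (\<phi> x + S 0 \<phi> x)" using R_small[OF \<epsilon>(1)] by blast
  have main: "\<exists>C. \<forall>x. \<phi> x \<le> C * exp ((a + \<eta>) * x)"
    if a: "0 \<le> a" "a \<le> a1" and C: "\<And>x. \<phi> x \<le> C * exp (a * x)" for a C
  proof -
    define a' where "a' = a - \<eta>"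
    have a': "a' \<le> a1" "\<bar>a'\<bar> \<le> \<mu>" "\<bar>a'\<bar> < \<Lambda>" "\<bar>a'\<bar> + \<eta> < \<Lambda>" "\<bar>a' + \<eta>\<bar> < \<Lambda>"
      using a a1 \<eta> \<eta>0 lam by (auto simp: a'_def)
    let ?w = "w a'"
    have w0: "0 \<le> ?w x" for x using w_pos[of a' x] by simp
    have wC: "?w x \<le> C * exp (\<eta> * x)" for x
    proof -
      have "?w x \<le> exp (- a' * x) * (C * exp (a * x))" unfolding w_def by (intro mult_left_mono C) auto
      also have "\<dots> = C * exp (\<eta> * x)" by (simp add: a'_def algebra_simps flip: exp_add)
      finally show ?thesis .
    qed
    obtain V where V: "\<And>x. (V has_real_derivative ?w x) (at x)" "\<And>x. 0 \<le> V x" "\<And>x. V x \<le> C / \<eta> * exp (\<eta> * x)"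
      using exp_bounded_antiderivative[OF w_cont \<eta>(1) w0 wC] by metis
    have cV: "continuous_on UNIV V" using V(1) by (meson DERIV_isCont continuous_at_imp_continuous_on)
    obtain U where U: "\<And>x. (U has_real_derivative V x) (at x)" "\<And>x. 0 \<le> U x" "\<And>x. U x \<le> C / \<eta> / \<eta> * exp (\<eta> * x)"
      using exp_bounded_antiderivative[OF cV \<eta>(1) V(2) V(3)] by metis
    have cU: "continuous_on UNIV U" using U(1) by (meson DERIV_isCont continuous_at_imp_continuous_on)
    have monoV: "mono V"
      by (rule monoI) (rule DERIV_nonneg_imp_nondecreasing[where f = V], assumption, use V(1) w0 in blast)
    define wd where "wd x = (L a' ?w x - (c * a' + b - E a') * ?w x - exp (- a' * x) * R x) / c" for x
    have dw: "(?w has_real_derivative wd x) (at x)" for x unfolding wd_def by (rule w_has_derivative)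
    have base: "c * wd x \<ge> (1 - \<epsilon>) * L a' ?w x + \<kappa> * ?w x" if "x \<le> X" for x
    proof -
      have "exp (- a' * x) * R x \<le> exp (- a' * x) * (\<epsilon> * (\<phi> x + S 0 \<phi> x))"
        using X[OF that] by (intro mult_left_mono) auto
      also have "\<dots> = \<epsilon> * (?w x + S a' ?w x)" unfolding S_w by (simp add: w_def algebra_simps)
      also have "\<dots> = \<epsilon> * L a' ?w x + \<epsilon> * (1 + E a') * ?w x" by (simp add: L_def algebra_simps)
      finally have r: "exp (- a' * x) * R x \<le> \<epsilon> * L a' ?w x + \<epsilon> * (1 + E a') * ?w x" .
      have "\<epsilon> * (1 + E a') \<le> \<epsilon> * (1 + E2)" using \<epsilon> E2[OF a'(2)] by (intro mult_left_mono) auto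
      moreover have "c * a' + b - E a' \<le> - (2 * \<kappa>)" 
      proof -
        have "2 * \<kappa> = E a1 - (c * a1 + b)" by (simp add: \<kappa>_def)
        thus ?thesis using char_le[OF a'(1) a1 a'(3)] by linarith
      qed
      ultimately have "\<kappa> \<le> - (c * a' + b - E a') - \<epsilon> * (1 + E a')" using \<epsilon> by linarith
      hence "\<kappa> * ?w x \<le> (- (c * a' + b - E a') - \<epsilon> * (1 + E a')) * ?w x" by (rule mult_right_mono[OF _ w0])
      also have "\<dots> = - ((c * a' + b - E a') * ?w x) - \<epsilon> * (1 + E a') * ?w x" 
        by (simp only: left_diff_distrib[of "- (c * a' + b - E a')"] minus_mult_left)
      finally have "\<kappa> * ?w x \<le> - ((c * a' + b - E a') * ?w x) - \<epsilon> * (1 + E a') * ?w x" .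
      moreover have "c * wd x = L a' ?w x - (c * a' + b - E a') * ?w x - exp (- a' * x) * R x"
        using c_pos by (simp add: wd_def)
      moreover have "(1 - \<epsilon>) * L a' ?w x = L a' ?w x - \<epsilon> * L a' ?w x" by (simp add: left_diff_distrib)
      ultimately show ?thesis using r by linarith
    qed
    have \<epsilon>': "0 \<le> \<epsilon>" "0 \<le> \<kappa>" using \<epsilon> \<kappa> by auto
    have flux1: "c * ?w x \<ge> (1 - \<epsilon>) * L a' V x + \<kappa> * V x" if "x \<le> X" for x
      by (rule flux_inequality[OF a'(4) \<eta>(1) \<epsilon>'(1) \<epsilon>(2) \<epsilon>'(2) c_pos dw w0 V(1) w_cont w0 wC V(2,3) base that])
    have flux2: "c * V x \<ge> (1 - \<epsilon>) * L a' U x + \<kappa> * U x" if "x \<le> X" for x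
      by (rule flux_inequality[OF a'(4) \<eta>(1) \<epsilon>'(1) \<epsilon>(2) \<epsilon>'(2) c_pos V(1,2) U(1) cV V(2,3) U(2,3) flux1 that])
    have UV: "U x \<le> D * V x" if "x \<le> X" for x
    proof -
      have "integrable \<rho> (\<lambda>\<alpha>. exp (a' * \<alpha>) * U (x + \<alpha>))"
        by (rule shift_int[OF a'(4) less_imp_le[OF \<eta>(1)] cU abs_le_exp_abs[OF U(2,3) \<eta>(1)]])
      hence "L a' U x \<ge> - (\<integral>\<alpha>. exp (a' * \<alpha>) * \<bar>\<alpha>\<bar> \<partial>\<rho>) * V x"
        by (intro L_ge_of_mono a' U(1) V(2) monoV abs_int)
      moreover have "(\<integral>\<alpha>. exp (a' * \<alpha>) * \<bar>\<alpha>\<bar> \<partial>\<rho>) * V x \<le> N * V x"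
        using N[OF a'(2)] V(2) by (intro mult_right_mono) auto
      ultimately have LU: "- (N * V x) \<le> L a' U x" by linarith
      have "- (N * V x) \<le> (1 - \<epsilon>) * (- (N * V x))"
        using \<epsilon> N0 V(2)[of x] mult_left_mono[of 0 "N * V x" \<epsilon>] by (simp add: left_diff_distrib)
      also have "\<dots> \<le> (1 - \<epsilon>) * L a' U x" using LU \<epsilon> by (intro mult_left_mono) auto
      finally have "\<kappa> * U x \<le> c * V x + N * V x" using flux2[OF that] by linarith
      hence "U x * \<kappa> \<le> (c + N) * V x" by (simp only: distrib_right mult.commute[of _ \<kappa>])
      hence "U x \<le> (c + N) * V x / \<kappa>" using \<kappa> by (simp add: pos_le_divide_eq)
      thus ?thesis by (simp add: D_def)
    qed
    \<comment> \<open>U \<le> D U' makes exp (- x / D) U nondecreasing.\<close>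
    have gron: "U x \<le> U X * exp ((x - X) / D)" if "x \<le> X" for x
    proof -
      have "exp (- x / D) * U x \<le> exp (- X / D) * U X"
      proof (rule DERIV_nonneg_imp_nondecreasing[where f = "\<lambda>x. exp (- x / D) * U x", OF that])
        fix t assume t: "x \<le> t" "t \<le> X"
        have "((\<lambda>x. exp (- x / D) * U x) has_real_derivative (exp (- t / D) * (V t - U t / D))) (at t)"
          by (rule derivative_eq_intros U(1) refl | use D in \<open>simp add: field_simps\<close>)+
        moreover have "U t / D \<le> V t" using UV[OF t(2)] D by (simp add: pos_divide_le_eq mult.commute)
        ultimately show "\<exists>d. ((\<lambda>x. exp (- x / D) * U x) has_real_derivative d) (at t) \<and> 0 \<le> d" by auto
      qed
      hence "exp (x / D) * (exp (- x / D) * U x) \<le> exp (x / D) * (exp (- X / D) * U X)"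
        by (intro mult_left_mono) auto
      moreover have "exp (x / D) * (exp (- x / D) * U x) = U x" by (simp add: exp_minus)
      moreover have "exp (x / D) * (exp (- X / D) * U X) = exp (x / D + - X / D) * U X"
        by (simp only: exp_add mult.assoc)
      moreover have "x / D + - X / D = (x - X) / D" by (simp add: diff_divide_distrib)
      ultimately show ?thesis by (simp only: mult.commute)
    qed
    define B where "B = E a' / c"
    have B: "B \<ge> 0" using E_nonneg c_pos by (simp add: B_def)
    \<comment> \<open>The way back from \<open>U\<close> to \<open>w\<close>: by a Harnack
      inequality \<open>w x\<close> is controlled by all values on [x, x + 1], hence by
      \<open>V (x + 1)\<close>, and \<open>V\<close> in turn by \<open>U\<close> one unit
      further.\<close>
    have harn: "?w x \<le> exp B * V (x + 1)" if x: "x + 1 \<le> X" for x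
    proof -
      have "exp (- B) * ?w x \<le> V (x + 1) - V x"
      proof (rule increment_ge[OF V(1)])
        fix t assume t: "x \<le> t" "t \<le> x + 1"
        have "?w x \<le> exp (B * (t - x)) * (?w t + 0 * (t - x))"
        proof (rule weak_harnack_left[OF t(1) B order_refl dw])
          fix r assume r: "x \<le> r" "r \<le> t"
          have "S a' ?w r \<ge> 0" by (rule S_nonneg) (rule w0)
          hence "(1 - \<epsilon>) * S a' ?w r \<ge> 0" "\<epsilon> * (E a' * ?w r) \<ge> 0" "\<kappa> * ?w r \<ge> 0"
            using \<epsilon> \<epsilon>' w0 E_nonneg by auto
          moreover have "(1 - \<epsilon>) * L a' ?w r = (1 - \<epsilon>) * S a' ?w r - E a' * ?w r + \<epsilon> * (E a' * ?w r)"
            by (simp add: L_def algebra_simps)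
          ultimately have "c * wd r \<ge> - (E a' * ?w r)" using base[of r] r t x by linarith
          also have "- (E a' * ?w r) = c * (- B * ?w r)" using c_pos by (simp add: B_def)
          finally have "- B * ?w r \<le> wd r" using c_pos by (simp only: mult_le_cancel_left_pos)
          thus "wd r \<ge> - B * ?w r - 0" by simp
        qed
        also have "\<dots> \<le> exp B * ?w t"
        proof -
          have "B * (t - x) \<le> B * 1" using t B by (intro mult_left_mono) auto
          thus ?thesis using w0[of t] by (auto intro!: mult_right_mono)
        qed
        finally show "exp (- B) * ?w x \<le> ?w t" by (simp only: exp_minus_mult_le_iff)
      qed
      hence "exp (- B) * ?w x \<le> V (x + 1)" using V(2)[of x] by linarith
      thus ?thesis by (simp only: exp_minus_mult_le_iff)
    qed
    have VU: "V x \<le> U (x + 1)" for x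
      using increment_ge[OF U(1), of x "V x"] monoD[OF monoV] U(2)[of x] by fastforce
    define Y where "Y = min (X - 2) 0"
    have Y: "Y \<le> X - 2" "Y \<le> 0" by (auto simp: Y_def)
    define C2 where "C2 = exp B * U X * exp ((2 - X) / D)"
    have C2: "C2 \<ge> 0" using U(2) by (simp add: C2_def)
    have left: "\<phi> x \<le> C2 * exp ((a + \<eta>) * x)" if x: "x \<le> Y" for x
    proof -
      have "?w x \<le> exp B * V (x + 1)" using harn x Y by auto
      also have "V (x + 1) \<le> U (x + 2)" using VU[of "x + 1"] by (simp add: add.assoc)
      also have "U (x + 2) \<le> U X * exp ((x + 2 - X) / D)" using gron x Y by auto
      finally have "?w x \<le> exp B * (U X * exp ((x + 2 - X) / D))" by simp
      also have "\<dots> = C2 * exp (x / D)" by (simp add: C2_def add_divide_distrib diff_divide_distrib exp_add exp_diff)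
      finally have "exp (a' * x) * ?w x \<le> exp (a' * x) * (C2 * exp (x / D))" by (intro mult_left_mono) auto
      moreover have "exp (a' * x) * ?w x = \<phi> x" by (simp add: w_def exp_minus)
      moreover have "exp (a' * x) * (C2 * exp (x / D)) = C2 * exp ((a' + 1 / D) * x)"
        by (simp add: distrib_right exp_add)
      ultimately have "\<phi> x \<le> C2 * exp ((a' + 1 / D) * x)" by simp
      also have "\<dots> \<le> C2 * exp ((a + \<eta>) * x)"
      proof -
        have "(a' + 1 / D) * x \<le> (a + \<eta>) * x"
          using \<eta>(3) x Y by (intro mult_right_mono_neg) (auto simp: a'_def)
        thus ?thesis using C2 by (intro mult_left_mono) auto
      qed
      finally show ?thesis .
    qed
    have right: "\<phi> x \<le> K * exp (- (a + \<eta>) * Y) * exp ((a + \<eta>) * x)" if "x \<ge> Y" for x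
    proof -
      have "0 \<le> (a + \<eta>) * (x - Y)" using that a \<eta> by simp
      hence "K * 1 \<le> K * exp ((a + \<eta>) * (x - Y))" using K_pos by (intro mult_left_mono) auto
      also have "\<dots> = K * exp (- (a + \<eta>) * Y) * exp ((a + \<eta>) * x)"
        by (simp add: algebra_simps flip: exp_add)
      finally show ?thesis using phi_le[of x] by linarith
    qed
    define C3 where "C3 = C2 + K * exp (- (a + \<eta>) * Y)"
    have "\<phi> x \<le> C3 * exp ((a + \<eta>) * x)" for x
    proof -
      have "0 \<le> C2 * exp ((a + \<eta>) * x)" "0 \<le> K * exp (- (a + \<eta>) * Y) * exp ((a + \<eta>) * x)"
        using C2 K_pos by auto
      moreover have "C3 * exp ((a + \<eta>) * x) =
          C2 * exp ((a + \<eta>) * x) + K * exp (- (a + \<eta>) * Y) * exp ((a + \<eta>) * x)"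
        unfolding C3_def by (rule distrib_right)
      ultimately show ?thesis using left[of x] right[of x] by linarith
    qed
    thus ?thesis by blast
  qed
  show ?thesis using \<eta>(1) main by blast
qed

lemma decay:
  assumes "0 \<le> a" "a < \<mu>"
  shows "\<exists>C. \<forall>x. \<phi> x \<le> C * exp (a * x)"
proof -
  obtain \<eta> where \<eta>: "\<eta> > 0" and step: "\<And>a'. 0 \<le> a' \<Longrightarrow> a' \<le> a \<Longrightarrow> \<exists>C. \<forall>x. \<phi> x \<le> C * exp (a' * x) \<Longrightarrow>
      \<exists>C. \<forall>x. \<phi> x \<le> C * exp ((a' + \<eta>) * x)"
    using decay_step[OF assms] by blast
  have iter: "real n * \<eta> \<le> a + \<eta> \<Longrightarrow> \<exists>C. \<forall>x. \<phi> x \<le> C * exp (real n * \<eta> * x)" for n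
  proof (induction n)
    case 0
    show ?case using phi_le by (intro exI[of _ K]) auto
  next
    case (Suc n)
    have "real (Suc n) * \<eta> = real n * \<eta> + \<eta>" by (simp add: algebra_simps)
    thus ?case using step[of "real n * \<eta>"] Suc \<eta> by auto
  qed
  \<comment> \<open>Each step may start from any rate up to a, so the last one overshoots to at most
    a + \<eta>. The surplus is dropped for x \<le> 0, and the bound K serves for x > 0.\<close>
  define n where "n = nat \<lceil>a / \<eta>\<rceil>"
  have n: "a / \<eta> \<le> real n" "real n < a / \<eta> + 1"
    using assms \<eta> by (auto simp: n_def) linarith+
  hence n': "a \<le> real n * \<eta>" "real n * \<eta> \<le> a + \<eta>"
    using \<eta> by (auto simp: field_simps)
  then obtain C where C: "\<And>x. \<phi> x \<le> C * exp (real n * \<eta> * x)" using iter by blast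
  have C0: "C \<ge> 0" using C[of 0] phi_pos[of 0] by simp
  have "\<phi> x \<le> (C + K) * exp (a * x)" for x
  proof (cases "x \<le> 0")
    case True
    have "\<phi> x \<le> C * exp (real n * \<eta> * x)" by (rule C)
    also have "\<dots> \<le> C * exp (a * x)"
      using C0 n' True by (intro mult_left_mono) (auto intro: mult_right_mono_neg)
    also have "\<dots> \<le> (C + K) * exp (a * x)" using K_pos by (intro mult_right_mono) auto
    finally show ?thesis .
  next
    case False
    have "\<phi> x \<le> K * 1" using phi_le by simp
    also have "\<dots> \<le> (C + K) * exp (a * x)" using False C0 K_pos assms by (intro mult_mono) auto
    finally show ?thesis .
  qed
  thus ?thesis by blast
qed

end

section \<open>The flux at the critical rate\<close>

text \<open>At the critical rate \<open>w \<mu>\<close> need not be integrable at -infinity, but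
  boundedness of \<phi> makes it decay like exp (- \<mu> x) at +infinity; antiderivatives are
  therefore normalised there, by reflection.\<close>

lemma exp_bounded_antiderivative_at_top:
  fixes w :: "real \<Rightarrow> real"
  assumes cw: "continuous_on UNIV w" and \<eta>: "\<eta> > 0"
    and w: "\<And>x. 0 \<le> w x" "\<And>x. w x \<le> C * exp (- \<eta> * x)"
  obtains V where "\<And>x. (V has_real_derivative - w x) (at x)"
    "\<And>x. 0 \<le> V x" "\<And>x. V x \<le> C / \<eta> * exp (- \<eta> * x)"
proof -
  have "continuous_on UNIV (\<lambda>x. w (- x))"
    by (rule continuous_on_compose2[OF cw]) (auto intro!: continuous_intros)
  then obtain F where F: "\<And>x. (F has_real_derivative w (- x)) (at x)"
    "\<And>x. 0 \<le> F x" "\<And>x. F x \<le> C / \<eta> * exp (\<eta> * x)"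
    using exp_bounded_antiderivative[of "\<lambda>x. w (- x)" \<eta> C] \<eta> w(1) w(2)[of "- x" for x]
    by (auto simp del: times_divide_eq_left)
  show thesis
  proof (rule that[of "\<lambda>x. F (- x)"])
    fix x
    have "((\<lambda>x. F (- x)) has_real_derivative w (- (- x)) * (- 1)) (at x)"
      by (rule DERIV_chain2[OF F(1)]) (auto intro!: derivative_eq_intros)
    thus "((\<lambda>x. F (- x)) has_real_derivative - w x) (at x)" by simp
    show "0 \<le> F (- x)" "F (- x) \<le> C / \<eta> * exp (- \<eta> * x)" using F(2)[of "- x"] F(3)[of "- x"] by auto
  qed
qed

text \<open>The rate doubles because |t| is estimated by exp (\<eta> |t|) / \<eta>.\<close>

lemma exp_abs_growth_antiderivative:
  fixes u v :: "real \<Rightarrow> real"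
  assumes \<eta>: "\<eta> > 0" and du: "\<And>t. (u has_real_derivative v t) (at t)"
    and v: "\<And>t. \<bar>v t\<bar> \<le> C * exp (\<eta> * \<bar>t\<bar>)"
  shows "\<bar>u t\<bar> \<le> (\<bar>u 0\<bar> + C / \<eta>) * exp (2 * \<eta> * \<bar>t\<bar>)"
proof -
  have C: "C \<ge> 0" using v[of 0] by simp
  have "\<bar>u t - u 0\<bar> \<le> C * exp (\<eta> * \<bar>t\<bar>) * \<bar>t - 0\<bar>"
  proof (rule real_mvt_bound[OF du])
    fix s assume "s \<in> closed_segment 0 t"
    hence "\<bar>s\<bar> \<le> \<bar>t\<bar>" by (auto simp: closed_segment_eq_real_ivl split: if_splits)
    hence "C * exp (\<eta> * \<bar>s\<bar>) \<le> C * exp (\<eta> * \<bar>t\<bar>)" using C \<eta> by (intro mult_left_mono) auto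
    thus "\<bar>v s\<bar> \<le> C * exp (\<eta> * \<bar>t\<bar>)" using v[of s] by linarith
  qed
  also have "\<bar>t - 0\<bar> \<le> exp (\<eta> * \<bar>t\<bar>) / \<eta>"
  proof -
    have "\<eta> * \<bar>t\<bar> \<le> exp (\<eta> * \<bar>t\<bar>)"
      using exp_ge_add_one_self[of "\<eta> * \<bar>t\<bar>"] by linarith
    thus ?thesis using \<eta> by (simp add: pos_le_divide_eq mult.commute)
  qed
  hence "C * exp (\<eta> * \<bar>t\<bar>) * \<bar>t - 0\<bar> \<le> C * exp (\<eta> * \<bar>t\<bar>) * (exp (\<eta> * \<bar>t\<bar>) / \<eta>)"
    using C by (intro mult_left_mono) auto
  also have "\<dots> = C / \<eta> * exp (2 * \<eta> * \<bar>t\<bar>)"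
    by (simp add: algebra_simps flip: exp_add)
  finally have "\<bar>u t - u 0\<bar> \<le> C / \<eta> * exp (2 * \<eta> * \<bar>t\<bar>)" .
  moreover have "\<bar>u 0\<bar> * 1 \<le> \<bar>u 0\<bar> * exp (2 * \<eta> * \<bar>t\<bar>)" using \<eta> by (intro mult_left_mono) auto
  ultimately show ?thesis unfolding distrib_right by linarith
qed

text \<open>\<open>V\<close> is minus the integral of \<open>w \<mu>\<close> over [x, infinity), as
  the two bounds force it to vanish at +infinity. \<open>U\<close> is fixed only up to a constant,
  which \<open>L\<close> does not see.\<close>

locale wave_flux = wave +
  fixes V U :: "real \<Rightarrow> real"
  assumes dV: "\<And>x. (V has_real_derivative w \<mu> x) (at x)"
    and dU: "\<And>x. (U has_real_derivative V x) (at x)"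
    and V_le: "\<And>x. V x \<le> 0" and V_ge: "\<And>x. - V x \<le> K / \<mu> * exp (- \<mu> * x)"
begin

abbreviation W :: "real \<Rightarrow> real" where "W \<equiv> w \<mu>"

definition r :: "real \<Rightarrow> real" where "r x = exp (- \<mu> * x) * R x"

text \<open>Formally this is P'(\<mu>); in the application it is positive for
  \<open>c > cstar\<close> and zero for \<open>c = cstar\<close>.\<close>

definition m :: real where "m = c - (\<integral>\<alpha>. exp (\<mu> * \<alpha>) * \<alpha> \<partial>\<rho>)"

definition J :: "real \<Rightarrow> real" where "J x = c * W x - L \<mu> V x"

text \<open>\<open>c - m\<close> is the first moment of the tilted kernel, so \<open>T\<close>
  integrates the second-order Taylor remainders of the convex function \<open>U\<close>, see
  \<open>T_eq\<close>. Its derivative is m W - J.\<close>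

definition T :: "real \<Rightarrow> real" where "T x = L \<mu> U x - (c - m) * V x"

lemma m_nonneg: "m \<ge> 0" using drift by (simp add: m_def)

lemma mu_Lam: "\<bar>\<mu>\<bar> < \<Lambda>" using lam by simp

lemma r_nonneg: "r x \<ge> 0" using R_nonneg by (simp add: r_def)

lemma dW: "(W has_real_derivative (L \<mu> W x - r x) / c) (at x)"
proof -
  have "c * \<mu> + b - E \<mu> = 0" using char_zero by simp
  thus ?thesis using w_has_derivative[of \<mu> x] by (simp add: r_def)
qed

lemma W_le: "W x \<le> K * exp (- \<mu> * x)"
  unfolding w_def by (subst mult.commute) (intro mult_right_mono phi_le, simp)

lemma W_growth:
  assumes "0 < \<eta>" "\<eta> \<le> \<mu>"
  shows "\<exists>C. \<forall>x. \<bar>W x\<bar> \<le> C * exp (\<eta> * \<bar>x\<bar>)"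
proof -
  obtain C where C: "\<And>x. \<phi> x \<le> C * exp ((\<mu> - \<eta>) * x)" using decay[of "\<mu> - \<eta>"] assms by auto
  have C0: "C \<ge> 0" using C[of 0] phi_pos[of 0] by simp
  have "\<bar>W x\<bar> \<le> C * exp (\<eta> * \<bar>x\<bar>)" for x
  proof -
    have "W x \<le> exp (- \<mu> * x) * (C * exp ((\<mu> - \<eta>) * x))" unfolding w_def by (intro mult_left_mono C) auto
    also have "\<dots> = C * exp (\<eta> * (- x))" by (simp add: algebra_simps flip: exp_add)
    also have "\<dots> \<le> C * exp (\<eta> * \<bar>x\<bar>)"
    proof -
      have "\<eta> * (- x) \<le> \<eta> * \<bar>x\<bar>" using assms by (intro mult_left_mono) auto
      thus ?thesis using C0 by (intro mult_left_mono) auto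
    qed
    finally show ?thesis using w_pos[of \<mu> x] by simp
  qed
  thus ?thesis by blast
qed

lemma growth:
  obtains \<delta> C where "\<delta> > 0" "\<bar>\<mu>\<bar> + \<delta> < \<Lambda>" "\<And>t. \<bar>W t\<bar> \<le> C * exp (\<delta> * \<bar>t\<bar>)"
    "\<And>t. \<bar>V t\<bar> \<le> C * exp (\<delta> * \<bar>t\<bar>)" "\<And>t. \<bar>U t\<bar> \<le> C * exp (\<delta> * \<bar>t\<bar>)"
proof -
  \<comment> \<open>The rate doubles at each of the two antiderivatives, and 4 \<eta> has to fit
    below \<Lambda> - \<mu>.\<close>
  define \<eta> where "\<eta> = min \<mu> ((\<Lambda> - \<mu>) / 8)"
  have \<eta>: "0 < \<eta>" "\<eta> \<le> \<mu>" using lam by (auto simp: \<eta>_def)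
  have "\<eta> \<le> (\<Lambda> - \<mu>) / 8" unfolding \<eta>_def by (rule min.cobounded2)
  hence \<eta>': "\<bar>\<mu>\<bar> + 4 * \<eta> < \<Lambda>" using lam by simp
  obtain C where C: "\<And>x. \<bar>W x\<bar> \<le> C * exp (\<eta> * \<bar>x\<bar>)" using W_growth[OF \<eta>] by blast
  define C1 where "C1 = \<bar>V 0\<bar> + C / \<eta>"
  have C1: "\<bar>V x\<bar> \<le> C1 * exp (2 * \<eta> * \<bar>x\<bar>)" for x
    unfolding C1_def by (rule exp_abs_growth_antiderivative[OF \<eta>(1) dV C])
  define C2 where "C2 = \<bar>U 0\<bar> + C1 / (2 * \<eta>)"
  have C2: "\<bar>U x\<bar> \<le> C2 * exp (2 * (2 * \<eta>) * \<bar>x\<bar>)" for x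
    unfolding C2_def using \<eta> by (intro exp_abs_growth_antiderivative[OF _ dU C1]) simp
  define B where "B = max C (max C1 C2)"
  have up: "y \<le> B * exp (4 * \<eta> * \<bar>t\<bar>)" if "y \<le> D * exp (k * \<bar>t\<bar>)" "D \<le> B" "k \<le> 4 * \<eta>" "D \<ge> 0" for y D k t
  proof -
    have "D * exp (k * \<bar>t\<bar>) \<le> B * exp (4 * \<eta> * \<bar>t\<bar>)"
      using that by (intro mult_mono) (auto intro: mult_right_mono)
    thus ?thesis using that(1) by linarith
  qed
  have pos: "C \<ge> 0" "C1 \<ge> 0" "C2 \<ge> 0" using C[of 0] C1[of 0] C2[of 0] by auto
  show thesis
  proof (rule that[of "4 * \<eta>" B])
    show "\<bar>W t\<bar> \<le> B * exp (4 * \<eta> * \<bar>t\<bar>)" for t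
      by (rule up[OF C]) (use pos \<eta> in \<open>auto simp: B_def\<close>)
    show "\<bar>V t\<bar> \<le> B * exp (4 * \<eta> * \<bar>t\<bar>)" for t
      by (rule up[OF C1]) (use pos \<eta> in \<open>auto simp: B_def\<close>)
    show "\<bar>U t\<bar> \<le> B * exp (4 * \<eta> * \<bar>t\<bar>)" for t
      by (rule up[OF C2]) (use pos \<eta> in \<open>auto simp: B_def\<close>)
  qed (use \<eta> \<eta>' in auto)
qed

lemma V_cont: "continuous_on UNIV V" using dV by (meson DERIV_isCont continuous_at_imp_continuous_on)
lemma U_cont: "continuous_on UNIV U" using dU by (meson DERIV_isCont continuous_at_imp_continuous_on)

lemma V_shift_int: "integrable \<rho> (\<lambda>\<alpha>. exp (\<mu> * \<alpha>) * V (x + \<alpha>))"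
proof -
  obtain \<delta> C where g: "\<delta> > 0" "\<bar>\<mu>\<bar> + \<delta> < \<Lambda>" "\<And>t. \<bar>V t\<bar> \<le> C * exp (\<delta> * \<bar>t\<bar>)" using growth by metis
  show ?thesis by (rule shift_int[OF g(2) less_imp_le[OF g(1)] V_cont g(3)])
qed

lemma U_shift_int: "integrable \<rho> (\<lambda>\<alpha>. exp (\<mu> * \<alpha>) * U (x + \<alpha>))"
proof -
  obtain \<delta> C where g: "\<delta> > 0" "\<bar>\<mu>\<bar> + \<delta> < \<Lambda>" "\<And>t. \<bar>U t\<bar> \<le> C * exp (\<delta> * \<bar>t\<bar>)" using growth by metis
  show ?thesis by (rule shift_int[OF g(2) less_imp_le[OF g(1)] U_cont g(3)])
qed

text \<open>At \<mu> the zero-order coefficient of the equation vanishes, so c W' = L W - r; since L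
  W is the derivative of L V, the nonlocal terms cancel.\<close>

lemma dJ: "(J has_real_derivative - r x) (at x)"
proof -
  obtain \<delta> C where g: "\<delta> > 0" "\<bar>\<mu>\<bar> + \<delta> < \<Lambda>" "\<And>t. \<bar>W t\<bar> \<le> C * exp (\<delta> * \<bar>t\<bar>)"
    "\<And>t. \<bar>V t\<bar> \<le> C * exp (\<delta> * \<bar>t\<bar>)" using growth by metis
  have "(J has_real_derivative (c * ((L \<mu> W x - r x) / c) - L \<mu> W x)) (at x)"
    unfolding J_def[abs_def]
    by (intro DERIV_diff DERIV_cmult dW L_has_derivative[OF g(2) less_imp_le[OF g(1)] dV w_cont g(4) g(3)])
  thus ?thesis using c_pos by simp
qed

lemma dT: "(T has_real_derivative m * W x - J x) (at x)"
proof -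
  obtain \<delta> C where g: "\<delta> > 0" "\<bar>\<mu>\<bar> + \<delta> < \<Lambda>" "\<And>t. \<bar>V t\<bar> \<le> C * exp (\<delta> * \<bar>t\<bar>)"
    "\<And>t. \<bar>U t\<bar> \<le> C * exp (\<delta> * \<bar>t\<bar>)" using growth by metis
  have "(T has_real_derivative (L \<mu> V x - (c - m) * W x)) (at x)"
    unfolding T_def[abs_def]
    by (intro DERIV_diff DERIV_cmult dV L_has_derivative[OF g(2) less_imp_le[OF g(1)] dU V_cont g(4) g(3)])
  thus ?thesis by (simp add: J_def algebra_simps)
qed

lemma r_decay:
  obtains \<beta> C where "\<beta> > 0" "C \<ge> 0" "\<And>x. r x \<le> C * exp (\<beta> * x)" "\<And>x. r x \<le> C * exp (- \<mu> * x)"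
proof -
  \<comment> \<open>This rate lies below \<mu>, so \<open>decay\<close> applies, yet (1 + s) a
    exceeds \<mu> by \<mu> s / 2, which becomes the decay rate of \<open>r\<close> at
    -infinity.\<close>
  define a where "a = \<mu> * (1 + s / 2) / (1 + s)"
  have a: "0 \<le> a" "a < \<mu>" "a * (1 + s) = \<mu> * (1 + s / 2)"
    using lam s_pos by (auto simp: a_def field_simps)
  obtain C where C: "\<And>x. \<phi> x \<le> C * exp (a * x)" using decay[OF a(1,2)] by blast
  have C0: "C \<ge> 0" using C[of 0] phi_pos[of 0] by simp
  define D where "D = C + C * E a"
  have D0: "D \<ge> 0" using C0 E_nonneg by (simp add: D_def)
  have int: "integrable \<rho> (\<lambda>\<alpha>. exp (0 * \<alpha>) * \<phi> (x + \<alpha>))" for x using phi_shift_int by simp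
  have D: "\<phi> x + S 0 \<phi> x \<le> D * exp (a * x)" for x
  proof -
    have "S 0 \<phi> x \<le> C * E (0 + a) * exp (a * x)" using a lam by (intro S_exp_bound int C) auto
    thus ?thesis using C[of x] by (simp add: D_def distrib_right)
  qed
  have D': "\<phi> x + S 0 \<phi> x \<le> K + K * E 0" for x
  proof -
    have "S 0 \<phi> x \<le> K * E (0 + 0) * exp (0 * x)" using Lam_pos phi_le by (intro S_exp_bound int) auto
    thus ?thesis using phi_le[of x] by simp
  qed
  have p0: "\<phi> x + S 0 \<phi> x \<ge> 0" for x using phi_pos[of x] S_phi_nonneg[of x] by simp
  define C1 where "C1 = M * D powr (1 + s)"
  define C2 where "C2 = M * (K + K * E 0) powr (1 + s)"
  have 1: "r x \<le> C1 * exp (\<mu> * s / 2 * x)" for x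
  proof -
    have "R x \<le> M * (D * exp (a * x)) powr (1 + s)"
      using R_le[of x] mult_left_mono[OF powr_mono2[OF _ p0 D], of "1 + s" M x] s_pos M_nonneg by auto
    also have "\<dots> = C1 * exp (a * (1 + s) * x)"
      using D0 by (simp add: C1_def powr_mult exp_powr_real ac_simps)
    finally have "r x \<le> exp (- \<mu> * x) * (C1 * exp (a * (1 + s) * x))"
      unfolding r_def by (intro mult_left_mono) auto
    also have "\<dots> = C1 * exp (\<mu> * s / 2 * x)" unfolding a(3)
      by (simp add: algebra_simps flip: exp_add)
    finally show ?thesis .
  qed
  have 2: "r x \<le> C2 * exp (- \<mu> * x)" for x
  proof -
    have "R x \<le> C2" unfolding C2_def
      using R_le[of x] mult_left_mono[OF powr_mono2[OF _ p0 D'], of "1 + s" M x] s_pos M_nonneg by auto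
    thus ?thesis unfolding r_def by (simp add: mult.commute)
  qed
  have C12: "C1 \<ge> 0" "C2 \<ge> 0" using M_nonneg by (auto simp: C1_def C2_def)
  show thesis
  proof (rule that[of "\<mu> * s / 2" "C1 + C2"])
    show "r x \<le> (C1 + C2) * exp (\<mu> * s / 2 * x)" for x
      by (rule order_trans[OF 1]) (use C12 in \<open>auto intro!: mult_right_mono\<close>)
    show "r x \<le> (C1 + C2) * exp (- \<mu> * x)" for x
      by (rule order_trans[OF 2]) (use C12 in \<open>auto intro!: mult_right_mono\<close>)
  qed (use lam s_pos C12 in auto)
qed

lemma r_weight: obtains C where "C \<ge> 0" "\<And>x. r x * (1 + x\<^sup>2) \<le> C"
proof -
  obtain \<beta> C where r: "\<beta> > 0" "C \<ge> 0" "\<And>x. r x \<le> C * exp (\<beta> * x)" "\<And>x. r x \<le> C * exp (- \<mu> * x)"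
    using r_decay by metis
  define \<gamma> where "\<gamma> = min \<beta> \<mu>"
  have \<gamma>: "\<gamma> > 0" "\<gamma> \<le> \<beta>" "\<gamma> \<le> \<mu>" using r lam by (auto simp: \<gamma>_def)
  obtain D where D: "D > 0" "\<And>x::real. (1 + x\<^sup>2)\<^sup>2 \<le> D * exp (\<gamma> * \<bar>x\<bar>)"
    using square_weight_le_exp[OF \<gamma>(1)] by auto
  have "r x * (1 + x\<^sup>2) \<le> C * D" for x
  proof -
    have "r x \<le> C * exp (- (\<gamma> * \<bar>x\<bar>))"
    proof (cases "x \<le> 0")
      case True
      have "\<beta> * x \<le> \<gamma> * x" using True \<gamma> by (intro mult_right_mono_neg) auto
      hence "C * exp (\<beta> * x) \<le> C * exp (- (\<gamma> * \<bar>x\<bar>))" using True r by (intro mult_left_mono) auto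
      thus ?thesis using r(3)[of x] by linarith
    next
      case False
      have "\<gamma> * x \<le> \<mu> * x" using False \<gamma> by (intro mult_right_mono) auto
      hence "C * exp (- \<mu> * x) \<le> C * exp (- (\<gamma> * \<bar>x\<bar>))" using False r by (intro mult_left_mono) auto
      thus ?thesis using r(4)[of x] by linarith
    qed
    moreover have "1 + x\<^sup>2 \<le> D * exp (\<gamma> * \<bar>x\<bar>)"
      using D(2)[of x] self_le_power[of "1 + x\<^sup>2" 2] by simp
    ultimately have "r x * (1 + x\<^sup>2) \<le> (C * exp (- (\<gamma> * \<bar>x\<bar>))) * (D * exp (\<gamma> * \<bar>x\<bar>))"
      using r by (intro mult_mono) auto
    also have "\<dots> = C * D" by (simp add: exp_minus)
    finally show ?thesis .
  qed
  thus thesis using that[of "C * D"] r D by auto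
qed

lemma J_antimono: "x \<le> y \<Longrightarrow> J y \<le> J x"
  by (rule DERIV_nonpos_imp_nonincreasing[where f = J], assumption) (use dJ r_nonneg in force)

text \<open>Since V \<le> 0, the terms c W and - S V are nonnegative; only E V can be negative, and
  \<open>V_ge\<close> makes it small at +infinity.\<close>

lemma J_lower: "J x \<ge> - (K / \<mu> * E 0 + K / \<mu> * E \<mu>) * exp (- \<mu> * x)"
proof -
  have "S \<mu> V x \<le> 0"
  proof -
    have "S \<mu> (\<lambda>t. - V t) x \<ge> 0" by (rule S_nonneg) (use V_le in auto)
    thus ?thesis by (simp add: S_def)
  qed
  moreover have "- (E \<mu> * V x) \<le> E \<mu> * (K / \<mu> * exp (- \<mu> * x))"
    using mult_left_mono[OF V_ge[of x] E_nonneg[of \<mu>]] by simp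
  moreover have "c * W x \<ge> 0" using c_pos w_pos[of \<mu> x] by simp
  moreover have "K / \<mu> * E 0 * exp (- \<mu> * x) \<ge> 0" using K_pos lam E_nonneg by simp
  moreover have "- (K / \<mu> * E 0 + K / \<mu> * E \<mu>) * exp (- \<mu> * x) =
      - (K / \<mu> * E 0 * exp (- \<mu> * x)) - E \<mu> * (K / \<mu> * exp (- \<mu> * x))" by (simp add: algebra_simps)
  moreover have "J x = c * W x - S \<mu> V x + E \<mu> * V x" by (simp add: J_def L_def)
  ultimately show ?thesis by linarith
qed

lemma J_nonneg: "J x \<ge> 0"
proof (rule tendsto_upperbound)
  have "((\<lambda>t. exp (- \<mu> * t)) \<longlongrightarrow> 0) at_top"
    by (rule filterlim_compose[OF exp_at_bot], rule filterlim_tendsto_neg_mult_at_bot[OF tendsto_const])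
      (use lam in \<open>auto intro: filterlim_ident\<close>)
  from tendsto_mult_left[OF this, of "- (K / \<mu> * E 0 + K / \<mu> * E \<mu>)"]
  show "((\<lambda>t. - (K / \<mu> * E 0 + K / \<mu> * E \<mu>) * exp (- \<mu> * t)) \<longlongrightarrow> 0) at_top" by simp
  show "\<forall>\<^sub>F t in at_top. - (K / \<mu> * E 0 + K / \<mu> * E \<mu>) * exp (- \<mu> * t) \<le> J x"
    using eventually_ge_at_top[of x] by eventually_elim (use J_lower J_antimono order_trans in blast)
qed simp

text \<open>Exponential smallness of \<open>r\<close> at -infinity gives \<open>J\<close> not only a
  limit but an exponential rate, which is needed to integrate l - J when \<open>T\<close> is
  compared with -l x.\<close>

lemma J_limit:
  obtains l \<beta> C where "l > 0" "\<beta> > 0" "C \<ge> 0" "\<And>x. J x \<le> l" "\<And>x. l - C * exp (\<beta> * x) \<le> J x"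
proof -
  obtain \<beta> C where r: "\<beta> > 0" "C \<ge> 0" "\<And>x. r x \<le> C * exp (\<beta> * x)" using r_decay by metis
  have up: "J y \<le> J x + C / \<beta> * exp (\<beta> * x)" for x y
  proof (cases "y \<le> x")
    case True
    have "J y + C / \<beta> * exp (\<beta> * y) \<le> J x + C / \<beta> * exp (\<beta> * x)"
    proof (rule DERIV_nonneg_imp_nondecreasing[where f = "\<lambda>x. J x + C / \<beta> * exp (\<beta> * x)", OF True])
      fix t
      have "((\<lambda>x. J x + C / \<beta> * exp (\<beta> * x)) has_real_derivative (- r t + C * exp (\<beta> * t))) (at t)"
        by (rule derivative_eq_intros dJ refl | use r in simp)+
      thus "\<exists>d. ((\<lambda>x. J x + C / \<beta> * exp (\<beta> * x)) has_real_derivative d) (at t) \<and> 0 \<le> d"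
        using r(3)[of t] by auto
    qed
    moreover have "C / \<beta> * exp (\<beta> * y) \<ge> 0" using r by simp
    ultimately show ?thesis by linarith
  next
    case False
    have "C / \<beta> * exp (\<beta> * x) \<ge> 0" using r by simp
    thus ?thesis using J_antimono[of x y] False by linarith
  qed
  define l where "l = (SUP x. J x)"
  have bdd: "bdd_above (range J)" using up[of _ 0] by (intro bdd_aboveI2)
  have le: "J x \<le> l" for x unfolding l_def using bdd by (intro cSUP_upper) auto
  have ge: "l \<le> J x + C / \<beta> * exp (\<beta> * x)" for x
    unfolding l_def using up by (intro cSUP_least) auto
  \<comment> \<open>If l = 0 then \<open>J\<close>, squeezed between 0 and l, vanishes identically,
    and so does \<open>r\<close>, against \<open>R_pos\<close>.\<close>
  have "l > 0"
  proof (rule ccontr)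
    assume "\<not> l > 0"
    hence "J x = 0" for x using le[of x] J_nonneg[of x] by linarith
    hence "J = (\<lambda>x. 0)" by auto
    hence "(J has_real_derivative 0) (at x)" for x by simp
    hence "r x = 0" for x using DERIV_unique[OF dJ] by force
    thus False using R_pos by (auto simp: r_def)
  qed
  thus thesis using le ge r that[of l \<beta> "C / \<beta>"] by (simp add: algebra_simps)
qed

lemma V_mono: "x \<le> y \<Longrightarrow> V x \<le> V y"
  by (rule DERIV_nonneg_imp_nondecreasing[where f = V], assumption) (use dV w_pos in \<open>metis less_imp_le\<close>)

lemma W_harnack:
  obtains B X where "\<And>x t. x + 1 \<le> X \<Longrightarrow> x \<le> t \<Longrightarrow> t \<le> x + 1 \<Longrightarrow> exp (- B) * W x \<le> W t"
proof -
  \<comment> \<open>With the constant 1 the remainder is at most W + S W, so the nonlocal part of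
    \<open>L\<close> compensates it exactly and only a zero-order loss remains.\<close>
  obtain X where X: "\<And>x. x \<le> X \<Longrightarrow> R x \<le> 1 * (\<phi> x + S 0 \<phi> x)" using R_small[of 1] by auto
  define B where "B = (E \<mu> + 1) / c"
  have B: "B \<ge> 0" using E_nonneg[of \<mu>] c_pos by (simp add: B_def)
  show thesis
  proof (rule that[of X B])
    fix x t assume x: "x + 1 \<le> X" "x \<le> t" "t \<le> x + 1"
    have "W x \<le> exp (B * (t - x)) * (W t + 0 * (t - x))"
    proof (rule weak_harnack_left[OF x(2) B order_refl dW])
      fix q assume q: "x \<le> q" "q \<le> t"
      have "r q \<le> exp (- \<mu> * q) * (\<phi> q + S 0 \<phi> q)"
        unfolding r_def using X[of q] q x by (intro mult_left_mono) auto
      also have "\<dots> = W q + S \<mu> W q" unfolding S_w by (simp add: w_def distrib_left)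
      finally have "L \<mu> W q - r q \<ge> - ((E \<mu> + 1) * W q)" by (simp add: L_def distrib_right)
      hence "(L \<mu> W q - r q) / c \<ge> - ((E \<mu> + 1) * W q) / c" using c_pos by (intro divide_right_mono) auto
      thus "(L \<mu> W q - r q) / c \<ge> - B * W q - 0" by (simp add: B_def)
    qed
    also have "\<dots> \<le> exp B * W t"
    proof -
      have "B * (t - x) \<le> B * 1" using x B by (intro mult_left_mono) auto
      thus ?thesis using w_pos[of \<mu> t] by (auto intro!: mult_right_mono)
    qed
    finally show "exp (- B) * W x \<le> W t" by (simp only: exp_minus_mult_le_iff)
  qed
qed

lemma U_taylor_nonneg: "U (x + \<alpha>) - U x - \<alpha> * V x \<ge> 0"
proof -
  define g where "g t = U t - t * V x" for t
  have dg: "(g has_real_derivative (V t - V x)) (at t)" for t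
    unfolding g_def by (rule derivative_eq_intros dU refl | simp)+
  have "g x \<le> g (x + \<alpha>)"
  proof (cases "\<alpha> \<ge> 0")
    case True
    hence "x \<le> x + \<alpha>" by simp
    thus ?thesis
    proof (rule DERIV_nonneg_imp_nondecreasing[where f = g])
      fix t assume "x \<le> t"
      thus "\<exists>d. (g has_real_derivative d) (at t) \<and> 0 \<le> d" using dg[of t] V_mono[of x t] by auto
    qed
  next
    case False
    hence "x + \<alpha> \<le> x" by simp
    thus ?thesis
    proof (rule DERIV_nonpos_imp_nonincreasing[where f = g])
      fix t assume "t \<le> x"
      thus "\<exists>d. (g has_real_derivative d) (at t) \<and> d \<le> 0" using dg[of t] V_mono[of t x] by auto
    qed
  qed
  thus ?thesis by (simp add: g_def algebra_simps)
qed

lemma T_int: "integrable \<rho> (\<lambda>\<alpha>. exp (\<mu> * \<alpha>) * (U (x + \<alpha>) - U x - \<alpha> * V x))"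
proof -
  have "integrable \<rho> (\<lambda>\<alpha>. exp (\<mu> * \<alpha>) * U (x + \<alpha>) - U x * exp (\<mu> * \<alpha>) - V x * (exp (\<mu> * \<alpha>) * \<alpha>))"
    by (intro Bochner_Integration.integrable_diff integrable_mult_right U_shift_int moment1_int[OF mu_Lam] exp_int mu_Lam)
  thus ?thesis by (simp add: algebra_simps)
qed

lemma T_eq: "T x = (\<integral>\<alpha>. exp (\<mu> * \<alpha>) * (U (x + \<alpha>) - U x - \<alpha> * V x) \<partial>\<rho>)"
proof -
  have "(\<integral>\<alpha>. exp (\<mu> * \<alpha>) * (U (x + \<alpha>) - U x - \<alpha> * V x) \<partial>\<rho>) =
    (\<integral>\<alpha>. (exp (\<mu> * \<alpha>) * U (x + \<alpha>) - U x * exp (\<mu> * \<alpha>)) - V x * (exp (\<mu> * \<alpha>) * \<alpha>) \<partial>\<rho>)"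
    by (intro Bochner_Integration.integral_cong) (auto simp: algebra_simps)
  also have "\<dots> = S \<mu> U x - U x * E \<mu> - V x * (c - m)"
    using U_shift_int[of x] moment1_int[OF mu_Lam] exp_int[OF mu_Lam]
    by (simp add: S_def E_def m_def)
  finally show ?thesis by (simp add: T_def L_def mult.commute)
qed

text \<open>All second-order remainders of the convex \<open>U\<close> are nonnegative, and the one
  at the atom \<alpha> = 1 is at least exp (- B) W x / 2, because on [x, x + 1] \<open>W\<close>
  stays above exp (- B) W x.\<close>

lemma W_le_T:
  obtains \<kappa> X where "\<kappa> > 0" "\<And>x. x \<le> X \<Longrightarrow> \<kappa> * W x \<le> T x"
proof -
  obtain B X where B: "\<And>x t. x + 1 \<le> X \<Longrightarrow> x \<le> t \<Longrightarrow> t \<le> x + 1 \<Longrightarrow> exp (- B) * W x \<le> W t"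
    using W_harnack by metis
  show thesis
  proof (rule that[of "d0 * exp \<mu> * (exp (- B) / 2)" "X - 1"])
    fix x assume x: "x \<le> X - 1"
    define k where "k = exp (- B) * W x"
    have V: "V t \<ge> V x + k * (t - x)" if t: "x \<le> t" "t \<le> x + 1" for t
    proof -
      have "V x - k * x \<le> V t - k * t"
      proof (rule DERIV_nonneg_imp_nondecreasing[where f = "\<lambda>t. V t - k * t", OF t(1)])
        fix q assume "x \<le> q" "q \<le> t"
        hence "k \<le> W q" unfolding k_def using x t by (intro B) auto
        moreover have "((\<lambda>t. V t - k * t) has_real_derivative (W q - k)) (at q)"
          by (rule derivative_eq_intros dV refl | simp)+
        ultimately show "\<exists>d. ((\<lambda>t. V t - k * t) has_real_derivative d) (at q) \<and> 0 \<le> d" by auto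
      qed
      thus ?thesis by (simp add: algebra_simps)
    qed
    define g where "g t = U t - V x * t - k * (t - x)\<^sup>2 / 2" for t
    have "x \<le> x + 1" by simp
    hence "g x \<le> g (x + 1)"
    proof (rule DERIV_nonneg_imp_nondecreasing[where f = g])
      fix t assume t: "x \<le> t" "t \<le> x + 1"
      have "(g has_real_derivative (V t - V x - k * (t - x))) (at t)"
        unfolding g_def by (rule derivative_eq_intros dU refl | simp)+
      thus "\<exists>d. (g has_real_derivative d) (at t) \<and> 0 \<le> d" using V[OF t] by auto
    qed
    hence "k / 2 \<le> U (x + 1) - U x - 1 * V x" by (simp add: g_def algebra_simps)
    hence "d0 * (exp \<mu> * (k / 2)) \<le> d0 * (exp (\<mu> * 1) * (U (x + 1) - U x - 1 * V x))"
      using d0_pos by (intro mult_left_mono) auto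
    also have "\<dots> \<le> (\<integral>\<alpha>. exp (\<mu> * \<alpha>) * (U (x + \<alpha>) - U x - \<alpha> * V x) \<partial>\<rho>)"
      by (rule atom[OF T_int]) (use U_taylor_nonneg in auto)
    also have "\<dots> = T x" by (simp add: T_eq)
    finally show "d0 * exp \<mu> * (exp (- B) / 2) * W x \<le> T x" by (simp add: k_def)
  qed (use d0_pos in auto)
qed

text \<open>T' = m W - J \<ge> - l bounds \<open>T\<close> by a linear function on the left
  half-line, and \<open>T\<close> controls \<open>W\<close>. For m = 0 this is the true order of
  growth; for m > 0 it makes the supremum in \<open>W_bounded\<close> finite.\<close>

lemma W_linear_growth: obtains C where "C \<ge> 0" "\<And>x. W x \<le> C * (1 + \<bar>x\<bar>)"
proof -
  obtain l where l: "l > 0" "\<And>x. J x \<le> l" using J_limit by metis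
  obtain \<kappa> X where \<kappa>: "\<kappa> > 0" "\<And>x. x \<le> X \<Longrightarrow> \<kappa> * W x \<le> T x" using W_le_T by metis
  have T: "T x \<le> T 0 + l * \<bar>x\<bar>" if "x \<le> 0" for x
  proof -
    have "T x + l * x \<le> T 0 + l * 0"
    proof (rule DERIV_nonneg_imp_nondecreasing[where f = "\<lambda>x. T x + l * x", OF that])
      fix t
      have "((\<lambda>x. T x + l * x) has_real_derivative (m * W t - J t + l)) (at t)"
        by (rule derivative_eq_intros dT refl | simp)+
      moreover have "m * W t \<ge> 0" using m_nonneg w_pos[of \<mu> t] by simp
      ultimately show "\<exists>d. ((\<lambda>x. T x + l * x) has_real_derivative d) (at t) \<and> 0 \<le> d"
        using l(2)[of t] by auto
    qed
    thus ?thesis using that by simp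
  qed
  define Y where "Y = min X 0"
  define C1 where "C1 = (\<bar>T 0\<bar> + l) / \<kappa>"
  define C2 where "C2 = K * exp (- \<mu> * Y)"
  have C: "C1 \<ge> 0" "C2 \<ge> 0" using l \<kappa> K_pos by (auto simp: C1_def C2_def)
  have "W x \<le> (C1 + C2) * (1 + \<bar>x\<bar>)" for x
  proof (cases "x \<le> Y")
    case True
    have "\<kappa> * W x \<le> T 0 + l * \<bar>x\<bar>" using \<kappa>(2)[of x] T[of x] True by (auto simp: Y_def)
    also have "\<dots> \<le> (\<bar>T 0\<bar> + l) * (1 + \<bar>x\<bar>)"
    proof -
      have "(\<bar>T 0\<bar> + l) * (1 + \<bar>x\<bar>) = \<bar>T 0\<bar> + l + \<bar>T 0\<bar> * \<bar>x\<bar> + l * \<bar>x\<bar>" by (simp add: algebra_simps)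
      moreover have "\<bar>T 0\<bar> * \<bar>x\<bar> \<ge> 0" by simp
      ultimately show ?thesis using l(1) by linarith
    qed
    finally have "W x \<le> C1 * (1 + \<bar>x\<bar>)" using \<kappa> by (simp add: C1_def pos_le_divide_eq mult.commute)
    also have "\<dots> \<le> (C1 + C2) * (1 + \<bar>x\<bar>)" using C by (intro mult_right_mono) auto
    finally show ?thesis .
  next
    case False
    have "W x \<le> K * exp (- \<mu> * x)" by (rule W_le)
    also have "\<dots> \<le> C2 * 1" unfolding C2_def using K_pos lam False by (auto intro!: mult_left_mono)
    also have "\<dots> \<le> (C1 + C2) * (1 + \<bar>x\<bar>)" using C by (intro mult_mono) auto
    finally show ?thesis .
  qed
  thus thesis using that[of "C1 + C2"] C by auto
qed

end

section \<open>Almost constant profiles and boundedness of \<open>W\<close>\<close>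

context wave_flux
begin

definition Q :: real where "Q = (\<integral>\<alpha>. exp (\<mu> * \<alpha>) * (1 + \<alpha>\<^sup>2)\<^sup>2 \<partial>\<rho>)"

definition k :: real where "k = (\<integral>\<alpha>. exp (\<mu> * \<alpha>) * \<alpha>\<^sup>2 \<partial>\<rho>) / 2"

lemma Q_int: "integrable \<rho> (\<lambda>\<alpha>. exp (\<mu> * \<alpha>) * (1 + \<alpha>\<^sup>2)\<^sup>2)"
  by (rule moment_int[OF mu_Lam, of _ 1]) auto

lemma Q_nonneg: "Q \<ge> 0"
  unfolding Q_def by (intro integral_nonneg_AE AE_I2) auto

lemma square_int: "integrable \<rho> (\<lambda>\<alpha>. exp (\<mu> * \<alpha>) * \<alpha>\<^sup>2)"
proof (rule moment_int[OF mu_Lam, of _ 1])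
  fix \<alpha> :: real
  have "\<alpha>\<^sup>2 \<le> (1 + \<alpha>\<^sup>2) ^ 1" by simp
  also have "\<dots> \<le> (1 + \<alpha>\<^sup>2)\<^sup>2" by (intro power_increasing) auto
  finally show "\<bar>exp (\<mu> * \<alpha>) * \<alpha>\<^sup>2\<bar> \<le> 1 * (exp (\<mu> * \<alpha>) * (1 + \<alpha>\<^sup>2)\<^sup>2)" by (simp add: abs_mult)
qed auto

lemma k_pos: "k > 0"
proof -
  have "d0 * (exp (\<mu> * 1) * 1\<^sup>2) \<le> (\<integral>\<alpha>. exp (\<mu> * \<alpha>) * \<alpha>\<^sup>2 \<partial>\<rho>)"
    by (rule atom[OF square_int]) auto
  moreover have "d0 * (exp (\<mu> * 1) * 1\<^sup>2) > 0" using d0_pos by simp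
  ultimately show ?thesis unfolding k_def by linarith
qed

lemma weighted_integral_bound:
  assumes "integrable \<rho> (\<lambda>\<alpha>. exp (\<mu> * \<alpha>) * g \<alpha>)" "\<And>\<alpha>. \<bar>g \<alpha>\<bar> \<le> e * (1 + \<alpha>\<^sup>2)\<^sup>2"
  shows "\<bar>\<integral>\<alpha>. exp (\<mu> * \<alpha>) * g \<alpha> \<partial>\<rho>\<bar> \<le> e * Q"
proof -
  have "\<bar>\<integral>\<alpha>. exp (\<mu> * \<alpha>) * g \<alpha> \<partial>\<rho>\<bar> \<le> (\<integral>\<alpha>. \<bar>exp (\<mu> * \<alpha>) * g \<alpha>\<bar> \<partial>\<rho>)"
    by (rule integral_abs_bound)
  also have "\<dots> \<le> (\<integral>\<alpha>. e * (exp (\<mu> * \<alpha>) * (1 + \<alpha>\<^sup>2)\<^sup>2) \<partial>\<rho>)"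
  proof (rule integral_mono)
    show "\<bar>exp (\<mu> * \<alpha>) * g \<alpha>\<bar> \<le> e * (exp (\<mu> * \<alpha>) * (1 + \<alpha>\<^sup>2)\<^sup>2)" for \<alpha>
      using mult_left_mono[OF assms(2)[of \<alpha>], of "exp (\<mu> * \<alpha>)"] by (simp add: abs_mult ac_simps)
  qed (use assms Q_int in \<open>auto intro: integrable_mult_right\<close>)
  also have "\<dots> = e * Q" by (simp add: Q_def)
  finally show ?thesis .
qed

lemma abs_le_weight: "\<bar>t\<bar> \<le> 1 + t\<^sup>2" for t :: real
  using one_plus_abs_le[of "\<bar>t\<bar>"] sum_squares_bound[of "\<bar>t\<bar>" 1] by (simp add: power2_eq_square)

text \<open>The hypothesis \<open>near\<close> is the form in which the maximum principle delivers
  its conclusion. \<open>N\<close> is the scale: the expected growth at x, or \<open>W x\<close>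
  itself. It is integrated once for \<open>V\<close> and twice for \<open>U\<close>; applying the
  kernel then costs a fixed moment.\<close>

context
  fixes x N A \<epsilon> :: real
  assumes N: "N > 0" and \<epsilon>: "\<epsilon> \<ge> 0"
    and near: "\<And>t. \<bar>W (x + t) / N - A\<bar> \<le> \<epsilon> * (1 + t\<^sup>2)"
begin

lemma near_W: "\<bar>W (x + t) - N * A\<bar> \<le> N * \<epsilon> * (1 + t\<^sup>2)"
proof -
  have "W (x + t) - N * A = N * (W (x + t) / N - A)" using N by (simp add: right_diff_distrib)
  hence "\<bar>W (x + t) - N * A\<bar> = N * \<bar>W (x + t) / N - A\<bar>" using N by (simp only: abs_mult abs_of_pos)
  also have "\<dots> \<le> N * (\<epsilon> * (1 + t\<^sup>2))" using N near by (intro mult_left_mono) auto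
  finally show ?thesis by (simp add: mult.assoc)
qed

lemma near_V: "\<bar>V (x + t) - V x - N * A * t\<bar> \<le> N * \<epsilon> * ((1 + t\<^sup>2) * \<bar>t\<bar>)"
proof -
  define u where "u t = V (x + t) - N * A * t" for t
  have du: "(u has_real_derivative (W (x + t) - N * A)) (at t)" for t
    unfolding u_def
    by (rule derivative_eq_intros DERIV_chain2[OF dV] refl | simp)+
  have "\<bar>u t - u 0\<bar> \<le> N * \<epsilon> * (1 + t\<^sup>2) * \<bar>t - 0\<bar>"
  proof (rule real_mvt_bound[OF du])
    fix s assume "s \<in> closed_segment 0 t"
    hence "\<bar>s\<bar> \<le> \<bar>t\<bar>" by (auto simp: closed_segment_eq_real_ivl split: if_splits)
    hence "s\<^sup>2 \<le> t\<^sup>2" by (simp add: abs_le_square_iff)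
    hence "N * \<epsilon> * (1 + s\<^sup>2) \<le> N * \<epsilon> * (1 + t\<^sup>2)" using N \<epsilon> by (intro mult_left_mono) auto
    thus "\<bar>W (x + s) - N * A\<bar> \<le> N * \<epsilon> * (1 + t\<^sup>2)" using near_W[of s] by linarith
  qed
  thus ?thesis by (simp add: u_def algebra_simps)
qed

lemma near_U: "\<bar>U (x + t) - U x - t * V x - N * A * t\<^sup>2 / 2\<bar> \<le> N * \<epsilon> * ((1 + t\<^sup>2) * t\<^sup>2)"
proof -
  define u where "u t = U (x + t) - t * V x - N * A * t\<^sup>2 / 2" for t
  have du: "(u has_real_derivative (V (x + t) - V x - N * A * t)) (at t)" for t
    unfolding u_def
    by (rule derivative_eq_intros DERIV_chain2[OF dU] refl | simp)+
  have "\<bar>u t - u 0\<bar> \<le> N * \<epsilon> * ((1 + t\<^sup>2) * \<bar>t\<bar>) * \<bar>t - 0\<bar>"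
  proof (rule real_mvt_bound[OF du])
    fix s assume "s \<in> closed_segment 0 t"
    hence s: "\<bar>s\<bar> \<le> \<bar>t\<bar>" by (auto simp: closed_segment_eq_real_ivl split: if_splits)
    hence "s\<^sup>2 \<le> t\<^sup>2" by (simp add: abs_le_square_iff)
    hence "(1 + s\<^sup>2) * \<bar>s\<bar> \<le> (1 + t\<^sup>2) * \<bar>t\<bar>" using s by (intro mult_mono) auto
    hence "N * \<epsilon> * ((1 + s\<^sup>2) * \<bar>s\<bar>) \<le> N * \<epsilon> * ((1 + t\<^sup>2) * \<bar>t\<bar>)" using N \<epsilon> by (intro mult_left_mono) auto
    thus "\<bar>V (x + s) - V x - N * A * s\<bar> \<le> N * \<epsilon> * ((1 + t\<^sup>2) * \<bar>t\<bar>)" using near_V[of s] by linarith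
  qed
  moreover have "N * \<epsilon> * ((1 + t\<^sup>2) * \<bar>t\<bar>) * \<bar>t - 0\<bar> = N * \<epsilon> * ((1 + t\<^sup>2) * t\<^sup>2)"
    by (simp add: power2_eq_square)
  moreover have "u t - u 0 = U (x + t) - U x - t * V x - N * A * t\<^sup>2 / 2" by (simp add: u_def)
  ultimately show ?thesis by (simp only:)
qed

lemma e_nonneg: "N * \<epsilon> \<ge> 0" using N \<epsilon> by simp

lemma div_bound: "\<bar>y - N * z\<bar> \<le> N * \<epsilon> * C \<Longrightarrow> \<bar>y / N - z\<bar> \<le> \<epsilon> * C"
proof -
  assume "\<bar>y - N * z\<bar> \<le> N * \<epsilon> * C"
  hence "\<bar>y - N * z\<bar> / N \<le> N * \<epsilon> * C / N" using N by (intro divide_right_mono) auto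
  moreover have "y / N - z = (y - N * z) / N" using N by (simp add: diff_divide_distrib)
  hence "\<bar>y - N * z\<bar> / N = \<bar>y / N - z\<bar>" using N by (simp only: abs_divide abs_of_pos)
  ultimately show ?thesis using N by simp
qed

text \<open>If \<open>W\<close> were equal to N A, the increments of \<open>V\<close> would be N A
  \<alpha>, and \<open>J\<close> would be N A times c minus the first moment, that is N A m; the
  deviation is integrated against the kernel.\<close>

lemma J_near: "\<bar>J x / N - A * m\<bar> \<le> \<epsilon> * (c + Q)"
proof (rule div_bound)
  have i: "integrable \<rho> (\<lambda>\<alpha>. exp (\<mu> * \<alpha>) * (V (x + \<alpha>) - V x))"
    using V_shift_int[of x] exp_int[OF mu_Lam] by (simp add: right_diff_distrib)
  have i2: "integrable \<rho> (\<lambda>\<alpha>. exp (\<mu> * \<alpha>) * (V (x + \<alpha>) - V x - N * A * \<alpha>))"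
  proof -
    have "integrable \<rho> (\<lambda>\<alpha>. exp (\<mu> * \<alpha>) * (V (x + \<alpha>) - V x) - N * A * (exp (\<mu> * \<alpha>) * \<alpha>))"
      by (intro Bochner_Integration.integrable_diff i integrable_mult_right moment1_int[OF mu_Lam])
    thus ?thesis by (simp add: algebra_simps)
  qed
  have "(\<integral>\<alpha>. exp (\<mu> * \<alpha>) * (V (x + \<alpha>) - V x - N * A * \<alpha>) \<partial>\<rho>)
      = (\<integral>\<alpha>. exp (\<mu> * \<alpha>) * (V (x + \<alpha>) - V x) - N * A * (exp (\<mu> * \<alpha>) * \<alpha>) \<partial>\<rho>)"
    by (intro Bochner_Integration.integral_cong) (auto simp: algebra_simps)
  also have "\<dots> = L \<mu> V x - N * A * (c - m)"
    using i moment1_int[OF mu_Lam] by (simp add: m_def L_eq[OF mu_Lam V_shift_int])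
  finally have eq: "J x - N * (A * m) = c * (W x - N * A) -
      (\<integral>\<alpha>. exp (\<mu> * \<alpha>) * (V (x + \<alpha>) - V x - N * A * \<alpha>) \<partial>\<rho>)"
    by (simp add: J_def algebra_simps)
  have 1: "\<bar>\<integral>\<alpha>. exp (\<mu> * \<alpha>) * (V (x + \<alpha>) - V x - N * A * \<alpha>) \<partial>\<rho>\<bar> \<le> N * \<epsilon> * Q"
  proof (rule weighted_integral_bound[OF i2])
    fix \<alpha> :: real
    have "(1 + \<alpha>\<^sup>2) * \<bar>\<alpha>\<bar> \<le> (1 + \<alpha>\<^sup>2) * (1 + \<alpha>\<^sup>2)" by (intro mult_left_mono abs_le_weight) auto
    hence "N * \<epsilon> * ((1 + \<alpha>\<^sup>2) * \<bar>\<alpha>\<bar>) \<le> N * \<epsilon> * (1 + \<alpha>\<^sup>2)\<^sup>2"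
      unfolding power2_eq_square[of "1 + \<alpha>\<^sup>2"] by (rule mult_left_mono[OF _ e_nonneg])
    thus "\<bar>V (x + \<alpha>) - V x - N * A * \<alpha>\<bar> \<le> N * \<epsilon> * (1 + \<alpha>\<^sup>2)\<^sup>2" using near_V[of \<alpha>] by linarith
  qed
  have "\<bar>W x - N * A\<bar> \<le> N * \<epsilon>" using near_W[of 0] by simp
  hence "c * \<bar>W x - N * A\<bar> \<le> c * (N * \<epsilon>)" using c_pos by (intro mult_left_mono) auto
  hence "\<bar>c * (W x - N * A)\<bar> \<le> N * \<epsilon> * c" using c_pos by (simp add: abs_mult mult.commute)
  moreover have "N * \<epsilon> * (c + Q) = N * \<epsilon> * c + N * \<epsilon> * Q" by (rule distrib_left)
  ultimately show "\<bar>J x - N * (A * m)\<bar> \<le> N * \<epsilon> * (c + Q)" unfolding eq using 1 by linarith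
qed

text \<open>If \<open>W\<close> were equal to N A, the Taylor remainder of \<open>U\<close> would be
  N A \<alpha>^2 / 2, whose integral is N A k whatever the value of m.\<close>

lemma T_near: "\<bar>T x / N - A * k\<bar> \<le> \<epsilon> * Q"
proof (rule div_bound)
  have i2: "integrable \<rho> (\<lambda>\<alpha>. exp (\<mu> * \<alpha>) * (U (x + \<alpha>) - U x - \<alpha> * V x - N * A * \<alpha>\<^sup>2 / 2))"
  proof -
    have "integrable \<rho> (\<lambda>\<alpha>. exp (\<mu> * \<alpha>) * (U (x + \<alpha>) - U x - \<alpha> * V x) - N * A / 2 * (exp (\<mu> * \<alpha>) * \<alpha>\<^sup>2))"
      by (intro Bochner_Integration.integrable_diff T_int integrable_mult_right square_int)
    thus ?thesis by (simp add: algebra_simps)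
  qed
  have "(\<integral>\<alpha>. exp (\<mu> * \<alpha>) * (U (x + \<alpha>) - U x - \<alpha> * V x - N * A * \<alpha>\<^sup>2 / 2) \<partial>\<rho>)
      = (\<integral>\<alpha>. exp (\<mu> * \<alpha>) * (U (x + \<alpha>) - U x - \<alpha> * V x) - N * A / 2 * (exp (\<mu> * \<alpha>) * \<alpha>\<^sup>2) \<partial>\<rho>)"
    by (intro Bochner_Integration.integral_cong) (auto simp: algebra_simps)
  also have "\<dots> = T x - N * (A * k)"
    using T_int[of x] square_int by (simp add: k_def T_eq)
  finally have eq: "T x - N * (A * k) =
      (\<integral>\<alpha>. exp (\<mu> * \<alpha>) * (U (x + \<alpha>) - U x - \<alpha> * V x - N * A * \<alpha>\<^sup>2 / 2) \<partial>\<rho>)" by simp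
  show "\<bar>T x - N * (A * k)\<bar> \<le> N * \<epsilon> * Q" unfolding eq
  proof (rule weighted_integral_bound[OF i2])
    fix \<alpha> :: real
    have "(1 + \<alpha>\<^sup>2) * \<alpha>\<^sup>2 \<le> (1 + \<alpha>\<^sup>2) * (1 + \<alpha>\<^sup>2)" by (intro mult_left_mono) auto
    hence "N * \<epsilon> * ((1 + \<alpha>\<^sup>2) * \<alpha>\<^sup>2) \<le> N * \<epsilon> * (1 + \<alpha>\<^sup>2)\<^sup>2"
      unfolding power2_eq_square[of "1 + \<alpha>\<^sup>2"] by (rule mult_left_mono[OF _ e_nonneg])
    thus "\<bar>U (x + \<alpha>) - U x - \<alpha> * V x - N * A * \<alpha>\<^sup>2 / 2\<bar> \<le> N * \<epsilon> * (1 + \<alpha>\<^sup>2)\<^sup>2"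
      using near_U[of \<alpha>] by linarith
  qed
qed

lemma LW_near: "\<bar>L \<mu> W x / N\<bar> \<le> \<epsilon> * (2 * Q)"
proof -
  have i: "integrable \<rho> (\<lambda>\<alpha>. exp (\<mu> * \<alpha>) * (W (x + \<alpha>) - W x))"
    using w_shift_int[of \<mu> x] exp_int[OF mu_Lam] by (simp add: right_diff_distrib)
  have "\<bar>\<integral>\<alpha>. exp (\<mu> * \<alpha>) * (W (x + \<alpha>) - W x) \<partial>\<rho>\<bar> \<le> (N * \<epsilon> * 2) * Q"
  proof (rule weighted_integral_bound[OF i])
    fix \<alpha> :: real
    have "\<bar>W (x + \<alpha>) - W x\<bar> \<le> N * \<epsilon> * (1 + \<alpha>\<^sup>2) + N * \<epsilon>"
      using near_W[of \<alpha>] near_W[of 0] by simp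
    also have "\<dots> = N * \<epsilon> * ((1 + \<alpha>\<^sup>2) + 1)" by (simp add: distrib_left)
    also have "\<dots> \<le> N * \<epsilon> * (2 * (1 + \<alpha>\<^sup>2)\<^sup>2)"
    proof (rule mult_left_mono[OF _ e_nonneg])
      have "1 + \<alpha>\<^sup>2 \<le> (1 + \<alpha>\<^sup>2)\<^sup>2" using power_increasing[of 1 2 "1 + \<alpha>\<^sup>2"] by simp
      moreover have "\<alpha>\<^sup>2 \<ge> 0" by simp
      ultimately show "1 + \<alpha>\<^sup>2 + 1 \<le> 2 * (1 + \<alpha>\<^sup>2)\<^sup>2" by linarith
    qed
    finally show "\<bar>W (x + \<alpha>) - W x\<bar> \<le> N * \<epsilon> * 2 * (1 + \<alpha>\<^sup>2)\<^sup>2" by (simp add: mult.assoc)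
  qed
  hence "\<bar>L \<mu> W x - N * 0\<bar> \<le> N * \<epsilon> * (2 * Q)"
    by (simp add: L_eq[OF mu_Lam w_shift_int] mult.assoc)
  from div_bound[OF this] show ?thesis by simp
qed

end

text \<open>The function \<sigma> (A - W (x + t) / N) solves the linear equation with source
  \<sigma> r / N, because \<open>L\<close> annihilates the constant A, so \<open>propagation\<close>
  applies to it. The sign \<sigma> treats near-maxima and near-minima together.\<close>

lemma near_of_one_sided:
  assumes \<epsilon>: "\<epsilon> > 0"
  obtains \<delta> where "\<delta> > 0" "\<And>\<sigma> x N A t. \<bar>\<sigma>\<bar> = 1 \<Longrightarrow> N > 0 \<Longrightarrow> (\<And>t. \<bar>A - W (x + t) / N\<bar> \<le> C * (1 + \<bar>t\<bar>)) \<Longrightarrow>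
    (\<And>t. \<sigma> * (A - W (x + t) / N) \<ge> - \<delta> * (1 + t\<^sup>2)) \<Longrightarrow> (\<And>t. r (x + t) / N \<le> \<delta> * (1 + t\<^sup>2)) \<Longrightarrow>
    \<sigma> * (A - W x / N) \<le> \<delta> \<Longrightarrow> \<bar>W (x + t) / N - A\<bar> \<le> \<epsilon> * (1 + t\<^sup>2)"
proof -
  obtain \<delta> where \<delta>: "\<delta> > 0" and max_principle: "\<And>z z' t. (\<And>t. (z has_real_derivative z' t) (at t)) \<Longrightarrow>
      (\<And>t. \<bar>z t\<bar> \<le> C * (1 + \<bar>t\<bar>)) \<Longrightarrow> (\<And>t. z t \<ge> - \<delta> * (1 + t\<^sup>2)) \<Longrightarrow>
      (\<And>t. \<bar>c * z' t - L \<mu> z t\<bar> \<le> \<delta> * (1 + t\<^sup>2)) \<Longrightarrow> z 0 \<le> \<delta> \<Longrightarrow> \<bar>z t\<bar> \<le> \<epsilon> * (1 + t\<^sup>2)"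
    using propagation[OF c_pos mu_Lam \<epsilon>, of C] by metis
  show thesis
  proof (rule that[OF \<delta>])
    fix \<sigma> x N A t
    assume \<sigma>: "\<bar>\<sigma>\<bar> = 1" and N: "N > 0" and A: "\<And>t. \<bar>A - W (x + t) / N\<bar> \<le> C * (1 + \<bar>t\<bar>)"
      and low: "\<And>t. \<sigma> * (A - W (x + t) / N) \<ge> - \<delta> * (1 + t\<^sup>2)" and r: "\<And>t. r (x + t) / N \<le> \<delta> * (1 + t\<^sup>2)"
      and z0: "\<sigma> * (A - W x / N) \<le> \<delta>"
    define z where "z t = \<sigma> * (A - W (x + t) / N)" for t
    define z' where "z' t = - \<sigma> * ((L \<mu> W (x + t) - r (x + t)) / c / N)" for t
    have dz: "(z has_real_derivative z' t) (at t)" for t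
      unfolding z_def z'_def by (rule derivative_eq_intros DERIV_chain2[OF dW] refl | use N in simp)+
    have Lz: "L \<mu> z t = - \<sigma> * (L \<mu> W (x + t) / N)" for t
    proof -
      have "S \<mu> z t = (\<integral>\<alpha>. \<sigma> * A * exp (\<mu> * \<alpha>) - \<sigma> / N * (exp (\<mu> * \<alpha>) * W (x + t + \<alpha>)) \<partial>\<rho>)"
        unfolding S_def z_def
        by (intro Bochner_Integration.integral_cong) (auto simp: algebra_simps)
      also have "\<dots> = \<sigma> * A * E \<mu> - \<sigma> / N * S \<mu> W (x + t)"
        unfolding S_def E_def using w_shift_int[of \<mu> "x + t"] exp_int[OF mu_Lam]
        by (subst Bochner_Integration.integral_diff) auto
      finally show ?thesis by (simp add: L_def z_def algebra_simps diff_divide_distrib)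
    qed
    have eq: "c * z' t - L \<mu> z t = \<sigma> * (r (x + t) / N)" for t
      unfolding Lz z'_def using c_pos N by (simp add: field_simps)
    have "\<bar>z t\<bar> \<le> \<epsilon> * (1 + t\<^sup>2)"
    proof (rule max_principle[OF dz])
      show "\<bar>z t\<bar> \<le> C * (1 + \<bar>t\<bar>)" for t using A[of t] \<sigma> by (simp add: z_def abs_mult)
      show "z t \<ge> - \<delta> * (1 + t\<^sup>2)" for t using low[of t] by (simp add: z_def)
      show "\<bar>c * z' t - L \<mu> z t\<bar> \<le> \<delta> * (1 + t\<^sup>2)" for t
        unfolding eq using \<sigma> r[of t] r_nonneg[of "x + t"] N by (simp add: abs_mult)
      show "z 0 \<le> \<delta>" using z0 by (simp add: z_def)
    qed
    thus "\<bar>W (x + t) / N - A\<bar> \<le> \<epsilon> * (1 + t\<^sup>2)" using \<sigma> by (simp add: z_def abs_mult abs_minus_commute)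
  qed
qed

text \<open>If \<open>W\<close> were unbounded, then near a point where \<open>W x / (1 + \<bar>x\<bar> / n)\<close> is almost maximal \<open>W\<close> would be
  almost constant, so \<open>J \<approx> m W\<close> there, although \<open>J\<close> is bounded.\<close>
lemma W_bounded:
  assumes m: "m > 0"
  shows "\<exists>C. \<forall>x. W x \<le> C"
proof (rule ccontr)
  assume "\<not> ?thesis"
  hence unb: "\<exists>x. W x > C" for C by (auto simp: not_le)
  obtain l where l: "l > 0" "\<And>x. J x \<le> l" using J_limit by metis
  obtain Cw where Cw: "Cw \<ge> 0" "\<And>x. W x \<le> Cw * (1 + \<bar>x\<bar>)" using W_linear_growth by metis
  obtain Cr where Cr: "Cr \<ge> 0" "\<And>x. r x * (1 + x\<^sup>2) \<le> Cr" using r_weight by metis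
  \<comment> \<open>Makes the error in \<open>J_near\<close> at most m / 2, so that J \<ge> m N / 2
    at the point chosen below.\<close>
  define \<epsilon> where "\<epsilon> = m / 2 / (c + Q)"
  have cQ: "c + Q > 0" using c_pos Q_nonneg by simp
  have \<epsilon>: "\<epsilon> > 0" "\<epsilon> * (c + Q) = m / 2" 
  proof -
    show "\<epsilon> > 0" unfolding \<epsilon>_def using m cQ by (intro divide_pos_pos) auto
    show "\<epsilon> * (c + Q) = m / 2" unfolding \<epsilon>_def using cQ by (intro nonzero_eq_divide_eq[THEN iffD1]) auto
  qed
  obtain \<delta> where \<delta>: "\<delta> > 0" and near: "\<And>\<sigma> x N A t. \<bar>\<sigma>\<bar> = 1 \<Longrightarrow> N > 0 \<Longrightarrow> (\<And>t. \<bar>A - W (x + t) / N\<bar> \<le> 4 * (1 + \<bar>t\<bar>)) \<Longrightarrow>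
    (\<And>t. \<sigma> * (A - W (x + t) / N) \<ge> - \<delta> * (1 + t\<^sup>2)) \<Longrightarrow> (\<And>t. r (x + t) / N \<le> \<delta> * (1 + t\<^sup>2)) \<Longrightarrow>
    \<sigma> * (A - W x / N) \<le> \<delta> \<Longrightarrow> \<bar>W (x + t) / N - A\<bar> \<le> \<epsilon> * (1 + t\<^sup>2)"
    using near_of_one_sided[OF \<epsilon>(1), of 4] by metis
  define d where "d = min \<delta> 1"
  have d: "d > 0" "d \<le> \<delta>" "d \<le> 1" using \<delta> by (auto simp: d_def)
  \<comment> \<open>The point chosen below has N \<ge> Y / 4, which makes r / N at most d and m N /
    2 larger than the bound l of \<open>J\<close>.\<close>
  define Y where "Y = 4 * (Cr / d + 2 * l / m + 1)"
  have Y: "Y / 4 \<ge> Cr / d" "Y / 4 > 2 * l / m" "Y > 0"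
  proof -
    have "Y / 4 = Cr / d + 2 * l / m + 1" by (simp add: Y_def)
    moreover have "Cr / d \<ge> 0" "2 * l / m \<ge> 0" using Cr d l m by auto
    ultimately show "Y / 4 \<ge> Cr / d" "Y / 4 > 2 * l / m" "Y > 0" by linarith+
  qed
  obtain y where y: "W y > Y" using unb by blast
  \<comment> \<open>The slope 1 / n of the penalty is small compared with d, and n \<ge> |y| keeps G
    y \<le> 2, so the penalised supremum exceeds Y / 2.\<close>
  obtain n :: nat where n: "real n \<ge> max 1 (max (4 / d) \<bar>y\<bar>)" using real_arch_simple by blast
  have n1: "real n \<ge> 1" and n4: "1 / real n \<le> d / 4" and ny: "\<bar>y\<bar> / real n \<le> 1"
    using n d by (auto simp: field_simps)
  define G where "G x = 1 + \<bar>x\<bar> / real n" for x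
  have G1: "G x \<ge> 1" for x by (simp add: G_def)
  have bdd: "bdd_above (range (\<lambda>x. W x / G x))"
  proof (rule bdd_aboveI2)
    fix x
    have "1 + \<bar>x\<bar> \<le> real n * G x" using n1 by (simp add: G_def distrib_left)
    hence "Cw * (1 + \<bar>x\<bar>) \<le> Cw * (real n * G x)" using Cw(1) by (rule mult_left_mono)
    hence "W x \<le> Cw * real n * G x" using Cw(2)[of x] by (simp add: mult.assoc)
    thus "W x / G x \<le> Cw * real n" using G1[of x] by (simp add: pos_divide_le_eq)
  qed
  define s where "s = (SUP x. W x / G x)"
  have s_up: "W x \<le> s * G x" for x
  proof -
    have "W x / G x \<le> s" unfolding s_def using bdd by (intro cSUP_upper) auto
    thus ?thesis using G1[of x] by (simp add: pos_divide_le_eq)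
  qed
  have s: "s > Y / 2"
  proof -
    have "Y < s * G y" using s_up[of y] y by linarith
    moreover have "0 < s" using \<open>Y < s * G y\<close> Y(3) G1[of y] by (smt (verit) mult_nonpos_nonneg)
    moreover have "s * G y \<le> s * 2" using ny \<open>0 < s\<close> by (intro mult_left_mono) (auto simp: G_def)
    ultimately show ?thesis by linarith
  qed
  \<comment> \<open>The supremum need not be attained; a point that reaches it up to the factor 1 -
    d / 4 serves.\<close>
  have s_lt: "(1 - d / 4) * s < s" using s Y d by (simp add: left_diff_distrib)
  have "\<exists>x. (1 - d / 4) * s < W x / G x"
  proof (rule ccontr)
    assume "\<not> ?thesis"
    hence "(SUP x. W x / G x) \<le> (1 - d / 4) * s" by (intro cSUP_least) (auto simp: not_less)
    thus False using s_lt unfolding s_def[symmetric] by linarith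
  qed
  then obtain x where x: "(1 - d / 4) * s < W x / G x" by blast
  \<comment> \<open>Normalising by the value at the point itself gives A = 1 and a deviation that is
    exactly 0 at t = 0.\<close>
  define N where "N = W x"
  have N: "N \<ge> (1 - d / 4) * s * G x" using x G1[of x] by (simp add: N_def pos_less_divide_eq)
  have d4: "1 - d / 4 \<ge> 3 / 4" using d by simp
  have N_large: "N \<ge> Y / 4"
  proof -
    have "(3 / 4) * s * 1 \<le> (1 - d / 4) * s * G x"
      using d4 s Y G1[of x] by (intro mult_mono) auto
    thus ?thesis using N s Y by linarith
  qed
  have N0: "N > 0" using w_pos by (simp add: N_def)
  have v: "W (x + t) / N \<le> (1 + \<bar>t\<bar> / real n) / (1 - d / 4)" for t
  proof -
    have "G (x + t) \<le> G x + \<bar>t\<bar> / real n"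
      using n1 by (simp add: G_def divide_right_mono flip: add_divide_distrib)
    also have "\<dots> \<le> G x + G x * (\<bar>t\<bar> / real n)"
      using mult_right_mono[OF G1[of x], of "\<bar>t\<bar> / real n"] by simp
    finally have "s * G (x + t) \<le> s * (G x * (1 + \<bar>t\<bar> / real n))"
      using s Y by (intro mult_left_mono) (auto simp: distrib_left)
    hence "W (x + t) * (1 - d / 4) \<le> s * (G x * (1 + \<bar>t\<bar> / real n)) * (1 - d / 4)"
      using s_up[of "x + t"] d4 by (intro mult_right_mono) auto
    also have "\<dots> = (1 - d / 4) * s * G x * (1 + \<bar>t\<bar> / real n)" by simp
    also have "\<dots> \<le> N * (1 + \<bar>t\<bar> / real n)" using N by (intro mult_right_mono) auto
    finally show ?thesis using N0 d4 by (simp add: pos_divide_le_eq pos_le_divide_eq mult.commute)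
  qed
  have v0: "W (x + t) / N > 0" for t using w_pos N0 by simp
  have v1: "W (x + t) / N \<le> 1 + d * (1 + t\<^sup>2)" for t
  proof -
    define q where "q = d * (1 + t\<^sup>2)"
    have q: "q \<ge> d" using d by (simp add: q_def)
    have "\<bar>t\<bar> / real n \<le> (d / 4) * \<bar>t\<bar>" using mult_right_mono[OF n4, of "\<bar>t\<bar>"] by simp
    also have "\<dots> \<le> (d / 4) * (1 + t\<^sup>2)" using d abs_le_weight[of t] by (intro mult_left_mono) auto
    finally have "1 + \<bar>t\<bar> / real n \<le> 1 + q / 4" by (simp add: q_def)
    also have "\<dots> \<le> (1 + q) * (1 - d / 4)"
    proof -
      have "q * d \<le> q * 1" using q d by (intro mult_left_mono) auto
      moreover have "(1 + q) * (1 - d / 4) = 1 + q - d / 4 - q * d / 4" by (simp add: algebra_simps)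
      ultimately show ?thesis using q d by linarith
    qed
    finally have "(1 + \<bar>t\<bar> / real n) / (1 - d / 4) \<le> 1 + q" using d4 by (simp add: pos_divide_le_eq)
    thus ?thesis using v[of t] by (simp add: q_def)
  qed
  have "\<bar>W (x + t) / N - 1\<bar> \<le> \<epsilon> * (1 + t\<^sup>2)" for t
  proof (rule near[of 1])
    show "\<bar>1 - W (x + t) / N\<bar> \<le> 4 * (1 + \<bar>t\<bar>)" for t
    proof -
      have "\<bar>t\<bar> / real n \<le> \<bar>t\<bar>" using n1 by (simp add: divide_le_eq_1 field_simps mult_le_cancel_left1)
      hence "(1 + \<bar>t\<bar> / real n) / (1 - d / 4) \<le> (1 + \<bar>t\<bar>) / (3 / 4)"
        using d4 by (intro frac_le) auto
      also have "\<dots> \<le> 4 * (1 + \<bar>t\<bar>) - 1" by (simp add: divide_simps)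
      finally have "W (x + t) / N \<le> 4 * (1 + \<bar>t\<bar>) - 1" using v[of t] by (rule order_trans[rotated])
      moreover have "1 \<le> 4 * (1 + \<bar>t\<bar>)" by simp
      ultimately show ?thesis using v0[of t] by (simp only: abs_le_iff) linarith
    qed
    show "1 * (1 - W (x + t) / N) \<ge> - \<delta> * (1 + t\<^sup>2)" for t
    proof -
      have "d * (1 + t\<^sup>2) \<le> \<delta> * (1 + t\<^sup>2)" using d by (intro mult_right_mono) auto
      thus ?thesis using v1[of t] by simp
    qed
    show "r (x + t) / N \<le> \<delta> * (1 + t\<^sup>2)" for t
    proof -
      have "r (x + t) * 1 \<le> r (x + t) * (1 + (x + t)\<^sup>2)" using r_nonneg by (intro mult_left_mono) auto
      hence "r (x + t) \<le> Cr" using Cr(2)[of "x + t"] by linarith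
      also have "Cr / d \<le> N" using N_large Y(1) by linarith
      hence "Cr \<le> d * N" using d by (simp add: pos_divide_le_eq mult.commute)
      finally have "r (x + t) / N \<le> d" using N0 by (simp add: pos_divide_le_eq)
      also have "d \<le> \<delta> * 1" using d by simp
      also have "\<delta> * 1 \<le> \<delta> * (1 + t\<^sup>2)" using \<delta> by (intro mult_left_mono) auto
      finally show ?thesis .
    qed
  qed (use N0 \<delta> in \<open>auto simp: N_def\<close>)
  from J_near[OF N0 less_imp_le[OF \<epsilon>(1)] this] have "\<bar>J x / N - 1 * m\<bar> \<le> m / 2" by (simp only: \<epsilon>(2))
  hence "J x / N \<ge> m / 2" by linarith
  hence "m / 2 * N \<le> l" using N0 l(2)[of x] by (simp add: pos_le_divide_eq)
  moreover have "2 * l / m < N" using N_large Y by linarith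
  hence "l < m / 2 * N" using m by (simp add: pos_divide_less_eq mult.commute)
  ultimately show False by linarith
qed

end

section \<open>Identification of the limit\<close>

lemma abs_large: "\<forall>\<^sub>F x in at_bot. B \<le> (1 + \<bar>x\<bar> :: real)"
  using eventually_le_at_bot[of "- \<bar>B\<bar>"] by eventually_elim auto

context wave_flux
begin

lemma r_weight_shift:
  obtains C where "C \<ge> 0" "\<And>x t. r (x + t) * (1 + x\<^sup>2) \<le> C * (1 + t\<^sup>2)"
proof -
  obtain C where C: "C \<ge> 0" "\<And>x. r x * (1 + x\<^sup>2) \<le> C" using r_weight by metis
  have "r (x + t) * (1 + x\<^sup>2) \<le> (2 * C) * (1 + t\<^sup>2)" for x t
  proof -
    have "1 + x\<^sup>2 \<le> 2 * (1 + (x + t)\<^sup>2) * (1 + t\<^sup>2)" using peetre[of "x + t" "- t"] by simp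
    hence "r (x + t) * (1 + x\<^sup>2) \<le> r (x + t) * (2 * (1 + (x + t)\<^sup>2) * (1 + t\<^sup>2))"
      using r_nonneg by (intro mult_left_mono)
    also have "\<dots> = (r (x + t) * (1 + (x + t)\<^sup>2)) * (2 * (1 + t\<^sup>2))" by (simp only: ac_simps)
    also have "\<dots> \<le> C * (2 * (1 + t\<^sup>2))" using C by (intro mult_right_mono) auto
    also have "\<dots> = (2 * C) * (1 + t\<^sup>2)" by (simp only: ac_simps)
    finally show ?thesis .
  qed
  thus thesis using C that[of "2 * C"] by simp
qed

text \<open>\<open>G\<close> is the expected order of growth of \<open>W\<close> at \<open>-\<infinity>\<close>.\<close>
context
  fixes G :: "real \<Rightarrow> real" and Cw :: real
  assumes G1: "\<And>x. G x \<ge> 1"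
    and G_slow: "\<And>x t. \<bar>G (x + t) - G x\<bar> * (1 + \<bar>x\<bar>) \<le> \<bar>t\<bar> * G x"
    and W_le_G: "\<And>x. W x \<le> Cw * G x"
begin

lemma Cw_pos: "Cw > 0"
proof -
  have "0 < Cw * G 0" using W_le_G[of 0] w_pos[of \<mu> 0] by linarith
  thus ?thesis using G1[of 0] by (simp add: zero_less_mult_iff)
qed

lemma G_ratio: "\<bar>G (x + t) / G x - 1\<bar> \<le> \<bar>t\<bar> / (1 + \<bar>x\<bar>)"
proof -
  have "G (x + t) / G x - 1 = (G (x + t) - G x) / G x" using G1[of x] by (simp add: diff_divide_distrib)
  hence "\<bar>G (x + t) / G x - 1\<bar> = \<bar>G (x + t) - G x\<bar> / G x" using G1[of x] by (simp add: abs_divide)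
  also have "\<dots> \<le> \<bar>t\<bar> / (1 + \<bar>x\<bar>)"
    using G_slow[of x t] G1[of x] by (simp add: pos_divide_le_eq pos_le_divide_eq add_pos_nonneg)
  finally show ?thesis .
qed

lemma W_shift_le: "W (x + t) / G x \<le> Cw * (1 + \<bar>t\<bar>)"
proof -
  have "G (x + t) / G x \<le> 1 + \<bar>t\<bar> / (1 + \<bar>x\<bar>)" using G_ratio[of x t] by linarith
  also have "\<bar>t\<bar> / (1 + \<bar>x\<bar>) \<le> \<bar>t\<bar> / 1" by (intro divide_left_mono) auto
  finally have "Cw * (G (x + t) / G x) \<le> Cw * (1 + \<bar>t\<bar>)" using Cw_pos by (intro mult_left_mono) auto
  moreover have "W (x + t) / G x \<le> Cw * G (x + t) / G x"
    using W_le_G G1[of x] by (intro divide_right_mono) auto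
  ultimately show ?thesis by simp
qed

text \<open>If x is far to the left, x + t > X forces |t| to be large, where the quadratic tolerance
  exceeds any linear bound. This covers the shifts that leave the region in which asymptotic
  information is available.\<close>

lemma far_shift:
  fixes C :: real
  assumes "\<delta> > 0"
  shows "\<forall>\<^sub>F x in at_bot. \<forall>t. x + t > X \<longrightarrow> C * (1 + \<bar>t\<bar>) \<le> \<delta> * (1 + t\<^sup>2)"
proof -
  obtain n :: nat where n: "\<And>t::real. \<bar>t\<bar> \<ge> real n \<Longrightarrow> C * (1 + \<bar>t\<bar>) \<le> \<delta> * (1 + t\<^sup>2)"
    using linear_le_square_weight[OF assms] by blast
  show ?thesis
    using eventually_le_at_bot[of "X - real n"]
  proof eventually_elim
    case (elim x)
    show ?case
    proof (intro allI impI n)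
      fix t assume "x + t > X"
      thus "\<bar>t\<bar> \<ge> real n" using elim by linarith
    qed
  qed
qed

text \<open>Turns an eventual bound at single points into one for the whole translated profile,
  measured by G at the fixed point x: slow variation of G handles x + t \<le> X, and
  \<open>far_shift\<close> the rest.\<close>

lemma upper_shift:
  assumes up: "\<And>\<epsilon>. \<epsilon> > 0 \<Longrightarrow> \<forall>\<^sub>F x in at_bot. W x / G x \<le> A + \<epsilon>" and A: "A \<ge> 0" and \<delta>: "\<delta> > 0"
  shows "\<forall>\<^sub>F x in at_bot. \<forall>t. W (x + t) / G x \<le> A + \<delta> * (1 + t\<^sup>2)"
proof -
  define d where "d = \<delta> / 2"
  have d: "d > 0" using \<delta> by (simp add: d_def)
  obtain X where X: "\<And>x. x \<le> X \<Longrightarrow> W x / G x \<le> A + d"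
    using up[OF d] by (auto simp: eventually_at_bot_linorder)
  show ?thesis using far_shift[OF \<delta>, of X Cw] abs_large[of "(A + d) / d"]
  proof eventually_elim
    case (elim x)
    show ?case
    proof
      fix t
      show "W (x + t) / G x \<le> A + \<delta> * (1 + t\<^sup>2)"
      proof (cases "x + t \<le> X")
        case True
        have "W (x + t) / G x = W (x + t) / G (x + t) * (G (x + t) / G x)"
          using G1[of "x + t"] by simp
        also have "\<dots> \<le> (A + d) * (1 + \<bar>t\<bar> / (1 + \<bar>x\<bar>))"
          using X[OF True] G_ratio[of x t] A d G1[of x] G1[of "x + t"] by (intro mult_mono) auto
        also have "\<dots> = A + d + (A + d) / (1 + \<bar>x\<bar>) * \<bar>t\<bar>" by (simp add: distrib_left)
        also have "(A + d) / (1 + \<bar>x\<bar>) * \<bar>t\<bar> \<le> d * \<bar>t\<bar>"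
          using elim(2) d by (intro mult_right_mono) (auto simp: pos_divide_le_eq mult.commute add_pos_nonneg)
        also have "d * \<bar>t\<bar> \<le> d * (1 + t\<^sup>2)" using d abs_le_weight by (intro mult_left_mono) auto
        also have "A + d + d * (1 + t\<^sup>2) \<le> A + \<delta> * (1 + t\<^sup>2)"
        proof -
          have "d * 1 \<le> d * (1 + t\<^sup>2)" using d by (intro mult_left_mono) auto
          moreover have "\<delta> * (1 + t\<^sup>2) = d * (1 + t\<^sup>2) + d * (1 + t\<^sup>2)" by (simp add: d_def)
          ultimately show ?thesis by linarith
        qed
        finally show ?thesis by simp
      next
        case False
        hence "Cw * (1 + \<bar>t\<bar>) \<le> \<delta> * (1 + t\<^sup>2)" using elim(1) by auto
        thus ?thesis using W_shift_le[of x t] A by linarith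
      qed
    qed
  qed
qed

lemma lower_shift:
  assumes low: "\<And>\<epsilon>. \<epsilon> > 0 \<Longrightarrow> \<forall>\<^sub>F x in at_bot. W x / G x \<ge> A - \<epsilon>" and A: "A \<ge> 0" and \<delta>: "\<delta> > 0"
  shows "\<forall>\<^sub>F x in at_bot. \<forall>t. W (x + t) / G x \<ge> A - \<delta> * (1 + t\<^sup>2)"
proof -
  define d where "d = \<delta> / 2"
  have d: "d > 0" using \<delta> by (simp add: d_def)
  obtain X where X: "\<And>x. x \<le> X \<Longrightarrow> W x / G x \<ge> A - d"
    using low[OF d] by (auto simp: eventually_at_bot_linorder)
  show ?thesis using far_shift[OF \<delta>, of X A] abs_large[of "A / d"]
  proof eventually_elim
    case (elim x)
    show ?case
    proof
      fix t
      have pos: "W (x + t) / G x > 0" using w_pos G1[of x] by simp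
      show "W (x + t) / G x \<ge> A - \<delta> * (1 + t\<^sup>2)"
      proof (cases "x + t \<le> X")
        case True
        have t: "d * \<bar>t\<bar> \<le> d * (1 + t\<^sup>2)" "d * 1 \<le> d * (1 + t\<^sup>2)"
          using d abs_le_weight by (intro mult_left_mono; simp)+
        have \<delta>2: "\<delta> * (1 + t\<^sup>2) = d * (1 + t\<^sup>2) + d * (1 + t\<^sup>2)" by (simp add: d_def)
        \<comment> \<open>Multiplying by the lower bound of G (x + t) / G x needs A - d \<ge> 0;
          otherwise positivity of \<open>W\<close> suffices.\<close>
        show ?thesis
        proof (cases "A \<ge> d")
          case False
          thus ?thesis using pos t \<delta>2 d by (smt (verit))
        next
          case Ad: True
          have "A * (\<bar>t\<bar> / (1 + \<bar>x\<bar>)) = A / (1 + \<bar>x\<bar>) * \<bar>t\<bar>" by simp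
          also have "\<dots> \<le> d * \<bar>t\<bar>"
            using elim(2) d by (intro mult_right_mono) (auto simp: pos_divide_le_eq mult.commute add_pos_nonneg)
          finally have q: "A * (\<bar>t\<bar> / (1 + \<bar>x\<bar>)) \<le> d * \<bar>t\<bar>" .
          have "(A - d) * (\<bar>t\<bar> / (1 + \<bar>x\<bar>)) \<le> A * (\<bar>t\<bar> / (1 + \<bar>x\<bar>))"
            using d by (intro mult_right_mono) (auto intro!: divide_nonneg_nonneg)
          hence "A - d - d * \<bar>t\<bar> \<le> (A - d) * (1 - \<bar>t\<bar> / (1 + \<bar>x\<bar>))" using q by (simp add: right_diff_distrib)
          also have "\<dots> \<le> (A - d) * (G (x + t) / G x)"
            using G_ratio[of x t] Ad by (intro mult_left_mono) linarith+
          also have "\<dots> \<le> W (x + t) / G (x + t) * (G (x + t) / G x)"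
            using X[OF True] G1[of x] G1[of "x + t"] by (intro mult_right_mono) auto
          also have "\<dots> = W (x + t) / G x" using G1[of "x + t"] by simp
          finally show ?thesis using t \<delta>2 by linarith
        qed
      next
        case False
        hence "A * (1 + \<bar>t\<bar>) \<le> \<delta> * (1 + t\<^sup>2)" using elim(1) by auto
        moreover have "A * 1 \<le> A * (1 + \<bar>t\<bar>)" using A by (intro mult_left_mono) auto
        ultimately show ?thesis using pos by linarith
      qed
    qed
  qed
qed

lemma r_shift_small:
  assumes "\<delta> > 0"
  shows "\<forall>\<^sub>F x in at_bot. \<forall>t. r (x + t) / G x \<le> \<delta> * (1 + t\<^sup>2)"
proof -
  obtain C where C: "C \<ge> 0" "\<And>x t. r (x + t) * (1 + x\<^sup>2) \<le> C * (1 + t\<^sup>2)" using r_weight_shift by metis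
  show ?thesis using abs_large[of "2 * (C / \<delta>)"]
  proof eventually_elim
    case (elim x)
    have "2 * (C / \<delta>) \<le> 2 * (1 + x\<^sup>2)" using elim one_plus_abs_le[of x] by (rule order_trans)
    hence "C / \<delta> \<le> 1 + x\<^sup>2" by (rule mult_left_le_imp_le) simp
    hence Cd: "C \<le> \<delta> * (1 + x\<^sup>2)" using assms by (simp add: pos_divide_le_eq mult.commute)
    show ?case
    proof
      fix t
      have "r (x + t) * (1 + x\<^sup>2) \<le> C * (1 + t\<^sup>2)" by (rule C)
      also have "\<dots> \<le> \<delta> * (1 + x\<^sup>2) * (1 + t\<^sup>2)" using Cd by (intro mult_right_mono) auto
      finally have "(1 + x\<^sup>2) * r (x + t) \<le> (1 + x\<^sup>2) * (\<delta> * (1 + t\<^sup>2))" by (simp add: ac_simps)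
      hence "r (x + t) \<le> \<delta> * (1 + t\<^sup>2)" by (rule mult_left_le_imp_le) (simp add: add_pos_nonneg)
      moreover have "r (x + t) / G x \<le> r (x + t) / 1"
        using r_nonneg G1[of x] by (intro divide_left_mono) auto
      ultimately show "r (x + t) / G x \<le> \<delta> * (1 + t\<^sup>2)" by simp
    qed
  qed
qed

text \<open>Any cluster value \<open>A\<close> of \<open>W / G\<close> that bounds it from one side (\<open>\<sigma> = 1\<close>: from above) is identified
  by a functional \<open>F\<close> whose limit is known.\<close>
lemma extremal_cluster_value:
  assumes \<sigma>: "\<bar>\<sigma>\<bar> = 1" and A: "A \<ge> 0"
    and one_sided: "\<And>\<delta>. \<delta> > 0 \<Longrightarrow> \<forall>\<^sub>F x in at_bot. \<forall>t. \<sigma> * (A - W (x + t) / G x) \<ge> - \<delta> * (1 + t\<^sup>2)"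
    and cluster: "\<And>\<delta>. \<delta> > 0 \<Longrightarrow> \<exists>\<^sub>F x in at_bot. \<sigma> * (A - W x / G x) \<le> \<delta>"
    and F: "\<And>x \<epsilon>. \<epsilon> \<ge> 0 \<Longrightarrow> (\<And>t. \<bar>W (x + t) / G x - A\<bar> \<le> \<epsilon> * (1 + t\<^sup>2)) \<Longrightarrow> \<bar>F x / G x - A * q\<bar> \<le> \<epsilon> * CF"
    and lim: "((\<lambda>x. F x / G x) \<longlongrightarrow> l) at_bot"
  shows "A * q = l"
proof -
  have CF: "\<bar>l - A * q\<bar> \<le> \<epsilon> * (1 + CF)" if \<epsilon>: "\<epsilon> > 0" for \<epsilon>
  proof -
    obtain \<delta> where \<delta>: "\<delta> > 0" and near: "\<And>\<sigma> x N A' t. \<bar>\<sigma>\<bar> = 1 \<Longrightarrow> N > 0 \<Longrightarrow> (\<And>t. \<bar>A' - W (x + t) / N\<bar> \<le> (A + Cw) * (1 + \<bar>t\<bar>)) \<Longrightarrow>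
      (\<And>t. \<sigma> * (A' - W (x + t) / N) \<ge> - \<delta> * (1 + t\<^sup>2)) \<Longrightarrow> (\<And>t. r (x + t) / N \<le> \<delta> * (1 + t\<^sup>2)) \<Longrightarrow>
      \<sigma> * (A' - W x / N) \<le> \<delta> \<Longrightarrow> \<bar>W (x + t) / N - A'\<bar> \<le> \<epsilon> * (1 + t\<^sup>2)"
      using near_of_one_sided[OF \<epsilon>, of "A + Cw"] by metis
    have "\<forall>\<^sub>F x in at_bot. dist (F x / G x) l < \<epsilon>" using lim \<epsilon> by (rule tendstoD)
    hence "\<forall>\<^sub>F x in at_bot. (\<forall>t. \<sigma> * (A - W (x + t) / G x) \<ge> - \<delta> * (1 + t\<^sup>2)) \<and>
        (\<forall>t. r (x + t) / G x \<le> \<delta> * (1 + t\<^sup>2)) \<and> dist (F x / G x) l < \<epsilon>"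
      using one_sided[OF \<delta>] r_shift_small[OF \<delta>] by eventually_elim blast
    from frequently_eventually_frequently[OF cluster[OF \<delta>] this]
    obtain x where x: "\<sigma> * (A - W x / G x) \<le> \<delta>" "\<And>t. \<sigma> * (A - W (x + t) / G x) \<ge> - \<delta> * (1 + t\<^sup>2)"
      "\<And>t. r (x + t) / G x \<le> \<delta> * (1 + t\<^sup>2)" "dist (F x / G x) l < \<epsilon>"
      by (auto dest!: frequently_ex)
    have "\<bar>W (x + t) / G x - A\<bar> \<le> \<epsilon> * (1 + t\<^sup>2)" for t
    proof (rule near[OF \<sigma> _ _ x(2) x(3) x(1)])
      show "G x > 0" using G1[of x] by simp
      show "\<bar>A - W (x + t) / G x\<bar> \<le> (A + Cw) * (1 + \<bar>t\<bar>)" for t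
      proof -
        have "A * 1 \<le> A * (1 + \<bar>t\<bar>)" using A by (intro mult_left_mono) auto
        moreover have "W (x + t) / G x > 0" using w_pos G1[of x] by simp
        moreover have "(A + Cw) * (1 + \<bar>t\<bar>) = A * (1 + \<bar>t\<bar>) + Cw * (1 + \<bar>t\<bar>)" by (rule distrib_right)
        ultimately show ?thesis using W_shift_le[of x t] A by (simp only: abs_le_iff) linarith
      qed
    qed
    hence "\<bar>F x / G x - A * q\<bar> \<le> \<epsilon> * CF" using \<epsilon> by (intro F) auto
    moreover have "\<bar>F x / G x - l\<bar> < \<epsilon>" using x(4) by (simp add: dist_real_def)
    moreover have "\<epsilon> * (1 + CF) = \<epsilon> + \<epsilon> * CF" by (simp add: distrib_left)
    ultimately show ?thesis by linarith
  qed
  have "\<bar>l - A * q\<bar> \<le> 0"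
  proof (rule field_le_epsilon)
    fix e :: real assume e: "e > 0"
    have "\<bar>l - A * q\<bar> \<le> e / (1 + \<bar>CF\<bar>) * (1 + CF)" using e by (intro CF) (auto intro!: divide_pos_pos add_pos_nonneg)
    also have "\<dots> \<le> e / (1 + \<bar>CF\<bar>) * (1 + \<bar>CF\<bar>)" using e by (intro mult_left_mono) auto
    also have "\<dots> = e" by (simp add: add_nonneg_eq_0_iff)
    finally show "\<bar>l - A * q\<bar> \<le> 0 + e" by simp
  qed
  thus ?thesis by simp
qed

text \<open>The limes superior and the limes inferior are both one-sided cluster values, so
  \<open>extremal_cluster_value\<close> assigns l / q to each. F stands for \<open>J\<close> with q
  = m on the scale G = 1, or for \<open>T\<close> with q = k on the scale 1 + |x|.\<close>

lemma W_limit: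
  assumes q: "q > 0"
    and F: "\<And>x A \<epsilon>. \<epsilon> \<ge> 0 \<Longrightarrow> (\<And>t. \<bar>W (x + t) / G x - A\<bar> \<le> \<epsilon> * (1 + t\<^sup>2)) \<Longrightarrow> \<bar>F x / G x - A * q\<bar> \<le> \<epsilon> * CF"
    and lim: "((\<lambda>x. F x / G x) \<longlongrightarrow> l) at_bot"
  shows "((\<lambda>x. W x / G x) \<longlongrightarrow> l / q) at_bot"
    and "((\<lambda>x. L \<mu> W x / G x) \<longlongrightarrow> 0) at_bot"
proof -
  have WG0: "W x / G x \<ge> 0" for x using w_pos[of \<mu> x] G1[of x] by simp
  have WGC: "W x / G x \<le> Cw" for x using W_shift_le[of x 0] by simp
  \<comment> \<open>The infimum of the eventual upper bounds is the limes superior; dually for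
    \<open>LB\<close>.\<close>
  define UB where "UB = {a. \<forall>\<^sub>F x in at_bot. W x / G x \<le> a}"
  define LB where "LB = {a. \<forall>\<^sub>F x in at_bot. W x / G x \<ge> a}"
  have UB_C: "Cw \<in> UB" using WGC by (simp add: UB_def)
  have LB_0: "0 \<in> LB" using WG0 by (simp add: LB_def)
  have UB_ge: "0 \<le> a" if "a \<in> UB" for a
  proof -
    have "\<forall>\<^sub>F x in at_bot. W x / G x \<le> a" using that by (simp add: UB_def)
    then obtain x where "W x / G x \<le> a" using eventually_happens trivial_limit_at_bot_linorder by blast
    thus ?thesis using WG0[of x] by linarith
  qed
  have LB_le: "a \<le> Cw" if "a \<in> LB" for a
  proof -
    have "\<forall>\<^sub>F x in at_bot. W x / G x \<ge> a" using that by (simp add: LB_def)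
    then obtain x where "W x / G x \<ge> a" using eventually_happens trivial_limit_at_bot_linorder by blast
    thus ?thesis using WGC[of x] by linarith
  qed
  have bddU: "bdd_below UB" using UB_ge by (rule bdd_belowI)
  have bddL: "bdd_above LB" using LB_le by (rule bdd_aboveI)
  define A where "A = Inf UB"
  define B where "B = Sup LB"
  have A0: "A \<ge> 0" unfolding A_def using UB_C UB_ge by (intro cInf_greatest) auto
  have B0: "B \<ge> 0" unfolding B_def using LB_0 bddL by (intro cSup_upper)
  have A_up: "\<forall>\<^sub>F x in at_bot. W x / G x \<le> A + \<epsilon>" if "\<epsilon> > 0" for \<epsilon>
  proof -
    have "Inf UB < A + \<epsilon>" using that by (simp add: A_def)
    then obtain a where "a \<in> UB" "a < A + \<epsilon>" using cInf_lessD[of UB "A + \<epsilon>"] UB_C by blast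
    thus ?thesis unfolding UB_def by (auto elim: eventually_mono)
  qed
  have B_low: "\<forall>\<^sub>F x in at_bot. W x / G x \<ge> B - \<epsilon>" if "\<epsilon> > 0" for \<epsilon>
  proof -
    have "B - \<epsilon> < Sup LB" using that by (simp add: B_def)
    then obtain a where "a \<in> LB" "B - \<epsilon> < a" using less_cSupD[of LB "B - \<epsilon>"] LB_0 by blast
    thus ?thesis unfolding LB_def by (auto elim: eventually_mono)
  qed
  have up: "\<forall>\<^sub>F x in at_bot. \<forall>t. W (x + t) / G x \<le> A + \<delta> * (1 + t\<^sup>2)" if "\<delta> > 0" for \<delta>
    by (rule upper_shift[OF _ A0 that]) (rule A_up)
  have low: "\<forall>\<^sub>F x in at_bot. \<forall>t. W (x + t) / G x \<ge> B - \<delta> * (1 + t\<^sup>2)" if "\<delta> > 0" for \<delta>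
    by (rule lower_shift[OF _ B0 that]) (rule B_low)
  have "A * q = l"
  proof (rule extremal_cluster_value[of 1, OF _ A0 _ _ F lim])
    show "\<forall>\<^sub>F x in at_bot. \<forall>t. 1 * (A - W (x + t) / G x) \<ge> - \<delta> * (1 + t\<^sup>2)" if "\<delta> > 0" for \<delta>
      using up[OF that] by eventually_elim (simp add: algebra_simps)
    show "\<exists>\<^sub>F x in at_bot. 1 * (A - W x / G x) \<le> \<delta>" if "\<delta> > 0" for \<delta>
    proof (rule ccontr)
      assume "\<not> ?thesis"
      hence "\<forall>\<^sub>F x in at_bot. \<not> 1 * (A - W x / G x) \<le> \<delta>" by (simp add: not_frequently)
      hence "\<forall>\<^sub>F x in at_bot. W x / G x \<le> A - \<delta>" by eventually_elim simp
      hence "A - \<delta> \<in> UB" by (simp add: UB_def)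
      hence "A \<le> A - \<delta>" unfolding A_def using bddU by (intro cInf_lower)
      thus False using that by simp
    qed
  qed auto
  moreover have "B * q = l"
  proof (rule extremal_cluster_value[of "-1", OF _ B0 _ _ F lim])
    show "\<forall>\<^sub>F x in at_bot. \<forall>t. (-1) * (B - W (x + t) / G x) \<ge> - \<delta> * (1 + t\<^sup>2)" if "\<delta> > 0" for \<delta>
      using low[OF that] by eventually_elim (simp add: algebra_simps)
    show "\<exists>\<^sub>F x in at_bot. (-1) * (B - W x / G x) \<le> \<delta>" if "\<delta> > 0" for \<delta>
    proof (rule ccontr)
      assume "\<not> ?thesis"
      hence "\<forall>\<^sub>F x in at_bot. \<not> (-1) * (B - W x / G x) \<le> \<delta>" by (simp add: not_frequently)
      hence "\<forall>\<^sub>F x in at_bot. W x / G x \<ge> B + \<delta>" by eventually_elim simp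
      hence "B + \<delta> \<in> LB" by (simp add: LB_def)
      hence "B + \<delta> \<le> B" unfolding B_def using bddL by (intro cSup_upper)
      thus False using that by simp
    qed
  qed auto
  ultimately have AB: "A = l / q" "B = l / q" using q by (auto simp: field_simps)
  show "((\<lambda>x. W x / G x) \<longlongrightarrow> l / q) at_bot"
  proof (rule tendstoI)
    fix e :: real assume e: "e > 0"
    hence e2: "e / 2 > 0" by simp
    show "\<forall>\<^sub>F x in at_bot. dist (W x / G x) (l / q) < e"
      using A_up[OF e2] B_low[OF e2] unfolding AB
      by eventually_elim (use e in \<open>auto simp: dist_real_def abs_if\<close>)
  qed
  show "((\<lambda>x. L \<mu> W x / G x) \<longlongrightarrow> 0) at_bot"
  proof (rule tendstoI)
    fix e :: real assume e: "e > 0"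
    define \<epsilon> where "\<epsilon> = e / (2 * Q + 1)"
    have Q1: "2 * Q + 1 > 0" using Q_nonneg by simp
    have \<epsilon>: "\<epsilon> > 0" "\<epsilon> * (2 * Q + 1) = e" using e Q1 by (auto simp: \<epsilon>_def)
    \<comment> \<open>Once both values coincide, nearness holds at every x far to the left and not
      only at special points, so \<open>LW_near\<close> yields a limit.\<close>
    have "\<forall>\<^sub>F x in at_bot. \<forall>t. \<bar>W (x + t) / G x - l / q\<bar> \<le> \<epsilon> * (1 + t\<^sup>2)"
      using up[OF \<epsilon>(1)] low[OF \<epsilon>(1)] unfolding AB
      by eventually_elim (auto simp: abs_le_iff algebra_simps)
    thus "\<forall>\<^sub>F x in at_bot. dist (L \<mu> W x / G x) 0 < e"
    proof eventually_elim
      case (elim x)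
      have "\<bar>L \<mu> W x / G x\<bar> \<le> \<epsilon> * (2 * Q)"
        using G1[of x] elim \<epsilon> by (intro LW_near[where A = "l / q"]) auto
      also have "\<dots> < e" using \<epsilon> by (simp add: distrib_left)
      finally show ?case by (simp add: dist_real_def)
    qed
  qed
qed

end

text \<open>For m = 0, T' = - J with 0 \<le> l - J \<le> C exp (\<beta> x), so T x + l x stays
  bounded on the left half-line.\<close>

lemma J_tendsto:
  obtains l where "l > 0" "(J \<longlongrightarrow> l) at_bot" "((\<lambda>x. T x / (1 + \<bar>x\<bar>)) \<longlongrightarrow> l) at_bot \<or> m \<noteq> 0"
proof -
  obtain l \<beta> C where l: "l > 0" "\<beta> > 0" "C \<ge> 0" "\<And>x. J x \<le> l" "\<And>x. l - C * exp (\<beta> * x) \<le> J x"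
    using J_limit by metis
  have "((\<lambda>x. exp (\<beta> * x)) \<longlongrightarrow> 0) at_bot"
    by (rule filterlim_compose[OF exp_at_bot], rule filterlim_tendsto_pos_mult_at_bot[OF tendsto_const])
      (use l in \<open>auto intro: filterlim_ident\<close>)
  from tendsto_diff[OF tendsto_const tendsto_mult_left[OF this, of C], of l]
  have lim: "((\<lambda>x. l - C * exp (\<beta> * x)) \<longlongrightarrow> l) at_bot" by simp
  have 1: "(J \<longlongrightarrow> l) at_bot"
    by (rule tendsto_sandwich[OF _ _ lim tendsto_const]) (use l in auto)
  have 2: "((\<lambda>x. T x / (1 + \<bar>x\<bar>)) \<longlongrightarrow> l) at_bot" if m: "m = 0"
  proof -
    have dT0: "(T has_real_derivative - J x) (at x)" for x using dT[of x] m by simp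
    have up: "T x + l * x \<le> T 0 + l * 0" if "x \<le> 0" for x
    proof (rule DERIV_nonneg_imp_nondecreasing[where f = "\<lambda>x. T x + l * x", OF that])
      fix t
      have "((\<lambda>x. T x + l * x) has_real_derivative (- J t + l)) (at t)"
        by (rule derivative_eq_intros dT0 refl | simp)+
      thus "\<exists>d. ((\<lambda>x. T x + l * x) has_real_derivative d) (at t) \<and> 0 \<le> d" using l(4)[of t] by auto
    qed
    have low: "T x + l * x \<ge> T 0 - C / \<beta>" if "x \<le> 0" for x
    proof -
      have "T 0 + l * 0 - C / \<beta> * exp (\<beta> * 0) \<le> T x + l * x - C / \<beta> * exp (\<beta> * x)"
      proof (rule DERIV_nonpos_imp_nonincreasing[where f = "\<lambda>x. T x + l * x - C / \<beta> * exp (\<beta> * x)", OF that])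
        fix t
        have "((\<lambda>x. T x + l * x - C / \<beta> * exp (\<beta> * x)) has_real_derivative (- J t + l - C * exp (\<beta> * t))) (at t)"
          by (rule derivative_eq_intros dT0 refl | use l in simp)+
        thus "\<exists>d. ((\<lambda>x. T x + l * x - C / \<beta> * exp (\<beta> * x)) has_real_derivative d) (at t) \<and> d \<le> 0"
          using l(5)[of t] by auto
      qed
      moreover have "C / \<beta> * exp (\<beta> * x) \<ge> 0" using l by simp
      ultimately show ?thesis by simp
    qed
    define D where "D = \<bar>T 0\<bar> + C / \<beta> + l"
    have near: "\<bar>T x / (1 + \<bar>x\<bar>) - l\<bar> \<le> D / (1 + \<bar>x\<bar>)" if "x \<le> 0" for x
    proof -
      have "T x / (1 + \<bar>x\<bar>) - l = (T x - l * (1 + \<bar>x\<bar>)) / (1 + \<bar>x\<bar>)"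
        by (simp add: diff_divide_distrib add_nonneg_eq_0_iff)
      hence "\<bar>T x / (1 + \<bar>x\<bar>) - l\<bar> = \<bar>T x - l * (1 + \<bar>x\<bar>)\<bar> / (1 + \<bar>x\<bar>)" by (simp add: abs_divide)
      also have "\<dots> \<le> D / (1 + \<bar>x\<bar>)"
      proof (rule divide_right_mono)
        have "T x - l * (1 + \<bar>x\<bar>) = T x + l * x - l" using that by (simp add: algebra_simps)
        moreover have "C / \<beta> \<ge> 0" using l by simp
        ultimately show "\<bar>T x - l * (1 + \<bar>x\<bar>)\<bar> \<le> D"
          using up[OF that] low[OF that] l(1) by (simp add: D_def)
      qed simp
      finally show ?thesis .
    qed
    have inf: "filterlim (\<lambda>x::real. 1 + \<bar>x\<bar>) at_top at_bot"
      unfolding filterlim_at_top using abs_large by auto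
    have "((\<lambda>x. D / (1 + \<bar>x\<bar>)) \<longlongrightarrow> 0) at_bot"
      by (rule real_tendsto_divide_at_top[OF tendsto_const inf])
    hence "((\<lambda>x. T x / (1 + \<bar>x\<bar>) - l) \<longlongrightarrow> 0) at_bot"
    proof (rule Lim_null_comparison[rotated])
      show "\<forall>\<^sub>F x in at_bot. norm (T x / (1 + \<bar>x\<bar>) - l) \<le> D / (1 + \<bar>x\<bar>)"
        using eventually_le_at_bot[of 0]
        by eventually_elim (simp only: real_norm_def near)
    qed
    thus ?thesis by (rule LIM_zero_cancel)
  qed
  show thesis using that[OF l(1) 1] 2 by blast
qed

text \<open>The logarithmic derivative of \<phi> is \<mu> + W' / W with c W' = L W - r; after
  division by G the numerator tends to 0 and W / G to a positive limit, so no asymptotic formula has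
  to be differentiated.\<close>

lemma log_derivative_limit:
  assumes G1: "\<And>x. G x \<ge> 1" and A: "A > 0"
    and WG: "((\<lambda>x. W x / G x) \<longlongrightarrow> A) at_bot" and LG: "((\<lambda>x. L \<mu> W x / G x) \<longlongrightarrow> 0) at_bot"
  shows "((\<lambda>x. deriv \<phi> x / \<phi> x) \<longlongrightarrow> \<mu>) at_bot"
proof -
  obtain C where C: "C \<ge> 0" "\<And>x. r x * (1 + x\<^sup>2) \<le> C" using r_weight by metis
  have inf: "filterlim (\<lambda>x::real. 1 + \<bar>x\<bar>) at_top at_bot"
    unfolding filterlim_at_top using abs_large by auto
  have lim0: "((\<lambda>x. 2 * C / (1 + \<bar>x\<bar>)) \<longlongrightarrow> 0) at_bot"
    by (rule real_tendsto_divide_at_top[OF tendsto_const inf])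
  have bound: "norm (r x / G x) \<le> 2 * C / (1 + \<bar>x\<bar>)" for x
  proof -
    have "r x / G x \<le> r x / 1" using r_nonneg G1[of x] by (intro divide_left_mono) auto
    note le1 = this
    have "r x * (1 + \<bar>x\<bar>) \<le> r x * (2 * (1 + x\<^sup>2))"
      using one_plus_abs_le r_nonneg by (intro mult_left_mono)
    moreover have "r x * (2 * (1 + x\<^sup>2)) = 2 * (r x * (1 + x\<^sup>2))" by (simp only: ac_simps)
    ultimately have "r x * (1 + \<bar>x\<bar>) \<le> 2 * C" using C(2)[of x] by linarith
    hence "r x \<le> 2 * C / (1 + \<bar>x\<bar>)" by (simp add: pos_le_divide_eq add_pos_nonneg)
    moreover have "r x / G x \<ge> 0" using r_nonneg G1[of x] by simp
    ultimately show ?thesis using le1 by simp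
  qed
  have "((\<lambda>x. r x / G x) \<longlongrightarrow> 0) at_bot"
    by (rule Lim_null_comparison[OF always_eventually lim0]) (rule allI, rule bound)
  hence "((\<lambda>x. \<mu> + (L \<mu> W x / G x - r x / G x) / c / (W x / G x)) \<longlongrightarrow> \<mu> + (0 - 0) / c / A) at_bot"
    using WG LG A c_pos by (intro tendsto_intros) auto
  moreover have "\<mu> + (L \<mu> W x / G x - r x / G x) / c / (W x / G x) = deriv \<phi> x / \<phi> x" for x
  proof -
    have W0: "W x > 0" by (rule w_pos)
    have cancel: "(a / g - b' / g) / c / (v / g) = (a - b') / c / v" if "g > 0" "v > 0" for a b' g v
      using that c_pos by (simp add: field_simps)
    have quot: "(L \<mu> W x / G x - r x / G x) / c / (W x / G x) = (L \<mu> W x - r x) / c / W x"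
      by (rule cancel) (use G1[of x] W0 in auto)
    have "((\<lambda>x. exp (\<mu> * x) * W x) has_real_derivative
        (exp (\<mu> * x) * (\<mu> * W x + (L \<mu> W x - r x) / c))) (at x)"
      by (rule derivative_eq_intros dW refl | simp add: algebra_simps)+
    moreover have phi: "\<phi> = (\<lambda>x. exp (\<mu> * x) * W x)" by (rule ext) (simp add: w_def exp_minus)
    ultimately have "deriv \<phi> x = exp (\<mu> * x) * (\<mu> * W x + (L \<mu> W x - r x) / c)"
      by (metis DERIV_imp_deriv)
    moreover have "\<phi> x = exp (\<mu> * x) * W x" by (simp add: w_def exp_minus)
    ultimately have "deriv \<phi> x / \<phi> x = (\<mu> * W x + (L \<mu> W x - r x) / c) / W x" by simp
    also have "\<dots> = \<mu> + (L \<mu> W x - r x) / c / W x" using W0 by (simp add: add_divide_distrib)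
    finally show ?thesis unfolding quot by simp
  qed
  ultimately show ?thesis by simp
qed

lemma flux_asymptotics:
  shows "m > 0 \<Longrightarrow> \<exists>A>0. (W \<longlongrightarrow> A) at_bot"
    and "m = 0 \<Longrightarrow> \<exists>A>0. ((\<lambda>x. W x / (1 + \<bar>x\<bar>)) \<longlongrightarrow> A) at_bot"
    and "((\<lambda>x. deriv \<phi> x / \<phi> x) \<longlongrightarrow> \<mu>) at_bot"
proof -
  obtain l where l: "l > 0" "(J \<longlongrightarrow> l) at_bot" "((\<lambda>x. T x / (1 + \<bar>x\<bar>)) \<longlongrightarrow> l) at_bot \<or> m \<noteq> 0"
    using J_tendsto by metis
  have pos: "((\<lambda>x. W x / 1) \<longlongrightarrow> l / m) at_bot \<and> ((\<lambda>x. L \<mu> W x / 1) \<longlongrightarrow> 0) at_bot" if m: "m > 0"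
  proof -
    obtain C where C: "\<And>x. W x \<le> C" using W_bounded[OF m] by blast
    have F: "\<bar>J x / 1 - A * m\<bar> \<le> \<epsilon> * (c + Q)"
      if "\<epsilon> \<ge> 0" "\<And>t. \<bar>W (x + t) / 1 - A\<bar> \<le> \<epsilon> * (1 + t\<^sup>2)" for x A \<epsilon>
      using that by (intro J_near) auto
    show ?thesis
      using l(2) C by (intro conjI W_limit[where F = J and CF = "c + Q" and Cw = C and q = m] m F) auto
  qed
  have zero: "((\<lambda>x. W x / (1 + \<bar>x\<bar>)) \<longlongrightarrow> l / k) at_bot \<and> ((\<lambda>x. L \<mu> W x / (1 + \<bar>x\<bar>)) \<longlongrightarrow> 0) at_bot" if m: "m = 0"
  proof -
    obtain C where C: "\<And>x. W x \<le> C * (1 + \<bar>x\<bar>)" using W_linear_growth by metis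
    have F: "\<bar>T x / (1 + \<bar>x\<bar>) - A * k\<bar> \<le> \<epsilon> * Q"
      if "\<epsilon> \<ge> 0" "\<And>t. \<bar>W (x + t) / (1 + \<bar>x\<bar>) - A\<bar> \<le> \<epsilon> * (1 + t\<^sup>2)" for x A \<epsilon>
      using that by (intro T_near) auto
    have slow: "\<bar>1 + \<bar>x + t\<bar> - (1 + \<bar>x\<bar>)\<bar> * (1 + \<bar>x\<bar>) \<le> \<bar>t\<bar> * (1 + \<bar>x\<bar>)" for x t :: real
      by (intro mult_right_mono) auto
    show ?thesis
      using l(3) m C slow by (intro conjI W_limit[where F = T and CF = Q and Cw = C and q = k] k_pos F) auto
  qed
  show "\<exists>A>0. (W \<longlongrightarrow> A) at_bot" if "m > 0"
    using pos[OF that] l(1) that by (intro exI[of _ "l / m"]) auto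
  show "\<exists>A>0. ((\<lambda>x. W x / (1 + \<bar>x\<bar>)) \<longlongrightarrow> A) at_bot" if "m = 0"
    using zero[OF that] l(1) k_pos by (intro exI[of _ "l / k"]) auto
  show "((\<lambda>x. deriv \<phi> x / \<phi> x) \<longlongrightarrow> \<mu>) at_bot"
  proof (cases "m = 0")
    case True
    show ?thesis
      by (rule log_derivative_limit[of "\<lambda>x. 1 + \<bar>x\<bar>" "l / k"]) (use zero[OF True] l(1) k_pos in auto)
  next
    case False
    hence "m > 0" using m_nonneg by simp
    thus ?thesis using pos l(1)
      by (intro log_derivative_limit[of "\<lambda>x. 1" "l / m"]) auto
  qed
qed

end

context wave
begin

theorem wave_asymptotics:
  defines "m0 \<equiv> c - (\<integral>\<alpha>. exp (\<mu> * \<alpha>) * \<alpha> \<partial>\<rho>)"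
  shows "m0 > 0 \<Longrightarrow> \<exists>A>0. ((\<lambda>x. exp (- \<mu> * x) * \<phi> x) \<longlongrightarrow> A) at_bot"
    and "m0 = 0 \<Longrightarrow> \<exists>A>0. ((\<lambda>x. exp (- \<mu> * x) * \<phi> x / (1 + \<bar>x\<bar>)) \<longlongrightarrow> A) at_bot"
    and "((\<lambda>x. deriv \<phi> x / \<phi> x) \<longlongrightarrow> \<mu>) at_bot"
proof -
  have wK: "w \<mu> x \<le> K * exp (- \<mu> * x)" for x
    unfolding w_def by (subst mult.commute) (intro mult_right_mono phi_le, simp)
  obtain V where V: "\<And>x. (V has_real_derivative - w \<mu> x) (at x)" "\<And>x. 0 \<le> V x"
    "\<And>x. V x \<le> K / \<mu> * exp (- \<mu> * x)"
    using exp_bounded_antiderivative_at_top[OF w_cont lam(1) less_imp_le[OF w_pos] wK] by metis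
  have cV: "continuous_on UNIV V" using V(1) by (meson DERIV_isCont continuous_at_imp_continuous_on)
  obtain U where U: "\<And>x. (U has_real_derivative - V x) (at x)"
    using exp_bounded_antiderivative_at_top[OF cV lam(1) V(2,3)] by metis
  \<comment> \<open>The \<open>V\<close> obtained above is the positive tail integral, so its
    negative takes the place of the locale's \<open>V\<close>.\<close>
  interpret wave_flux \<rho> d0 \<Lambda> c b K M s \<mu> \<phi> R "\<lambda>x. - V x" U
    by unfold_locales (use V U DERIV_minus[OF V(1)] in auto)
  show "m0 > 0 \<Longrightarrow> \<exists>A>0. ((\<lambda>x. exp (- \<mu> * x) * \<phi> x) \<longlongrightarrow> A) at_bot"
    "m0 = 0 \<Longrightarrow> \<exists>A>0. ((\<lambda>x. exp (- \<mu> * x) * \<phi> x / (1 + \<bar>x\<bar>)) \<longlongrightarrow> A) at_bot"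
    "((\<lambda>x. deriv \<phi> x / \<phi> x) \<longlongrightarrow> \<mu>) at_bot"
    using flux_asymptotics unfolding m_def m0_def w_def by auto
qed

end

section \<open>The kernel and its characteristic function\<close>

text \<open>The kernel is a sum of point masses and an absolutely continuous part. Nonnegative
  integrals add up by induction over measurable functions; real integrals are derived from them in
  \<open>atoms_plus_density_measure\<close>.\<close>

lemma sum_of_borel_measures:
  fixes M N :: "real measure"
  assumes [measurable_cong]: "sets M = sets borel" "sets N = sets borel"
  obtains \<rho> :: "real measure" where "sets \<rho> = sets borel"
    "\<And>F. F \<in> borel_measurable borel \<Longrightarrow> (\<integral>\<^sup>+x. F x \<partial>\<rho>) = (\<integral>\<^sup>+x. F x \<partial>M) + (\<integral>\<^sup>+x. F x \<partial>N)"
proof -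
  define \<rho> :: "real measure" where "\<rho> = measure_of UNIV (sets borel) (\<lambda>A. emeasure M A + emeasure N A)"
  have sets_rho [measurable_cong]: "sets \<rho> = sets borel"
    unfolding \<rho>_def by (metis sets.sigma_sets_eq sets_measure_of space_borel subset_Pow_Union top_greatest sets.space_closed)
  have em: "emeasure \<rho> A = emeasure M A + emeasure N A" if "A \<in> sets borel" for A
  proof (rule emeasure_measure_of[OF \<rho>_def])
    show "positive (sets \<rho>) (\<lambda>A. emeasure M A + emeasure N A)" by (simp add: positive_def)
    show "countably_additive (sets \<rho>) (\<lambda>A. emeasure M A + emeasure N A)"
      unfolding countably_additive_def
    proof (intro allI impI)
      fix A :: "nat \<Rightarrow> real set"
      assume A: "range A \<subseteq> sets \<rho>" "disjoint_family A"
      have "(\<Sum>i. emeasure M (A i) + emeasure N (A i)) = (\<Sum>i. emeasure M (A i)) + (\<Sum>i. emeasure N (A i))"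
        by (rule suminf_add[symmetric]) auto
      also have "\<dots> = emeasure M (\<Union>i. A i) + emeasure N (\<Union>i. A i)"
        using A by (subst (1 2) suminf_emeasure) (auto simp: sets_rho assms)
      finally show "(\<Sum>i. emeasure M (A i) + emeasure N (A i)) = emeasure M (\<Union>i. A i) + emeasure N (\<Union>i. A i)" .
    qed
  qed (use that sets_rho in auto)
  show thesis
  proof (rule that[OF sets_rho])
    fix F :: "real \<Rightarrow> ennreal" assume "F \<in> borel_measurable borel"
    thus "(\<integral>\<^sup>+x. F x \<partial>\<rho>) = (\<integral>\<^sup>+x. F x \<partial>M) + (\<integral>\<^sup>+x. F x \<partial>N)"
    proof induction
      case (cong f g)
      thus ?case by (simp add: fun_eq_iff)
    next
      case (set A)
      thus ?case by (simp add: em assms sets_rho)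
    next
      case (mult u c)
      thus ?case by (simp add: nn_integral_cmult distrib_left)
    next
      case (add u v)
      thus ?case by (simp add: nn_integral_add ac_simps)
    next
      case (seq U)
      have m: "U i \<in> borel_measurable M" "U i \<in> borel_measurable N" "U i \<in> borel_measurable \<rho>" for i
        using seq(1)[of i] by measurable
      have "(\<integral>\<^sup>+x. (SUP i. U i) x \<partial>\<rho>) = (SUP i. \<integral>\<^sup>+x. U i x \<partial>\<rho>)"
        unfolding SUP_apply by (rule nn_integral_monotone_convergence_SUP[OF seq(3) m(3)])
      also have "\<dots> = (SUP i. (\<integral>\<^sup>+x. U i x \<partial>M) + (\<integral>\<^sup>+x. U i x \<partial>N))" by (simp add: seq)
      also have "\<dots> = (SUP i. \<integral>\<^sup>+x. U i x \<partial>M) + (SUP i. \<integral>\<^sup>+x. U i x \<partial>N)"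
        using seq(3) by (intro ennreal_SUP_add) (auto simp: incseq_def le_fun_def intro!: nn_integral_mono)
      also have "\<dots> = (\<integral>\<^sup>+x. (SUP i. U i) x \<partial>M) + (\<integral>\<^sup>+x. (SUP i. U i) x \<partial>N)"
        unfolding SUP_apply
        using nn_integral_monotone_convergence_SUP[OF seq(3) m(1)]
          nn_integral_monotone_convergence_SUP[OF seq(3) m(2)] by simp
      finally show ?case .
    qed
  qed
qed

text \<open>The push-forward under y -> - y - e turns the delayed convolution at x - e into an
  integral of \<phi> (x + \<alpha>), so that both nonlocal terms of the wave equation become one
  translation-invariant integral. The atoms are finite, hence the density alone decides
  integrability.\<close>

lemma atoms_plus_density_measure:
  fixes k :: "real \<Rightarrow> real" and d e :: real
  assumes d: "d \<ge> 0" and [measurable]: "k \<in> borel_measurable borel" and k: "\<And>y. k y \<ge> 0"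
  obtains \<rho> :: "real measure" where "sets \<rho> = sets borel"
    "\<And>F. F \<in> borel_measurable borel \<Longrightarrow>
      integrable \<rho> F \<longleftrightarrow> integrable lborel (\<lambda>y. k y * F (- y - e))"
    "\<And>F. F \<in> borel_measurable borel \<Longrightarrow> integrable \<rho> F \<Longrightarrow>
      (\<integral>\<alpha>. F \<alpha> \<partial>\<rho>) = d * F 1 + d * F (- 1) + (\<integral>y. k y * F (- y - e) \<partial>lborel)"
proof -
  define M :: "real measure" where "M = distr (density (count_space {1, - 1}) (\<lambda>_. ennreal d)) borel (\<lambda>x. x)"
  define N :: "real measure" where "N = distr (density lborel (\<lambda>y. ennreal (k y))) borel (\<lambda>y. - y - e)"
  have sets_MN: "sets M = sets borel" "sets N = sets borel" by (auto simp: M_def N_def)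
  obtain \<rho> :: "real measure" where sets_rho: "sets \<rho> = sets borel"
    and nn: "\<And>F. F \<in> borel_measurable borel \<Longrightarrow> (\<integral>\<^sup>+x. F x \<partial>\<rho>) = (\<integral>\<^sup>+x. F x \<partial>M) + (\<integral>\<^sup>+x. F x \<partial>N)"
    using sum_of_borel_measures[OF sets_MN] by metis
  note [measurable_cong] = sets_MN sets_rho
  have nnM: "(\<integral>\<^sup>+x. F x \<partial>M) = ennreal d * F 1 + ennreal d * F (- 1)"
    if [measurable]: "F \<in> borel_measurable borel" for F :: "real \<Rightarrow> ennreal"
    unfolding M_def
    by (subst nn_integral_distr) (auto simp: nn_integral_density nn_integral_count_space_finite)
  have N_int: "integrable N F \<longleftrightarrow> integrable lborel (\<lambda>y. k y * F (- y - e))"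
    and N_integral: "(\<integral>x. F x \<partial>N) = (\<integral>y. k y * F (- y - e) \<partial>lborel)"
    if [measurable]: "F \<in> borel_measurable borel" for F :: "real \<Rightarrow> real"
    unfolding N_def using k
    by (subst integrable_distr_eq integral_distr; simp add: integrable_density integral_density)+
  have M_fin: "(\<integral>\<^sup>+x. ennreal (F x) \<partial>M) < \<infinity>" if [measurable]: "F \<in> borel_measurable borel" for F :: "real \<Rightarrow> real"
    by (subst nnM) (auto simp: ennreal_mult_less_top)
  have int: "integrable \<rho> F \<longleftrightarrow> integrable N F" if [measurable]: "F \<in> borel_measurable borel" for F :: "real \<Rightarrow> real"
    unfolding integrable_iff_bounded using M_fin[of "\<lambda>x. norm (F x)"] by (auto simp: nn)
  have M_int: "integrable M F" if [measurable]: "F \<in> borel_measurable borel" for F :: "real \<Rightarrow> real"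
    unfolding integrable_iff_bounded using M_fin[of "\<lambda>x. norm (F x)"] by auto
  have M_integral: "(\<integral>x. F x \<partial>M) = d * F 1 + d * F (- 1)" if [measurable]: "F \<in> borel_measurable borel" for F :: "real \<Rightarrow> real"
    unfolding M_def using d
    by (subst integral_distr; simp add: integral_density lebesgue_integral_count_space_finite distrib_left)
  have sum: "(\<integral>x. F x \<partial>\<rho>) = (\<integral>x. F x \<partial>M) + (\<integral>x. F x \<partial>N)"
    if F: "F \<in> borel_measurable borel" and i: "integrable \<rho> F" for F :: "real \<Rightarrow> real"
  proof -
    note [measurable] = F
    have iN: "integrable N F" using int[OF F] i by simp
    have fin: "(\<integral>\<^sup>+x. ennreal (F x) \<partial>M) < top" "(\<integral>\<^sup>+x. ennreal (- F x) \<partial>M) < top"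
      "(\<integral>\<^sup>+x. ennreal (F x) \<partial>N) < top" "(\<integral>\<^sup>+x. ennreal (- F x) \<partial>N) < top"
      using M_int[OF F] iN unfolding real_integrable_def by (auto simp: less_top)
    show ?thesis
      unfolding real_lebesgue_integral_def[OF i] real_lebesgue_integral_def[OF M_int[OF F]] real_lebesgue_integral_def[OF iN]
      using fin by (simp add: nn enn2real_plus)
  qed
  show thesis
  proof (rule that[OF sets_rho])
    fix F :: "real \<Rightarrow> real" assume F: "F \<in> borel_measurable borel"
    show "integrable \<rho> F \<longleftrightarrow> integrable lborel (\<lambda>y. k y * F (- y - e))"
      using int[OF F] N_int[OF F] by simp
    show "(\<integral>\<alpha>. F \<alpha> \<partial>\<rho>) = d * F 1 + d * F (- 1) + (\<integral>y. k y * F (- y - e) \<partial>lborel)" if "integrable \<rho> F"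
      using sum[OF F that] M_integral[OF F] N_integral[OF F] by simp
  qed
qed

text \<open>Evenness folds the line: the integrand is dominated by the half-line moment function
  plus its mirror image.\<close>

lemma even_exp_moment_integrable:
  fixes h :: "real \<Rightarrow> real"
  assumes nn: "\<And>x. h x \<ge> 0" and even: "\<And>x. h (- x) = h x" and [measurable]: "h \<in> borel_measurable borel"
    and int: "set_integrable lborel {0..} (\<lambda>x. h x * exp (\<bar>l\<bar> * x))"
  shows "integrable lborel (\<lambda>y. h y * exp (l * y))"
proof -
  define g where "g x = indicator {0..} x * (h x * exp (\<bar>l\<bar> * x))" for x :: real
  have g: "integrable lborel g" using int by (simp add: set_integrable_def g_def[abs_def])
  have g': "integrable lborel (\<lambda>x. g (- x))"
    using lborel_integrable_real_affine_iff[of "- 1" g 0] g by simp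
  show ?thesis
  proof (rule Bochner_Integration.integrable_bound[OF Bochner_Integration.integrable_add[OF g g']])
    show "AE y in lborel. norm (h y * exp (l * y)) \<le> norm (g y + g (- y))"
    proof (rule AE_I2)
      fix y :: real
      have "l * y \<le> \<bar>l\<bar> * \<bar>y\<bar>" by (metis abs_ge_self abs_mult)
      hence "h y * exp (l * y) \<le> h y * exp (\<bar>l\<bar> * \<bar>y\<bar>)" using nn by (intro mult_left_mono) auto
      also have "\<dots> \<le> g y + g (- y)" using nn[of y] by (cases "y \<ge> 0") (auto simp: g_def even)
      finally show "norm (h y * exp (l * y)) \<le> norm (g y + g (- y))" using nn[of y] by simp
    qed
  qed measurable
qed

section \<open>Convexity and roots of the characteristic function\<close>

context kernel
begin

text \<open>Integrates the tangent inequality exp (a \<alpha>) \<ge> exp (l \<alpha>) (1 + (a - l)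
  \<alpha>); keeping the gap at the atom \<alpha> = 1 makes the convexity of \<open>E\<close>
  strict.\<close>

lemma E_tangent:
  assumes "\<bar>a\<bar> < \<Lambda>" "\<bar>l\<bar> < \<Lambda>"
    and int: "integrable \<rho> (\<lambda>\<alpha>. exp (l * \<alpha>) * \<alpha>)"
  shows "E l + (a - l) * (\<integral>\<alpha>. exp (l * \<alpha>) * \<alpha> \<partial>\<rho>) + d0 * (exp a - exp l * (1 + (a - l))) \<le> E a"
proof -
  define F where "F \<alpha> = exp (a * \<alpha>) - (exp (l * \<alpha>) + (a - l) * (exp (l * \<alpha>) * \<alpha>))" for \<alpha>
  have F0: "F \<alpha> \<ge> 0" for \<alpha>
  proof -
    have "exp (l * \<alpha>) * (1 + (a - l) * \<alpha>) \<le> exp (l * \<alpha>) * exp ((a - l) * \<alpha>)"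
      by (intro mult_left_mono exp_ge_add_one_self) auto
    also have "\<dots> = exp (a * \<alpha>)" by (simp add: algebra_simps flip: exp_add)
    finally show ?thesis by (simp add: F_def algebra_simps)
  qed
  have Fi: "integrable \<rho> F" unfolding F_def
    by (intro Bochner_Integration.integrable_diff Bochner_Integration.integrable_add integrable_mult_right int exp_int assms)
  have "d0 * F 1 \<le> (\<integral>\<alpha>. F \<alpha> \<partial>\<rho>)" by (rule atom[OF Fi F0])
  also have "\<dots> = E a - (E l + (a - l) * (\<integral>\<alpha>. exp (l * \<alpha>) * \<alpha> \<partial>\<rho>))"
    unfolding F_def E_def using int exp_int assms
    by (subst Bochner_Integration.integral_diff Bochner_Integration.integral_add; simp)+
  finally show ?thesis by (simp add: F_def algebra_simps)
qed

lemma E_continuous: "continuous_on {- \<Lambda><..<\<Lambda>} E"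
proof (rule convex_on_continuous)
  show "convex_on {- \<Lambda><..<\<Lambda>} E"
  proof (rule convex_onI)
    fix t x y :: real
    assume t: "0 < t" "t < 1" and "x \<in> {- \<Lambda><..<\<Lambda>}" "y \<in> {- \<Lambda><..<\<Lambda>}"
    hence "\<bar>x\<bar> < \<Lambda>" "\<bar>y\<bar> < \<Lambda>" by (auto simp: abs_less_iff)
    thus "E ((1 - t) *\<^sub>R x + t *\<^sub>R y) \<le> (1 - t) * E x + t * E y"
      using E_convex[of x y "1 - t"] t by simp
  qed simp
qed simp

text \<open>Any root in (0, \<nu>) is the first one: P is concave and positive at \<nu>, so P \<ge>
  0 at an earlier a would make P(\<mu>) > 0. The tangent at \<mu> must reach a positive value at
  \<nu>, whence P'(\<mu>) > 0.\<close>

lemma smallest_root: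
  assumes \<nu>: "0 < \<nu>" "\<nu> < \<Lambda>" and P0: "b < E 0" and P\<nu>: "c * \<nu> + b > E \<nu>"
  obtains \<mu> where "0 < \<mu>" "\<mu> < \<nu>" "c * \<mu> + b = E \<mu>" "\<And>a. 0 \<le> a \<Longrightarrow> a < \<mu> \<Longrightarrow> c * a + b < E a"
    "(\<integral>\<alpha>. exp (\<mu> * \<alpha>) * \<alpha> \<partial>\<rho>) < c"
proof -
  have cont: "continuous_on {0..\<nu>} (\<lambda>a. c * a + b - E a)"
    using \<nu> by (intro continuous_intros continuous_on_subset[OF E_continuous]) auto
  obtain \<mu> where \<mu>: "0 \<le> \<mu>" "\<mu> \<le> \<nu>" "c * \<mu> + b - E \<mu> = 0"
    using IVT'[of "\<lambda>a. c * a + b - E a" 0 0 \<nu>, OF _ _ _ cont] P0 P\<nu> \<nu> by auto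
  have ne: "\<mu> \<noteq> 0" "\<mu> \<noteq> \<nu>" using \<mu> P0 P\<nu> by auto
  have bound: "0 < \<mu>" "\<mu> < \<nu>" using \<mu> ne by auto
  show thesis
  proof (rule that[OF bound])
    show "c * \<mu> + b = E \<mu>" using \<mu> by simp
    show "c * a + b < E a" if a: "0 \<le> a" "a < \<mu>" for a
    proof (rule ccontr)
      assume "\<not> ?thesis"
      hence Pa: "E a \<le> c * a + b" by simp
      define \<theta> where "\<theta> = (\<nu> - \<mu>) / (\<nu> - a)"
      have \<theta>: "0 < \<theta>" "\<theta> < 1" using a bound by (auto simp: \<theta>_def field_simps)
      have "\<theta> * (\<nu> - a) = \<nu> - \<mu>" using a bound by (simp add: \<theta>_def)
      hence e: "\<theta> * a + (1 - \<theta>) * \<nu> = \<mu>" by (simp add: algebra_simps)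
      have "E \<mu> \<le> \<theta> * E a + (1 - \<theta>) * E \<nu>"
        using E_convex[of a \<nu> \<theta>] \<theta> a bound \<nu> by (simp add: e)
      moreover have "\<theta> * E a \<le> \<theta> * (c * a + b)" using Pa \<theta> by (intro mult_left_mono) auto
      moreover have "(1 - \<theta>) * E \<nu> < (1 - \<theta>) * (c * \<nu> + b)" using P\<nu> \<theta> by (intro mult_strict_left_mono) auto
      ultimately have "E \<mu> < \<theta> * (c * a + b) + (1 - \<theta>) * (c * \<nu> + b)" by linarith
      also have "\<dots> = c * (\<theta> * a + (1 - \<theta>) * \<nu>) + b" by (simp add: algebra_simps)
      finally show False using \<mu>(3) unfolding e by linarith
    qed
    define m where "m = (\<integral>\<alpha>. exp (\<mu> * \<alpha>) * \<alpha> \<partial>\<rho>)"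
    have "E \<mu> + (\<nu> - \<mu>) * m + d0 * (exp \<nu> - exp \<mu> * (1 + (\<nu> - \<mu>))) \<le> E \<nu>"
      unfolding m_def using \<nu> bound by (intro E_tangent moment1_int) auto
    moreover have "exp \<mu> * (1 + (\<nu> - \<mu>)) \<le> exp \<mu> * exp (\<nu> - \<mu>)"
      by (intro mult_left_mono exp_ge_add_one_self) auto
    hence "d0 * (exp \<nu> - exp \<mu> * (1 + (\<nu> - \<mu>))) \<ge> 0" using d0_pos by (simp add: exp_diff)
    ultimately have "E \<mu> + (\<nu> - \<mu>) * m < c * \<nu> + b" using P\<nu> by linarith
    hence "(\<nu> - \<mu>) * m < (\<nu> - \<mu>) * c" using \<mu>(3) by (simp add: algebra_simps)
    thus "(\<integral>\<alpha>. exp (\<mu> * \<alpha>) * \<alpha> \<partial>\<rho>) < c" using bound by (simp add: m_def)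
  qed
qed

text \<open>Differentiability enters only through the hypothesis: by \<open>E_tangent\<close>, P
  minus a line of slope m has a local maximum at \<mu>, so its derivative - m vanishes there. The
  strict gap at the atom then makes P negative away from \<mu>.\<close>

lemma double_root:
  assumes \<mu>: "\<bar>\<mu>\<bar> < \<Lambda>" and P: "c * \<mu> + b = E \<mu>"
    and der: "((\<lambda>a. c * a + b - E a) has_real_derivative 0) (at \<mu>)"
  shows "(\<integral>\<alpha>. exp (\<mu> * \<alpha>) * \<alpha> \<partial>\<rho>) = c"
    and "\<And>a. \<bar>a\<bar> < \<Lambda> \<Longrightarrow> a \<noteq> \<mu> \<Longrightarrow> c * a + b < E a"
proof -
  define m where "m = c - (\<integral>\<alpha>. exp (\<mu> * \<alpha>) * \<alpha> \<partial>\<rho>)"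
  have tan: "c * a + b - E a \<le> (a - \<mu>) * m - d0 * (exp a - exp \<mu> * (1 + (a - \<mu>)))" if "\<bar>a\<bar> < \<Lambda>" for a
    using E_tangent[OF that \<mu> moment1_int[OF \<mu>]] P by (simp add: m_def algebra_simps)
  have strict: "exp a - exp \<mu> * (1 + (a - \<mu>)) \<ge> 0" for a
    using mult_left_mono[OF exp_ge_add_one_self[of "a - \<mu>"], of "exp \<mu>"] by (simp add: exp_diff)
  have "- m = 0"
  proof (rule DERIV_local_max)
    show "((\<lambda>a. c * a + b - E a - (a - \<mu>) * m) has_real_derivative - m) (at \<mu>)"
      by (rule derivative_eq_intros der refl | simp)+
    show "\<Lambda> - \<bar>\<mu>\<bar> > 0" using \<mu> by simp
    show "\<forall>y. \<bar>\<mu> - y\<bar> < \<Lambda> - \<bar>\<mu>\<bar> \<longrightarrow> c * y + b - E y - (y - \<mu>) * m \<le> c * \<mu> + b - E \<mu> - (\<mu> - \<mu>) * m"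
    proof (intro allI impI)
      fix y assume "\<bar>\<mu> - y\<bar> < \<Lambda> - \<bar>\<mu>\<bar>"
      hence "\<bar>y\<bar> < \<Lambda>" by linarith
      moreover have "d0 * (exp y - exp \<mu> * (1 + (y - \<mu>))) \<ge> 0" using d0_pos strict by simp
      ultimately show "c * y + b - E y - (y - \<mu>) * m \<le> c * \<mu> + b - E \<mu> - (\<mu> - \<mu>) * m"
        using tan[of y] P by simp
    qed
  qed
  hence m: "m = 0" by simp
  thus "(\<integral>\<alpha>. exp (\<mu> * \<alpha>) * \<alpha> \<partial>\<rho>) = c" by (simp add: m_def)
  show "c * a + b < E a" if a: "\<bar>a\<bar> < \<Lambda>" "a \<noteq> \<mu>" for a
  proof -
    have "1 + (a - \<mu>) \<noteq> exp (a - \<mu>)"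
      using ln_eq_minus_one[of "exp (a - \<mu>)"] a(2) by auto
    hence "1 + (a - \<mu>) < exp (a - \<mu>)" using exp_ge_add_one_self[of "a - \<mu>"] by linarith
    hence "exp \<mu> * (1 + (a - \<mu>)) < exp \<mu> * exp (a - \<mu>)" by simp
    hence "d0 * (exp a - exp \<mu> * (1 + (a - \<mu>))) > 0" using d0_pos by (simp add: exp_diff)
    thus ?thesis using tan[OF a(1)] m by simp
  qed
qed

end

section \<open>Travelling waves\<close>

lemma exp_shift_limit:
  fixes \<phi> :: "real \<Rightarrow> real"
  assumes "\<mu> > 0" "A > 0" and lim: "((\<lambda>x. exp (- \<mu> * x) * \<phi> x) \<longlongrightarrow> A) at_bot"
  shows "((\<lambda>\<xi>. \<phi> (\<xi> + - ln A / \<mu>) / exp (\<mu> * \<xi>)) \<longlongrightarrow> 1) at_bot"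
proof -
  define \<eta> where "\<eta> = - ln A / \<mu>"
  have e: "exp (\<mu> * \<eta>) = 1 / A" using assms by (simp add: \<eta>_def exp_minus inverse_eq_divide)
  have "filterlim (\<lambda>\<xi>. \<xi> + \<eta>) at_bot at_bot"
    unfolding filterlim_at_bot eventually_at_bot_linorder
    by (metis add.commute le_diff_eq)
  from filterlim_compose[OF lim this]
  have "((\<lambda>\<xi>. exp (- \<mu> * (\<xi> + \<eta>)) * \<phi> (\<xi> + \<eta>) * exp (\<mu> * \<eta>)) \<longlongrightarrow> A * exp (\<mu> * \<eta>)) at_bot"
    by (rule tendsto_mult_right)
  moreover have "exp (- \<mu> * (\<xi> + \<eta>)) * \<phi> (\<xi> + \<eta>) * exp (\<mu> * \<eta>) = \<phi> (\<xi> + \<eta>) / exp (\<mu> * \<xi>)" for \<xi>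
    by (simp add: distrib_left exp_diff exp_minus field_simps flip: exp_add)
  moreover have "A * exp (\<mu> * \<eta>) = 1" using assms by (simp add: e)
  ultimately show ?thesis unfolding \<eta>_def[symmetric] by (simp only:)
qed

text \<open>For \<phi> divided by 1 + |x| the shift removes A as in \<open>exp_shift_limit\<close>;
  replacing 1 + |\<xi> + \<eta>| by -\<xi> costs a factor tending to 1.\<close>

lemma linear_exp_shift_limit:
  fixes \<phi> :: "real \<Rightarrow> real"
  assumes "\<mu> > 0" "A > 0" and lim: "((\<lambda>x. exp (- \<mu> * x) * \<phi> x / (1 + \<bar>x\<bar>)) \<longlongrightarrow> A) at_bot"
  shows "((\<lambda>\<xi>. \<phi> (\<xi> + - ln A / \<mu>) / (- \<xi> * exp (\<mu> * \<xi>))) \<longlongrightarrow> 1) at_bot"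
proof -
  define \<eta> where "\<eta> = - ln A / \<mu>"
  have "((\<lambda>x. exp (- \<mu> * x) * (\<phi> x / (1 + \<bar>x\<bar>))) \<longlongrightarrow> A) at_bot" using lim by simp
  from exp_shift_limit[OF assms(1,2) this]
  have 1: "((\<lambda>\<xi>. \<phi> (\<xi> + \<eta>) / (1 + \<bar>\<xi> + \<eta>\<bar>) / exp (\<mu> * \<xi>)) \<longlongrightarrow> 1) at_bot" by (simp add: \<eta>_def)
  have top: "filterlim (\<lambda>\<xi>::real. - \<xi>) at_top at_bot" by (rule filterlim_uminus_at_top_at_bot)
  have "((\<lambda>\<xi>. 1 + (1 - \<eta>) / (- \<xi>)) \<longlongrightarrow> 1 + 0) at_bot"
    by (intro tendsto_intros real_tendsto_divide_at_top[OF tendsto_const top])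
  moreover have "\<forall>\<^sub>F \<xi> in at_bot. 1 + (1 - \<eta>) / (- \<xi>) = (1 + \<bar>\<xi> + \<eta>\<bar>) / (- \<xi>)"
    using eventually_le_at_bot[of "- \<bar>\<eta>\<bar> - 1"]
  proof eventually_elim
    case (elim \<xi>)
    hence "\<bar>\<xi> + \<eta>\<bar> = - \<xi> - \<eta>" "\<xi> < 0" by auto
    thus ?case by (simp add: field_simps)
  qed
  ultimately have 2: "((\<lambda>\<xi>. (1 + \<bar>\<xi> + \<eta>\<bar>) / (- \<xi>)) \<longlongrightarrow> 1) at_bot"
    by (simp add: Lim_transform_eventually)
  have "\<phi> (\<xi> + \<eta>) / (1 + \<bar>\<xi> + \<eta>\<bar>) / exp (\<mu> * \<xi>) * ((1 + \<bar>\<xi> + \<eta>\<bar>) / (- \<xi>)) = \<phi> (\<xi> + \<eta>) / (- \<xi> * exp (\<mu> * \<xi>))" for \<xi>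
  proof -
    have "1 + \<bar>\<xi> + \<eta>\<bar> \<noteq> 0" by (simp add: add_nonneg_eq_0_iff)
    thus ?thesis by simp
  qed
  with tendsto_mult[OF 1 2] show ?thesis unfolding \<eta>_def[symmetric] by (simp only: mult_1_left)
qed

lemma le_of_nonneg_derivative_within:
  fixes g g' :: "real \<Rightarrow> real"
  assumes "\<And>y. y \<in> {0..K} \<Longrightarrow> (g has_real_derivative g' y) (at y within {0..K})"
    and "\<And>y. y \<in> {0..K} \<Longrightarrow> g' y \<ge> 0" and v: "0 \<le> v" "v \<le> K"
  shows "g 0 \<le> g v"
proof -
  have "\<exists>x\<in>{0..v}. g v - g 0 = g' x * (v - 0)"
  proof (rule mvt_very_simple[OF v(1)])
    fix x assume "0 \<le> x" "x \<le> v"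
    thus "(g has_derivative (*) (g' x)) (at x within {0..v})"
      using v by (intro has_derivative_subset[OF assms(1)[unfolded has_field_derivative_def]]) auto
  qed
  then obtain x where "x \<in> {0..v}" "g v - g 0 = g' x * v" by auto
  moreover have "g' x * v \<ge> 0" using assms(2)[of x] v \<open>x \<in> {0..v}\<close> by auto
  ultimately show ?thesis by linarith
qed

section \<open>The convolution with \<open>h\<close>\<close>

context
  fixes h \<phi> :: "real \<Rightarrow> real" and K :: real
  assumes h: "\<And>x. h x \<ge> 0" "integrable lborel h" "(LINT x|lborel. h x) = 1"
    and phi: "continuous_on UNIV \<phi>" "\<And>x. 0 \<le> \<phi> x" "\<And>x. \<phi> x \<le> K"
begin

lemma h_phi_le: "h y * \<phi> z \<le> K * h y"
  by (subst mult.commute) (intro mult_right_mono h phi)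

lemma h_phi_nonneg: "h y * \<phi> z \<ge> 0"
  by (intro mult_nonneg_nonneg h phi)

lemma conv_integrable: "integrable lborel (\<lambda>y. h y * \<phi> (x - y))"
proof (rule Bochner_Integration.integrable_bound)
  show "integrable lborel (\<lambda>y. K * h y)" using h by simp
  have [measurable]: "\<phi> \<in> borel_measurable borel" "h \<in> borel_measurable borel"
    using phi h by (auto intro: borel_measurable_continuous_onI borel_measurable_integrable)
  show "(\<lambda>y. h y * \<phi> (x - y)) \<in> borel_measurable lborel" by measurable
  show "AE y in lborel. norm (h y * \<phi> (x - y)) \<le> norm (K * h y)"
    using h_phi_le h_phi_nonneg by (intro AE_I2) (smt (verit) real_norm_def)
qed

lemma conv_bounds: "0 \<le> conv h \<phi> x" "conv h \<phi> x \<le> K"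
proof -
  show "0 \<le> conv h \<phi> x" unfolding conv_def using h phi by (intro integral_nonneg_AE AE_I2) auto
  have "conv h \<phi> x \<le> (LINT y|lborel. K * h y)"
    unfolding conv_def using h by (intro integral_mono conv_integrable h_phi_le) simp
  thus "conv h \<phi> x \<le> K" using h by simp
qed

lemma conv_tendsto:
  assumes "(\<phi> \<longlongrightarrow> l) at_top"
  shows "((\<lambda>x. conv h \<phi> (x - e)) \<longlongrightarrow> l) at_top"
proof -
  have [measurable]: "\<phi> \<in> borel_measurable borel" "h \<in> borel_measurable borel"
    using phi h by (auto intro: borel_measurable_continuous_onI borel_measurable_integrable)
  have "((\<lambda>x. LINT y|lborel. h y * \<phi> (x - e - y)) \<longlongrightarrow> (LINT y|lborel. h y * l)) at_top"
  proof (rule integral_dominated_convergence_at_top)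
    show "integrable lborel (\<lambda>y. K * h y)" using h by simp
    show "\<forall>\<^sub>F x in at_top. AE y in lborel. norm (h y * \<phi> (x - e - y)) \<le> K * h y"
      using h_phi_le h_phi_nonneg by (intro always_eventually allI AE_I2) (simp only: real_norm_def abs_of_nonneg)
    show "AE y in lborel. ((\<lambda>x. h y * \<phi> (x - e - y)) \<longlongrightarrow> h y * l) at_top"
    proof (rule AE_I2)
      fix y
      have "\<exists>N. \<forall>x\<ge>N. Z \<le> x - e - y" for Z by (rule exI[of _ "Z + e + y"]) auto
      hence "filterlim (\<lambda>x. x - e - y) at_top at_top"
        unfolding filterlim_at_top eventually_at_top_linorder by blast
      thus "((\<lambda>x. h y * \<phi> (x - e - y)) \<longlongrightarrow> h y * l) at_top"
        by (intro tendsto_mult_left filterlim_compose[OF assms])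
    qed
  qed measurable
  thus ?thesis using h by (simp add: conv_def)
qed

end

theorem theorem4p2:
  fixes d \<tau> K :: real
    and f f1 f2 :: "real \<Rightarrow> real \<Rightarrow> real"
    and h :: "real \<Rightarrow> real"
    and lam0 :: ereal
    and cstar lamstar c :: real
    and \<phi> :: "real \<Rightarrow> real"
  assumes d_pos: "d > 0" and tau_nonneg: "\<tau> \<ge> 0" and K_pos: "K > 0"
    \<comment> \<open>f1, f2 are the partial derivatives of f on [0,K]^2\<close>
    and f1_deriv: "\<And>u v. u \<in> {0..K} \<Longrightarrow> v \<in> {0..K} \<Longrightarrow>
        ((\<lambda>x. f x v) has_real_derivative f1 u v) (at u within {0..K})"
    and f2_deriv: "\<And>u v. u \<in> {0..K} \<Longrightarrow> v \<in> {0..K} \<Longrightarrow>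
        ((\<lambda>y. f u y) has_real_derivative f2 u v) (at v within {0..K})"
    \<comment> \<open>(F1)\<close>
    and F1_cont: "continuous_on ({0..K} \<times> {0..K}) (\<lambda>(u, v). f u v)"
    and F1_00: "f 0 0 = 0" and F1_KK: "f K K = 0"
    and F1_pos: "\<And>u. 0 < u \<Longrightarrow> u < K \<Longrightarrow> f u u > 0"
    and F1_mono: "\<And>u v. u \<in> {0..K} \<Longrightarrow> v \<in> {0..K} \<Longrightarrow> f2 u v \<ge> 0"
    \<comment> \<open>(F2)\<close>
    and F2: "\<exists>M \<sigma>. M > 0 \<and> 0 < \<sigma> \<and> \<sigma> \<le> 1 \<and>
        (\<forall>u\<in>{0..K}. \<forall>v\<in>{0..K}.
           0 \<le> f1 0 0 * u + f2 0 0 * v - f u v \<and>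
           f1 0 0 * u + f2 0 0 * v - f u v \<le> M * (u + v) powr (1 + \<sigma>))"
    and F2_K: "f1 K K + f2 K K < 0"
    \<comment> \<open>(H1)\<close>
    and H1_nonneg: "\<And>x. h x \<ge> 0"
    and H1_even: "\<And>x. h (- x) = h x"
    and H1_int: "integrable lborel h"
    and H1_one: "(LINT x|lborel. h x) = 1"
    \<comment> \<open>(H2)\<close>
    and H2_pos: "lam0 > 0"
    and H2: "\<And>l. ereal l < lam0 \<Longrightarrow> set_integrable lborel {0..} (\<lambda>x. h x * exp (l * x))"
    \<comment> \<open>(c*, \<lambda>*) is the unique pair with c* > 0, \<lambda>* \<in> (0,\<lambda>^+), \<Delta> = 0 = \<partial>_\<lambda> \<Delta>\<close>
    and cstar_pos: "cstar > 0"
    and lamstar_pos: "0 < lamstar" and lamstar_lt: "ereal lamstar < lam_plus (f2 0 0) lam0"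
    and char_zero: "char_fun d \<tau> (f1 0 0) (f2 0 0) h cstar lamstar = 0"
    and char_deriv_zero:
      "((\<lambda>l. char_fun d \<tau> (f1 0 0) (f2 0 0) h cstar l) has_real_derivative 0) (at lamstar)"
    and star_unique: "\<And>c' l'. c' > 0 \<Longrightarrow> 0 < l' \<Longrightarrow> ereal l' < lam_plus (f2 0 0) lam0 \<Longrightarrow>
        char_fun d \<tau> (f1 0 0) (f2 0 0) h c' l' = 0 \<Longrightarrow>
        ((\<lambda>l. char_fun d \<tau> (f1 0 0) (f2 0 0) h c' l) has_real_derivative 0) (at l') \<Longrightarrow>
        c' = cstar \<and> l' = lamstar"
    \<comment> \<open>(c, \<phi>) is a solution with c \<ge> c*\<close>
    and sol: "tw_solution d \<tau> K f h c \<phi>"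
    and c_ge: "c \<ge> cstar"
  shows "(\<exists>\<eta>::real.
            (c > cstar \<longrightarrow>
               ((\<lambda>\<xi>. \<phi> (\<xi> + \<eta>) / exp (lambda1 d \<tau> (f1 0 0) (f2 0 0) h lam0 cstar lamstar c * \<xi>))
                  \<longlongrightarrow> 1) at_bot) \<and>
            (c = cstar \<longrightarrow>
               ((\<lambda>\<xi>. \<phi> (\<xi> + \<eta>) / (- \<xi> * exp (lambda1 d \<tau> (f1 0 0) (f2 0 0) h lam0 cstar lamstar c * \<xi>)))
                  \<longlongrightarrow> 1) at_bot))
         \<and> ((\<lambda>\<xi>. deriv \<phi> \<xi> / \<phi> \<xi>) \<longlongrightarrow> lambda1 d \<tau> (f1 0 0) (f2 0 0) h lam0 cstar lamstar c) at_bot"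
proof -
  obtain M \<sigma> where M: "M > 0" and \<sigma>: "0 < \<sigma>" and F2_lower: "\<And>u v. u \<in> {0..K} \<Longrightarrow> v \<in> {0..K} \<Longrightarrow> 0 \<le> f1 0 0 * u + f2 0 0 * v - f u v"
    and F2_upper: "\<And>u v. u \<in> {0..K} \<Longrightarrow> v \<in> {0..K} \<Longrightarrow> f1 0 0 * u + f2 0 0 * v - f u v \<le> M * (u + v) powr (1 + \<sigma>)"
    using F2 by blast
  define q1 where "q1 = f1 0 0"
  define q2 where "q2 = f2 0 0"
  have q2: "q2 \<ge> 0" using F1_mono[of 0 0] K_pos by (simp add: q2_def)
  note F2_lower = F2_lower[folded q1_def q2_def] and F2_upper = F2_upper[folded q1_def q2_def]
  have c_pos: "c > 0" and phi_diff: "\<And>x. \<phi> differentiable (at x)"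
    and eq: "\<And>x. - c * deriv \<phi> x + d * disc_lap \<phi> x + f (\<phi> x) (conv h \<phi> (x - c * \<tau>)) = 0"
    and phi_bot: "(\<phi> \<longlongrightarrow> 0) at_bot" and phi_top: "(\<phi> \<longlongrightarrow> K) at_top"
    and phi0: "\<And>x. 0 \<le> \<phi> x" and phiK: "\<And>x. \<phi> x \<le> K"
    using sol unfolding tw_solution_def by auto
  have dphi: "(\<phi> has_real_derivative deriv \<phi> x) (at x)" for x
    using phi_diff by (simp add: DERIV_deriv_iff_real_differentiable)
  have phi_cont: "continuous_on UNIV \<phi>"
    using dphi by (meson DERIV_isCont continuous_at_imp_continuous_on)
  have [measurable]: "\<phi> \<in> borel_measurable borel" "h \<in> borel_measurable borel"
    using phi_cont H1_int by (auto intro: borel_measurable_continuous_onI borel_measurable_integrable)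
  define v where "v x = conv h \<phi> (x - c * \<tau>)" for x
  have v: "0 \<le> v x" "v x \<le> K" for x
    unfolding v_def using conv_bounds[OF H1_nonneg H1_int H1_one phi_cont phi0 phiK] by auto
  have phi_in: "\<phi> x \<in> {0..K}" and v_in: "v x \<in> {0..K}" for x using phi0 phiK v by auto
  have f_mono: "f u 0 \<le> f u y" if "u \<in> {0..K}" "y \<in> {0..K}" for u y
    using f2_deriv[OF that(1)] F1_mono[OF that(1)] that
    by (intro le_of_nonneg_derivative_within[where g = "f u" and g' = "f2 u" and K = K]) auto
  \<comment> \<open>A zero would be a minimum, so the derivative vanishes there and, as f(0, v)
    \<ge> f(0, 0) = 0, both neighbours at distance 1 are zeros too; along x + n this contradicts the
    limit K.\<close>
  have phi_pos: "\<phi> x > 0" for x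
  proof (rule ccontr)
    assume "\<not> \<phi> x > 0"
    hence x0: "\<phi> x = 0" using phi0[of x] by simp
    have step: "\<phi> (y + 1) = 0" if y: "\<phi> y = 0" for y
    proof -
      have "deriv \<phi> y = 0"
        by (rule DERIV_local_min[OF dphi, of 1]) (use phi0 y in auto)
      hence "d * (\<phi> (y + 1) + \<phi> (y - 1)) + f 0 (v y) = 0"
        using eq[of y] y by (simp add: disc_lap_def v_def)
      moreover have "f 0 (v y) \<ge> 0" using f_mono[OF _ v_in[of y], of 0] F1_00 K_pos by simp
      ultimately have "d * (\<phi> (y + 1) + \<phi> (y - 1)) \<le> 0" by linarith
      thus ?thesis using d_pos phi0[of "y + 1"] phi0[of "y - 1"] by (simp add: mult_le_0_iff)
    qed
    have zero: "\<phi> (x + real n) = 0" for n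
    proof (induction n)
      case (Suc n)
      show ?case using step[OF Suc.IH] by (simp add: add_ac)
    qed (use x0 in simp)
    have "filterlim (\<lambda>n. x + real n) at_top sequentially"
      by (rule filterlim_tendsto_add_at_top[OF tendsto_const filterlim_real_sequentially])
    from filterlim_compose[OF phi_top this] have "(\<lambda>n. 0) \<longlonglongrightarrow> K" by (simp add: zero)
    thus False using K_pos by (simp add: LIMSEQ_const_iff)
  qed
  \<comment> \<open>A real number between \<open>lamstar\<close> and the possibly infinite
    \<open>lam_plus\<close>; all spectral statements are made for |a| < \<Lambda>.\<close>
  obtain \<Lambda> where \<Lambda>: "lamstar < \<Lambda>" "ereal \<Lambda> < lam_plus q2 lam0"
    using ereal_dense2[OF lamstar_lt] unfolding q2_def by auto
  have Lam_lt: "ereal l < lam_plus q2 lam0" if "l < \<Lambda>" for l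
    using that \<Lambda>(2) by (meson ereal_less_eq(3) less_imp_le order.strict_trans1)
  \<comment> \<open>The factor \<open>q2\<close> stays inside: for q2 = 0 the bound
    \<open>lam_plus\<close> is infinite and \<open>h\<close> may have no exponential moment at
    l.\<close>
  have h_exp: "integrable lborel (\<lambda>y. q2 * (h y * exp (l * y)))" if l: "\<bar>l\<bar> < \<Lambda>" for l
  proof (cases "q2 = 0")
    case False
    hence "ereal \<bar>l\<bar> < lam0" using Lam_lt[OF l] q2 by (simp add: lam_plus_def)
    thus ?thesis by (intro integrable_mult_right even_exp_moment_integrable H1_nonneg H1_even H2) auto
  qed simp
  obtain \<rho> :: "real measure" where sets_rho: "sets \<rho> = sets borel"
    and rho_int: "\<And>F. F \<in> borel_measurable borel \<Longrightarrow>
      integrable \<rho> F \<longleftrightarrow> integrable lborel (\<lambda>y. q2 * h y * F (- y - c * \<tau>))"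
    and rho_integral: "\<And>F. F \<in> borel_measurable borel \<Longrightarrow> integrable \<rho> F \<Longrightarrow>
      (\<integral>\<alpha>. F \<alpha> \<partial>\<rho>) = d * F 1 + d * F (- 1) + (\<integral>y. q2 * h y * F (- y - c * \<tau>) \<partial>lborel)"
    using atoms_plus_density_measure[of d "\<lambda>y. q2 * h y" "c * \<tau>"] d_pos q2 H1_nonneg by auto
  have exp_eq: "q2 * h y * exp (l * (- y - c * \<tau>)) = exp (- l * c * \<tau>) * (q2 * (h y * exp (- l * y)))" for l y
    by (simp add: right_diff_distrib exp_diff exp_minus field_simps)
  interpret kernel \<rho> d \<Lambda>
  proof
    show "integrable \<rho> (\<lambda>\<alpha>. exp (l * \<alpha>))" if "\<bar>l\<bar> < \<Lambda>" for l
      using h_exp[of "- l"] that by (subst rho_int) (auto simp: exp_eq)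
    show "d * F 1 \<le> (\<integral>\<alpha>. F \<alpha> \<partial>\<rho>)" if F: "integrable \<rho> F" "\<And>\<alpha>. F \<alpha> \<ge> 0" for F
    proof -
      have m: "F \<in> borel_measurable borel" using F(1) sets_rho by (metis borel_measurable_integrable measurable_cong_sets)
      have "(\<integral>y. q2 * h y * F (- y - c * \<tau>) \<partial>lborel) \<ge> 0"
        using q2 H1_nonneg F(2) by (intro integral_nonneg_AE AE_I2) auto
      moreover have "d * F (- 1) \<ge> 0" using d_pos F(2) by simp
      ultimately show ?thesis using rho_integral[OF m F(1)] by linarith
    qed
  qed (use sets_rho d_pos in auto)
  \<comment> \<open>Splitting off the linear part of f at 0, the equation reads c \<phi>' = d
    \<phi>(x + 1) + d \<phi>(x - 1) + q2 v - (2 d - q1) \<phi> - R.\<close>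
  define b where "b = 2 * d - q1"
  have P_eq: "c * a + b - E a = char_fun d \<tau> q1 q2 h c a" if a: "\<bar>a\<bar> < \<Lambda>" for a
  proof -
    have "E a = d * exp a + d * exp (- a) + (\<integral>y. q2 * h y * exp (a * (- y - c * \<tau>)) \<partial>lborel)"
      unfolding E_def using exp_int[OF a] by (subst rho_integral) auto
    also have "(\<integral>y. q2 * h y * exp (a * (- y - c * \<tau>)) \<partial>lborel) = exp (- a * c * \<tau>) * (q2 * Gfun h a)"
      unfolding exp_eq Gfun_def by simp
    finally show ?thesis by (simp add: char_fun_def b_def algebra_simps)
  qed
  have S_eq: "S 0 \<phi> x = d * \<phi> (x + 1) + d * \<phi> (x - 1) + q2 * v x" for x
  proof -
    have int: "integrable \<rho> (\<lambda>\<alpha>. exp (0 * \<alpha>) * \<phi> (x + \<alpha>))"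
      using phi_cont phi0 phiK \<Lambda> lamstar_pos
      by (intro shift_int[where \<delta> = 0 and C = K]) auto
    have "S 0 \<phi> x = d * \<phi> (x + 1) + d * \<phi> (x + - 1) + (\<integral>y. q2 * (h y * \<phi> (x - c * \<tau> - y)) \<partial>lborel)"
      unfolding S_def using int by (subst rho_integral) (auto simp: algebra_simps)
    thus ?thesis by (simp add: v_def conv_def)
  qed
  define R where "R x = q1 * \<phi> x + q2 * v x - f (\<phi> x) (v x)" for x
  have R0: "R x \<ge> 0" for x unfolding R_def by (rule F2_lower[OF phi_in v_in])
  have S_ge: "q2 * v x \<le> S 0 \<phi> x" for x using S_eq[of x] d_pos phi0 by simp
  have S0: "S 0 \<phi> x \<ge> 0" for x by (rule order_trans[OF _ S_ge]) (use q2 v in simp)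
  \<comment> \<open>The hypothesis bounds R by a power of \<phi> + v. For q2 > 0, v is at most S /
    q2; for q2 = 0 the kernel does not see v, but f(u, v) \<ge> f(u, 0) allows v to be replaced by
    0.\<close>
  define M' where "M' = (if q2 = 0 then M else M * (1 + 1 / q2) powr (1 + \<sigma>))"
  have R_le: "R x \<le> M' * (\<phi> x + S 0 \<phi> x) powr (1 + \<sigma>)" for x
  proof (cases "q2 = 0")
    case True
    have "R x \<le> q1 * \<phi> x + q2 * 0 - f (\<phi> x) 0"
      unfolding R_def using f_mono[OF phi_in v_in, of x x] by (simp add: True)
    also have "\<dots> \<le> M * (\<phi> x + 0) powr (1 + \<sigma>)" using phi_in K_pos by (intro F2_upper) auto
    also have "\<dots> \<le> M' * (\<phi> x + S 0 \<phi> x) powr (1 + \<sigma>)"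
      using True M \<sigma> phi0 S0 by (auto simp: M'_def intro!: mult_left_mono powr_mono2)
    finally show ?thesis .
  next
    case False
    hence q2': "q2 > 0" using q2 by simp
    have "v x \<le> S 0 \<phi> x / q2" using S_ge[of x] q2' by (simp add: pos_le_divide_eq mult.commute)
    hence "\<phi> x + v x \<le> \<phi> x + S 0 \<phi> x / q2" by simp
    also have "\<dots> \<le> (1 + 1 / q2) * (\<phi> x + S 0 \<phi> x)"
      using q2' phi0[of x] S0[of x] by (simp add: distrib_left distrib_right)
    finally have le: "\<phi> x + v x \<le> (1 + 1 / q2) * (\<phi> x + S 0 \<phi> x)" .
    have "R x \<le> M * (\<phi> x + v x) powr (1 + \<sigma>)" unfolding R_def by (rule F2_upper[OF phi_in v_in])
    also have "\<dots> \<le> M * ((1 + 1 / q2) * (\<phi> x + S 0 \<phi> x)) powr (1 + \<sigma>)"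
      using le M \<sigma> phi0[of x] v(1)[of x] by (intro mult_left_mono powr_mono2) auto
    also have "\<dots> = M' * (\<phi> x + S 0 \<phi> x) powr (1 + \<sigma>)"
      using False q2' phi0[of x] S0[of x] by (simp add: M'_def powr_mult)
    finally show ?thesis .
  qed
  \<comment> \<open>Diagonal positivity at K / 2 against the linear upper bound of f. It yields P(0)
    < 0 and a positive limit of R at +infinity.\<close>
  have q_pos: "q1 + q2 > 0"
  proof -
    have "0 < f (K / 2) (K / 2)" using K_pos by (intro F1_pos) auto
    also have "\<dots> \<le> q1 * (K / 2) + q2 * (K / 2)" using F2_lower[of "K / 2" "K / 2"] K_pos by auto
    also have "\<dots> = (q1 + q2) * (K / 2)" by (simp add: distrib_right)
    finally show ?thesis using K_pos by (simp add: zero_less_mult_iff)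
  qed
  \<comment> \<open>Because f(K, K) = 0, R tends to (q1 + q2) K at +infinity.\<close>
  have R_pos: "\<exists>x. R x > 0"
  proof -
    have vK: "(v \<longlongrightarrow> K) at_top"
      unfolding v_def by (rule conv_tendsto[OF H1_nonneg H1_int H1_one phi_cont phi0 phiK phi_top])
    have "((\<lambda>x. (\<lambda>(u, v). f u v) (\<phi> x, v x)) \<longlongrightarrow> (\<lambda>(u, v). f u v) (K, K)) at_top"
      by (rule continuous_on_tendsto_compose[OF F1_cont tendsto_Pair[OF phi_top vK]])
        (use phi_in v_in K_pos in auto)
    hence "((\<lambda>x. f (\<phi> x) (v x)) \<longlongrightarrow> 0) at_top" using F1_KK by simp
    hence "(R \<longlongrightarrow> q1 * K + q2 * K - 0) at_top"
      unfolding R_def[abs_def] by (intro tendsto_intros phi_top vK)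
    moreover have "q1 * K + q2 * K - 0 > 0" using q_pos K_pos by (simp flip: distrib_right)
    ultimately have "\<forall>\<^sub>F x in at_top. R x > 0" by (rule order_tendstoD)
    then obtain x where "\<And>y. y \<ge> x \<Longrightarrow> R y > 0" by (auto simp: eventually_at_top_linorder)
    thus ?thesis by blast
  qed
  define l1 where "l1 = lambda1 d \<tau> q1 q2 h lam0 cstar lamstar c"
  have lamstar_Lam: "\<bar>lamstar\<bar> < \<Lambda>" "0 < \<Lambda>" using \<Lambda> lamstar_pos by auto
  have spectral: "0 < l1 \<and> l1 < \<Lambda> \<and> c * l1 + b = E l1 \<and> (\<forall>a. 0 \<le> a \<longrightarrow> a < l1 \<longrightarrow> c * a + b < E a) \<and>
    (if c = cstar then (\<integral>\<alpha>. exp (l1 * \<alpha>) * \<alpha> \<partial>\<rho>) = c else (\<integral>\<alpha>. exp (l1 * \<alpha>) * \<alpha> \<partial>\<rho>) < c)"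
  proof (cases "c = cstar")
    case True
    have l1: "l1 = lamstar" by (simp add: l1_def lambda1_def True)
    have root: "c * lamstar + b = E lamstar"
      using P_eq[OF lamstar_Lam(1)] char_zero True by (simp add: q1_def q2_def)
    \<comment> \<open>The derivative hypothesis concerns \<open>char_fun\<close>, whose agreement
      with P is known only for |a| < \<Lambda>; equality near \<open>lamstar\<close> transfers
      it.\<close>
    have ev: "\<forall>\<^sub>F a in nhds lamstar. c * a + b - E a = char_fun d \<tau> q1 q2 h cstar a"
    proof (rule eventually_nhds_in_open[THEN eventually_mono])
      show "open {- \<Lambda><..<\<Lambda>}" "lamstar \<in> {- \<Lambda><..<\<Lambda>}" using lamstar_Lam by auto
      show "c * a + b - E a = char_fun d \<tau> q1 q2 h cstar a" if "a \<in> {- \<Lambda><..<\<Lambda>}" for a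
        using P_eq[of a] that True by (auto simp: abs_less_iff)
    qed
    have der: "((\<lambda>a. c * a + b - E a) has_real_derivative 0) (at lamstar)"
      using char_deriv_zero by (subst DERIV_cong_ev[OF refl ev refl]) (simp add: q1_def q2_def)
    show ?thesis unfolding l1
      using double_root[OF lamstar_Lam(1) root der] root lamstar_pos \<Lambda> True by auto
  next
    case False
    hence c_gt: "c > cstar" using c_ge by simp
    have G0: "Gfun h lamstar \<ge> 0"
      unfolding Gfun_def using H1_nonneg by (intro integral_nonneg_AE AE_I2) auto
    \<comment> \<open>For fixed positive rate the characteristic function increases strictly in the
      speed, so for \<open>c > cstar\<close> it is positive at \<open>lamstar\<close>, which then
      serves as \<nu> in \<open>smallest_root\<close>.\<close>
    have "char_fun d \<tau> q1 q2 h cstar lamstar < char_fun d \<tau> q1 q2 h c lamstar"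
    proof -
      have "lamstar * cstar * \<tau> \<le> lamstar * c * \<tau>"
        using c_gt lamstar_pos tau_nonneg by (intro mult_right_mono mult_left_mono) auto
      hence "exp (- lamstar * c * \<tau>) \<le> exp (- lamstar * cstar * \<tau>)" by simp
      hence "q2 * exp (- lamstar * c * \<tau>) * Gfun h lamstar \<le> q2 * exp (- lamstar * cstar * \<tau>) * Gfun h lamstar"
        using q2 G0 by (intro mult_right_mono mult_left_mono)
      moreover have "cstar * lamstar < c * lamstar" using c_gt lamstar_pos by simp
      ultimately show ?thesis unfolding char_fun_def by linarith
    qed
    hence P_star: "c * lamstar + b > E lamstar"
      using P_eq[OF lamstar_Lam(1)] char_zero by (simp add: q1_def q2_def)
    have P_0: "b < E 0"
    proof -
      have "char_fun d \<tau> q1 q2 h c 0 = - q1 - q2" by (simp add: char_fun_def Gfun_def H1_one)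
      hence "b - E 0 = - q1 - q2" using P_eq[of 0] lamstar_Lam(2) by simp
      thus ?thesis using q_pos by linarith
    qed
    obtain \<mu> where \<mu>: "0 < \<mu>" "\<mu> < lamstar" "c * \<mu> + b = E \<mu>"
      "\<And>a. 0 \<le> a \<Longrightarrow> a < \<mu> \<Longrightarrow> c * a + b < E a" "(\<integral>\<alpha>. exp (\<mu> * \<alpha>) * \<alpha> \<partial>\<rho>) < c"
      by (rule smallest_root[OF lamstar_pos \<Lambda>(1) P_0 P_star]) (rule that; assumption)
    have "(LEAST l. 0 < l \<and> ereal l < lam_plus q2 lam0 \<and> char_fun d \<tau> q1 q2 h c l = 0) = \<mu>"
    proof (rule Least_equality)
      have "\<bar>\<mu>\<bar> < \<Lambda>" using \<mu> \<Lambda> by simp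
      thus "0 < \<mu> \<and> ereal \<mu> < lam_plus q2 lam0 \<and> char_fun d \<tau> q1 q2 h c \<mu> = 0"
        using \<mu> P_eq[of \<mu>] Lam_lt[of \<mu>] by simp
      fix y assume y: "0 < y \<and> ereal y < lam_plus q2 lam0 \<and> char_fun d \<tau> q1 q2 h c y = 0"
      show "\<mu> \<le> y"
      proof (rule ccontr)
        assume "\<not> \<mu> \<le> y"
        hence "c * y + b < E y" "\<bar>y\<bar> < \<Lambda>" using y \<mu> \<Lambda> by auto
        thus False using P_eq[of y] y by simp
      qed
    qed
    hence l1: "l1 = \<mu>" using False by (simp add: l1_def lambda1_def)
    show ?thesis unfolding l1 using \<mu> \<Lambda> False by simp
  qed
  interpret wave \<rho> d \<Lambda> c b K M' \<sigma> l1 \<phi> R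
  proof
    show "(\<phi> has_real_derivative (S 0 \<phi> x - b * \<phi> x - R x) / c) (at x)" for x
    proof -
      have "c * deriv \<phi> x = S 0 \<phi> x - b * \<phi> x - R x"
        using eq[of x] unfolding S_eq R_def b_def v_def disc_lap_def by (simp add: algebra_simps)
      hence "deriv \<phi> x = (S 0 \<phi> x - b * \<phi> x - R x) / c" using c_pos by (simp add: field_simps)
      thus ?thesis using dphi[of x] by simp
    qed
    show "(\<integral>\<alpha>. exp (l1 * \<alpha>) * \<alpha> \<partial>\<rho>) \<le> c" using spectral by (auto split: if_splits)
    show "M' \<ge> 0" using M by (simp add: M'_def)
  qed (use c_pos \<sigma> K_pos spectral phi_pos phiK phi_bot R0 R_le R_pos in auto)
  have l1_pos: "l1 > 0" using spectral by blast
  have log_deriv: "((\<lambda>x. deriv \<phi> x / \<phi> x) \<longlongrightarrow> l1) at_bot" by (rule wave_asymptotics(3))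
  have "\<exists>\<eta>. (c > cstar \<longrightarrow> ((\<lambda>\<xi>. \<phi> (\<xi> + \<eta>) / exp (l1 * \<xi>)) \<longlongrightarrow> 1) at_bot) \<and>
      (c = cstar \<longrightarrow> ((\<lambda>\<xi>. \<phi> (\<xi> + \<eta>) / (- \<xi> * exp (l1 * \<xi>))) \<longlongrightarrow> 1) at_bot)"
  proof (cases "c = cstar")
    case True
    then obtain A where "A > 0" "((\<lambda>x. exp (- l1 * x) * \<phi> x / (1 + \<bar>x\<bar>)) \<longlongrightarrow> A) at_bot"
      using wave_asymptotics(2) spectral by auto
    from linear_exp_shift_limit[OF l1_pos this] show ?thesis using True by blast
  next
    case False
    then obtain A where "A > 0" "((\<lambda>x. exp (- l1 * x) * \<phi> x) \<longlongrightarrow> A) at_bot"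
      using wave_asymptotics(1) spectral by auto
    from exp_shift_limit[OF l1_pos this] show ?thesis using False by blast
  qed
  thus ?thesis using log_deriv unfolding l1_def q1_def q2_def by blast
qed

end
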